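(* Let $\mathcal{M}=\mathbb{R}$ or $\mathcal{M}=\mathbb{T}$, with the convention that $M^{2,p}(\mathbb{T})=\mathcal{F}L^p(\mathbb{T})$ and $M^{2,p}_s(\mathbb{T})=\mathcal{F}L^{s,p}(\mathbb{T})$ on the circle. (i) Let $\theta<-\frac12$ and $2\le p\le\infty$. Then $$\|f\|_{MH^{\theta,p}(\mathcal{M})}\sim\|f\|_{M^{2,p}(\mathcal{M})}.$$ (ii) Let $-\frac12\le\theta<0$ and $2\le q<p\le\infty$. Then $$\|f\|_{M^{2,p}(\mathcal{M})}\lesssim\|f\|_{MH^{\theta,p}(\mathcal{M})}\lesssim \|f\|_{M^{2,q}(\mathcal{M})}\qquad\text{and}\qquad \|f\|_{MH^{\theta,p}(\mathcal{M})}\lesssim\|f\|_{M^{2,p}_s(\mathcal{M})},$$ provided that $\frac1q>\frac1p+\frac12+\theta$ and $s>\frac12+\theta$. Here the implicit constants are independent of $f$.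
   Context: $\mathbb{T}=\mathbb{R}/(2\pi\mathbb{Z})$, $\langle\xi\rangle=(1+|\xi|^2)^{1/2}$. $A\lesssim B$ means $A\le CB$ for a constant $C>0$, and $A\sim B$ means $A\lesssim B$ and $B\lesssim A$. The estimates are for all tempered (respectively periodic) distributions $f$, with norms allowed to be $+\infty$; a norm is $+\infty$ if an $L^2$-norm in it is not finite. Fourier transform: $\widehat f(\xi)=\frac1{\sqrt{2\pi}}\int_{\mathbb{R}}f(x)e^{-ix\xi}dx$ for $\xi\in\mathbb{R}$ on $\mathbb{R}$; $\widehat f(\xi)=\frac1{\sqrt{2\pi}}\int_0^{2\pi}f(x)e^{-ix\xi}dx$ for $\xi\in\mathbb{Z}$ on $\mathbb{T}$. The dual group is $\widehat{\mathcal{M}}=\mathbb{R}$ (Lebesgue measure) if $\mathcal{M}=\mathbb{R}$, and $\widehat{\mathcal{M}}=\mathbb{Z}$ (counting measure) if $\mathcal{M}=\mathbb{T}$. Fourier-Lebesgue spaces: $\|f\|_{\mathcal{F}L^{s,p}(\mathcal{M})}=\|\langle\xi\rangle^s\widehat f(\xi)\|_{L^p_\xi(\widehat{\mathcal{M}})}$ and $\mathcal{F}L^p=\mathcal{F}L^{0,p}$. Modulation spaces on $\mathbb{R}$: fix $\psi\in\mathcal{S}(\mathbb{R})$ with $\operatorname{supp}\psi\subset[-1,1]$ and $\sum_{k\in\mathbb{Z}}\psi(\xi-k)\equiv1$; let $\psi_n(D)$ be the Fourier multiplier operator with multiplier $\psi_n(\xi)=\psi(\xi-n)$. Then $\|f\|_{M^{2,p}_s(\mathbb{R})}=\big\|\langle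 n\rangle^s\|\psi_n(D)f\|_{L^2(\mathbb{R})}\big\|_{\ell^p_n(\mathbb{Z})}$ and $M^{2,p}=M^{2,p}_0$. Modulated Sobolev spaces: $\|f\|_{MH^{\theta,p}(\mathcal{M})}=\Big(\sum_{n\in\mathbb{Z}}\|\langle\xi-n\rangle^\theta\widehat f(\xi)\|_{L^2_\xi(\widehat{\mathcal{M}})}^p\Big)^{1/p}$, with the usual modification (supremum over $n$) when $p=\infty$. *)

theory Defs
  imports "HOL-Analysis.Analysis"
begin

datatype line_or_circle = Line | Circle

definition jbracket :: "real \<Rightarrow> real" where
  "jbracket \<xi> = sqrt (1 + \<bar>\<xi>\<bar>\<^sup>2)"

subsection \<open>Norms with values in the extended nonnegative reals\<close>

text \<open>Only meant for positive exponents.\<close>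
definition ennpowr :: "ennreal \<Rightarrow> real \<Rightarrow> ennreal" where
  "ennpowr x a = (if x = \<infinity> then \<infinity> else ennreal (enn2real x powr a))"

text \<open>The norm of \<open>\<ell>\<^sup>p(\<int>)\<close>, for \<open>1 \<le> p \<le> \<infinity>\<close>, of a family that may take the value \<open>\<infinity>\<close>.\<close>
definition lp_norm :: "ereal \<Rightarrow> (int \<Rightarrow> ennreal) \<Rightarrow> ennreal" where
  "lp_norm p a =
    (if p = \<infinity> then (SUP n. a n)
     else ennpowr (\<integral>\<^sup>+ n. ennpowr (a n) (real_of_ereal p) \<partial>count_space UNIV) (1 / real_of_ereal p))"

definition L2_norm_fun :: "(real \<Rightarrow> complex) \<Rightarrow> ennreal" where
  "L2_norm_fun g = ennpowr (\<integral>\<^sup>+ x. ennreal ((cmod (g x))\<^sup>2) \<partial>lborel) (1 / 2)"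

subsection \<open>Smooth functions and distributions\<close>

definition nth_deriv :: "nat \<Rightarrow> (real \<Rightarrow> complex) \<Rightarrow> real \<Rightarrow> complex" where
  "nth_deriv k \<phi> = ((\<lambda>g x. vector_derivative g (at x)) ^^ k) \<phi>"

definition smooth :: "(real \<Rightarrow> complex) \<Rightarrow> bool" where
  "smooth \<phi> \<longleftrightarrow> (\<forall>k x. nth_deriv k \<phi> differentiable (at x))"

definition schwartz :: "(real \<Rightarrow> complex) set" where
  "schwartz = {\<phi>. smooth \<phi> \<and> (\<forall>j k. bounded (range (\<lambda>x. x ^ j *\<^sub>R nth_deriv k \<phi> x)))}"

definition schwartz_seminorm :: "nat \<Rightarrow> nat \<Rightarrow> (real \<Rightarrow> complex) \<Rightarrow> real" where
  "schwartz_seminorm j k \<phi> = (SUP x. cmod (x ^ j *\<^sub>R nth_deriv k \<phi> x))"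

definition smooth_periodic :: "(real \<Rightarrow> complex) set" where
  "smooth_periodic = {\<phi>. smooth \<phi> \<and> (\<forall>x. \<phi> (x + 2 * pi) = \<phi> x)}"

definition periodic_seminorm :: "nat \<Rightarrow> (real \<Rightarrow> complex) \<Rightarrow> real" where
  "periodic_seminorm k \<phi> = (SUP x. cmod (nth_deriv k \<phi> x))"

text \<open>
  A distribution is a functional on all of \<open>real \<Rightarrow> complex\<close> of which only the values on the
  test functions matter: linear on the test functions, and bounded there by finitely many of the
  seminorms.
\<close>
type_synonym functional = "(real \<Rightarrow> complex) \<Rightarrow> complex"

definition linear_functional_on :: "(real \<Rightarrow> complex) set \<Rightarrow> functional \<Rightarrow> bool" where
  "linear_functional_on S u \<longleftrightarrow>
    (\<forall>\<phi>\<in>S. \<forall>\<eta>\<in>S. \<forall>a b. u (\<lambda>x. a * \<phi> x + b * \<eta> x) = a * u \<phi> + b * u \<eta>)"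

definition tempered_distributions :: "functional set" where
  "tempered_distributions =
    {u. linear_functional_on schwartz u \<and>
        (\<exists>C N. \<forall>\<phi>\<in>schwartz. cmod (u \<phi>) \<le> C * (\<Sum>j\<le>N. \<Sum>k\<le>N. schwartz_seminorm j k \<phi>))}"

definition periodic_distributions :: "functional set" where
  "periodic_distributions =
    {u. linear_functional_on smooth_periodic u \<and>
        (\<exists>C N. \<forall>\<phi>\<in>smooth_periodic. cmod (u \<phi>) \<le> C * (\<Sum>k\<le>N. periodic_seminorm k \<phi>))}"

fun distributions :: "line_or_circle \<Rightarrow> functional set" where
  "distributions Line = tempered_distributions"
| "distributions Circle = periodic_distributions"

definition mult_distr :: "(real \<Rightarrow> complex) \<Rightarrow> functional \<Rightarrow> functional" where
  "mult_distr m u = (\<lambda>\<phi>. u (\<lambda>x. m x * \<phi> x))"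

text \<open>
  The \<open>L\<^sup>2(\<real>)\<close>-norm of a tempered distribution. A representing function is unique almost
  everywhere, so the infimum is over at most one value; it is \<open>\<infinity>\<close> if the distribution is not
  given by an \<open>L\<^sup>2\<close>-function.
\<close>
definition L2_norm :: "functional \<Rightarrow> ennreal" where
  "L2_norm u =
    (INF g \<in> {g. g \<in> borel_measurable lborel \<and> L2_norm_fun g < \<infinity> \<and>
                 (\<forall>\<phi>\<in>schwartz. u \<phi> = (\<integral>x. g x * \<phi> x \<partial>lborel))}. L2_norm_fun g)"

subsection \<open>Fourier transform\<close>

definition fourier_fun :: "(real \<Rightarrow> complex) \<Rightarrow> real \<Rightarrow> complex" where
  "fourier_fun \<phi> \<xi> = of_real (1 / sqrt (2 * pi)) * (\<integral>x. \<phi> x * exp (- \<i> * complex_of_real (x * \<xi>)) \<partial>lborel)"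

definition inv_fourier_fun :: "(real \<Rightarrow> complex) \<Rightarrow> real \<Rightarrow> complex" where
  "inv_fourier_fun \<phi> x = of_real (1 / sqrt (2 * pi)) * (\<integral>\<xi>. \<phi> \<xi> * exp (\<i> * complex_of_real (x * \<xi>)) \<partial>lborel)"

definition fourier :: "functional \<Rightarrow> functional" where
  "fourier u = (\<lambda>\<phi>. u (fourier_fun \<phi>))"

definition inv_fourier :: "functional \<Rightarrow> functional" where
  "inv_fourier u = (\<lambda>\<phi>. u (inv_fourier_fun \<phi>))"

definition fourier_multiplier :: "(real \<Rightarrow> complex) \<Rightarrow> functional \<Rightarrow> functional" where
  "fourier_multiplier m f = inv_fourier (mult_distr m (fourier f))"

text \<open>
  A function \<open>g\<close> on the circle acts as the functional sending \<open>\<phi>\<close> to the integral of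
  \<open>g \<phi>\<close> over \<open>[0, 2\<pi>]\<close>.
\<close>
definition fourier_coeff :: "functional \<Rightarrow> int \<Rightarrow> complex" where
  "fourier_coeff f k = of_real (1 / sqrt (2 * pi)) * f (\<lambda>x. exp (- \<i> * complex_of_real (x * of_int k)))"

subsection \<open>Function spaces\<close>

definition modulation_window :: "(real \<Rightarrow> complex) \<Rightarrow> bool" where
  "modulation_window \<psi> \<longleftrightarrow>
    \<psi> \<in> schwartz \<and> closure {\<xi>. \<psi> \<xi> \<noteq> 0} \<subseteq> {-1..1} \<and>
    (\<forall>\<xi>. ((\<lambda>k::int. \<psi> (\<xi> - of_int k)) has_sum 1) UNIV)"

definition FL_norm_circle :: "real \<Rightarrow> ereal \<Rightarrow> functional \<Rightarrow> ennreal" where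
  "FL_norm_circle s p f =
    lp_norm p (\<lambda>k. ennreal (jbracket (of_int k) powr s * cmod (fourier_coeff f k)))"

definition modulation_norm_line :: "(real \<Rightarrow> complex) \<Rightarrow> real \<Rightarrow> ereal \<Rightarrow> functional \<Rightarrow> ennreal" where
  "modulation_norm_line \<psi> s p f =
    lp_norm p (\<lambda>n. ennreal (jbracket (of_int n) powr s) *
                    L2_norm (fourier_multiplier (\<lambda>\<xi>. \<psi> (\<xi> - of_int n)) f))"

text \<open>The norm of \<open>M\<^sup>2\<^sup>,\<^sup>p\<^sub>s\<close>; on the circle this space is by convention the Fourier-Lebesgue space.\<close>
fun M2_norm :: "line_or_circle \<Rightarrow> (real \<Rightarrow> complex) \<Rightarrow> real \<Rightarrow> ereal \<Rightarrow> functional \<Rightarrow> ennreal" where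
  "M2_norm Line \<psi> s p f = modulation_norm_line \<psi> s p f"
| "M2_norm Circle \<psi> s p f = FL_norm_circle s p f"

fun MH_norm :: "line_or_circle \<Rightarrow> real \<Rightarrow> ereal \<Rightarrow> functional \<Rightarrow> ennreal" where
  "MH_norm Line \<theta> p f =
    lp_norm p (\<lambda>n. L2_norm (mult_distr (\<lambda>\<xi>. of_real (jbracket (\<xi> - of_int n) powr \<theta>)) (fourier f)))"
| "MH_norm Circle \<theta> p f =
    lp_norm p (\<lambda>n. lp_norm 2
      (\<lambda>k. ennreal (jbracket (of_int (k - n)) powr \<theta> * cmod (fourier_coeff f k))))"

subsection \<open>Comparison up to constants\<close>

definition lesssim_on :: "'a set \<Rightarrow> ('a \<Rightarrow> ennreal) \<Rightarrow> ('a \<Rightarrow> ennreal) \<Rightarrow> bool" where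
  "lesssim_on D A B \<longleftrightarrow> (\<exists>C>0. \<forall>f\<in>D. A f \<le> ennreal C * B f)"

definition sim_on :: "'a set \<Rightarrow> ('a \<Rightarrow> ennreal) \<Rightarrow> ('a \<Rightarrow> ennreal) \<Rightarrow> bool" where
  "sim_on D A B \<longleftrightarrow> lesssim_on D A B \<and> lesssim_on D B A"

end

theory Submission
  imports Defs "HOL-Probability.Sinc_Integral" "HOL-Probability.Characteristic_Functions" "HOL-Real_Asymp.Real_Asymp"
begin

text \<open>
  Let \<open>M\<^sub>k\<close> be the \<open>L\<^sup>2\<close>-norm of the piece of \<open>f\<close> with frequency near \<open>k\<close> (on the circle, the modulus of the
  \<open>k\<close>-th Fourier coefficient), and \<open>H\<^sub>n\<close> the weighted \<open>L\<^sup>2\<close>-norm of the Fourier transform in the \<open>n\<close>-th term of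
  the modulated Sobolev norm. Since the weight is comparable to a constant near its centre,
  \<open>M\<^sub>n \<lesssim> H\<^sub>n\<close>, which is the first lower bound. Conversely \<open>H\<^sub>n\<^sup>2 \<lesssim> \<Sum>\<^sub>k \<langle>k - n\<rangle>\<^sup>2\<^sup>\<theta> M\<^sub>k\<^sup>2\<close>, so that the upper bounds follow
  from Young's inequality for sequences, because \<open>\<langle>\<cdot>\<rangle>\<^sup>2\<^sup>\<theta>\<close> lies in \<open>\<ell>\<^sup>v\<close> iff \<open>2\<theta>v < -1\<close>, and the bound with weight
  \<open>\<langle>n\<rangle>\<^sup>s\<close> from the embedding of the weighted \<open>\<ell>\<^sup>p\<close> into a suitable \<open>\<ell>\<^sup>q\<close>.

  On the line both inequalities between \<open>M\<close> and \<open>H\<close> need Plancherel's theorem to pass from \<open>\<psi>\<^sub>n(D) f\<close> to its Fourier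
  transform. It is obtained by Gaussian regularization, as an inequality, which is all that is used.
  The second one also needs that a tempered distribution is the limit of its frequency-localized pieces.
\<close>

text \<open>All norms live in \<open>ennreal\<close>, and \<open>L2_norm\<close> is an infimum over
  representing functions, infinite when there is none. An estimate with \<open>L2_norm\<close> on
  its right-hand side therefore treats arbitrary representatives. The bound of H by M has to choose
  them for all pieces at once; it takes near-optimal ones and pays errors proportional to <k>^-2,
  which are summable and are then sent to 0. A representative of the Fourier transform of a piece is
  at first only known to be square integrable. Multiplying it by a wider window that is 1 on the
  support of \<psi> leaves the distribution unchanged and makes it vanish at distance more than 3
  from k, so that at most 7 pieces overlap. Squaring turns the l^p norm of H into the l^(p/2) norm
  of a convolution. With 1/v = 1 + 2/p - 2/q the condition 2\<theta>v < -1 is exactly 1/q > 1/p +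
  1/2 + \<theta>. For the weighted bound one passes through l^(1/\<kappa>) with 1/p + 1/2 + \<theta>
  < \<kappa> < 1/p + s.\<close>

section \<open>Young's inequality for sequences with values in the extended nonnegative reals\<close>

text \<open>Unlike \<^const>\<open>ennpowr\<close>, this power is additive in the exponent on all of \<open>[0, \<infinity>)\<close>.\<close>
definition epowr :: "ennreal \<Rightarrow> real \<Rightarrow> ennreal" where
  "epowr x a = (if a = 0 then 1 else ennpowr x a)"

lemma ennpowr_eq_epowr: "a > 0 \<Longrightarrow> ennpowr x a = epowr x a"
  by (simp add: epowr_def)

lemma epowr_0 [simp]: "a > 0 \<Longrightarrow> epowr 0 a = 0"
  and epowr_zero_exp [simp]: "epowr x 0 = 1"
  and epowr_top [simp]: "a > 0 \<Longrightarrow> epowr top a = top"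
  by (simp_all add: epowr_def ennpowr_def)

lemma epowr_ennreal: "x > 0 \<Longrightarrow> a \<ge> 0 \<Longrightarrow> epowr (ennreal x) a = ennreal (x powr a)"
  by (simp add: epowr_def ennpowr_def)

lemma epowr_cases [case_names zero top pos]:
  fixes x :: ennreal
  assumes "x = 0 \<Longrightarrow> P" "x = top \<Longrightarrow> P" "\<And>r. r > 0 \<Longrightarrow> x = ennreal r \<Longrightarrow> P"
  shows P
  using assms by (cases x) (force simp: less_le)+

lemma epowr_1 [simp]: "epowr x 1 = x"
  by (cases x rule: epowr_cases) (auto simp: epowr_ennreal)

lemma epowr_one [simp]: "a \<ge> 0 \<Longrightarrow> epowr 1 a = 1"
  using epowr_ennreal[of 1 a] by simp

lemma epowr_mono:
  assumes "x \<le> y" "a \<ge> 0"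
  shows "epowr x a \<le> epowr y a"
proof (cases "a = 0")
  case False
  then show ?thesis
    using assms
    by (cases x rule: epowr_cases; cases y rule: epowr_cases)
       (auto simp: epowr_ennreal ennreal_leI powr_mono2 top_unique)
qed simp

lemma epowr_mult:
  assumes "a \<ge> 0"
  shows "epowr (x * y) a = epowr x a * epowr y a"
proof (cases "a = 0")
  case False
  then have "a > 0" using assms by simp
  then show ?thesis
    by (cases x rule: epowr_cases; cases y rule: epowr_cases)
       (auto simp: epowr_ennreal powr_mult ennreal_mult_top ennreal_top_mult simp flip: ennreal_mult)
qed simp

lemma epowr_add:
  assumes "a \<ge> 0" "b \<ge> 0"
  shows "epowr x (a + b) = epowr x a * epowr x b"
proof (cases "a = 0 \<or> b = 0")
  case False
  then have "a > 0" "b > 0" using assms by auto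
  then show ?thesis
    by (cases x rule: epowr_cases)
       (auto simp: epowr_ennreal powr_add simp flip: ennreal_mult)
qed auto

lemma epowr_epowr:
  assumes "a \<ge> 0" "b \<ge> 0"
  shows "epowr (epowr x a) b = epowr x (a * b)"
proof (cases "a = 0 \<or> b = 0")
  case False
  then have "a > 0" "b > 0" using assms by auto
  then show ?thesis
    by (cases x rule: epowr_cases) (auto simp: epowr_ennreal powr_powr)
qed (use assms in auto)

lemma epowr_2: "epowr x 2 = x\<^sup>2"
  using epowr_add[of 1 1 x] by (simp add: power2_eq_square)

lemma epowr_eq_0: "epowr x a = 0 \<longleftrightarrow> x = 0 \<and> a \<noteq> 0" if "a \<ge> 0"
  using that by (cases "a = 0"; cases x rule: epowr_cases) (auto simp: epowr_ennreal)

lemma epowr_less_top: "x < top \<Longrightarrow> a \<ge> 0 \<Longrightarrow> epowr x a < top"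
  by (cases "a = 0"; cases x rule: epowr_cases) (auto simp: epowr_ennreal)

lemma epowr_le_iff: "epowr x a \<le> y \<longleftrightarrow> x \<le> epowr y (1 / a)" if "a > 0"
proof
  assume "epowr x a \<le> y"
  then have "epowr (epowr x a) (1 / a) \<le> epowr y (1 / a)"
    using that by (intro epowr_mono) auto
  then show "x \<le> epowr y (1 / a)" using that by (simp add: epowr_epowr)
next
  assume "x \<le> epowr y (1 / a)"
  then have "epowr x a \<le> epowr (epowr y (1 / a)) a"
    using that by (intro epowr_mono) auto
  then show "epowr x a \<le> y" using that by (simp add: epowr_epowr)
qed

lemma weighted_am_gm_ennreal:
  fixes x y :: ennreal
  assumes "\<alpha> > 0" "\<beta> > 0" "\<alpha> + \<beta> = 1"
  shows "epowr x \<alpha> * epowr y \<beta> \<le> ennreal \<alpha> * x + ennreal \<beta> * y"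
proof (cases x rule: epowr_cases)
  case (pos r)
  show ?thesis
  proof (cases y rule: epowr_cases)
    case (pos s)
    then have "r powr \<alpha> * s powr \<beta> \<le> \<alpha> * r + \<beta> * s"
      using \<open>r > 0\<close> assms by (intro Youngs_inequality_0) auto
    then show ?thesis
      using assms pos \<open>r > 0\<close> \<open>x = ennreal r\<close>
      by (simp add: epowr_ennreal ennreal_leI flip: ennreal_mult ennreal_plus)
  qed (use assms pos in \<open>auto simp: ennreal_mult_top\<close>)
qed (use assms in \<open>auto simp: ennreal_mult_top\<close>)

text \<open>The exponents are the reciprocals of the usual ones, so that 0 stands for an infinite
  exponent. Once both integrals are normalized to 1, the weighted AM-GM inequality integrates to
  \<alpha> + \<beta> = 1; the integrals 0 and \<open>top\<close> cannot be divided out and are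
  treated first.\<close>

lemma Hoelder_nn_integral:
  assumes [measurable]: "f \<in> borel_measurable M" "g \<in> borel_measurable M"
    and meas [measurable]: "(\<lambda>x. epowr (f x) \<alpha>) \<in> borel_measurable M" "(\<lambda>x. epowr (g x) \<beta>) \<in> borel_measurable M"
    and ab: "\<alpha> \<ge> 0" "\<beta> \<ge> 0" "\<alpha> + \<beta> = 1"
  shows "(\<integral>\<^sup>+x. epowr (f x) \<alpha> * epowr (g x) \<beta> \<partial>M) \<le> epowr (\<integral>\<^sup>+x. f x \<partial>M) \<alpha> * epowr (\<integral>\<^sup>+x. g x \<partial>M) \<beta>"
proof (cases "\<alpha> = 0 \<or> \<beta> = 0")
  case False
  then have ab': "\<alpha> > 0" "\<beta> > 0" using ab by auto
  define F where "F = (\<integral>\<^sup>+x. f x \<partial>M)"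
  define G where "G = (\<integral>\<^sup>+x. g x \<partial>M)"
  consider "F = 0 \<or> G = 0" | "F \<noteq> 0 \<and> G \<noteq> 0 \<and> (F = top \<or> G = top)"
    | "F \<noteq> 0" "G \<noteq> 0" "F \<noteq> top" "G \<noteq> top" by blast
  then show ?thesis
  proof cases
    \<comment> \<open>One factor vanishes almost everywhere, and 0 * \<open>top\<close> = 0 keeps
      the product 0 even where the other factor is infinite.\<close>
    case 1
    then have "(AE x in M. f x = 0) \<or> (AE x in M. g x = 0)"
      unfolding F_def G_def by (subst (asm) (1 2) nn_integral_0_iff_AE) auto
    then have "AE x in M. epowr (f x) \<alpha> * epowr (g x) \<beta> = 0"
      using ab' by auto
    then have "(\<integral>\<^sup>+x. epowr (f x) \<alpha> * epowr (g x) \<beta> \<partial>M) = 0"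
      by (subst nn_integral_0_iff_AE) auto
    then show ?thesis by simp
  next
    case 2
    then have "epowr F \<alpha> * epowr G \<beta> = top"
      using ab' ab by (auto simp: ennreal_mult_eq_top_iff epowr_eq_0)
    then show ?thesis by (simp add: F_def G_def)
  next
    case 3
    then obtain F' G' where F': "F = ennreal F'" "F' > 0" and G': "G = ennreal G'" "G' > 0"
      by (metis epowr_cases)
    have "(\<integral>\<^sup>+x. epowr (f x) \<alpha> * epowr (g x) \<beta> \<partial>M)
        = (\<integral>\<^sup>+x. epowr F \<alpha> * epowr G \<beta> * (epowr (f x / F) \<alpha> * epowr (g x / G) \<beta>) \<partial>M)"
    proof (intro nn_integral_cong)
      fix x
      have "f x = F * (f x / F)"
        using 3 by (simp add: ennreal_times_divide mult_divide_eq_ennreal mult.commute[of F])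
      then have f: "epowr (f x) \<alpha> = epowr F \<alpha> * epowr (f x / F) \<alpha>"
        using ab(1) epowr_mult by metis
      have "g x = G * (g x / G)"
        using 3 by (simp add: ennreal_times_divide mult_divide_eq_ennreal mult.commute[of G])
      then have g: "epowr (g x) \<beta> = epowr G \<beta> * epowr (g x / G) \<beta>"
        using ab(2) epowr_mult by metis
      show "epowr (f x) \<alpha> * epowr (g x) \<beta>
        = epowr F \<alpha> * epowr G \<beta> * (epowr (f x / F) \<alpha> * epowr (g x / G) \<beta>)"
        by (subst f, subst g) (simp only: mult_ac)
    qed
    also have "\<dots> \<le> (\<integral>\<^sup>+x. epowr F \<alpha> * epowr G \<beta> * (ennreal \<alpha> * (f x / F) + ennreal \<beta> * (g x / G)) \<partial>M)"
      using weighted_am_gm_ennreal[OF ab' ab(3)]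
      by (intro nn_integral_mono mult_left_mono) auto
    also have "\<dots> = epowr F \<alpha> * epowr G \<beta> * (ennreal \<alpha> * (F / F) + ennreal \<beta> * (G / G))"
      by (simp add: nn_integral_cmult nn_integral_add nn_integral_divide F_def G_def)
    also have "\<dots> = epowr F \<alpha> * epowr G \<beta>"
      using 3 ab by (simp add: ennreal_divide_self top.not_eq_extremum flip: ennreal_plus)
    finally show ?thesis unfolding F_def G_def .
  qed
qed (use ab in auto)

abbreviation ennreal_sum :: "('a \<Rightarrow> ennreal) \<Rightarrow> ennreal"  (binder "\<Sum>\<^sup>+" 10) where
  "\<Sum>\<^sup>+k. f k \<equiv> (\<integral>\<^sup>+k. f k \<partial>count_space UNIV)"

lemma Hoelder_sum:
  fixes f g :: "'a \<Rightarrow> ennreal"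
  assumes "\<alpha> \<ge> 0" "\<beta> \<ge> 0" "\<alpha> + \<beta> = 1"
  shows "(\<Sum>\<^sup>+x. epowr (f x) \<alpha> * epowr (g x) \<beta>)
      \<le> epowr (\<Sum>\<^sup>+x. f x) \<alpha> * epowr (\<Sum>\<^sup>+x. g x) \<beta>"
  using assms by (intro Hoelder_nn_integral) auto

text \<open>The two-factor inequality is used twice: the last two factors are grouped under the
  exponent \<delta> = \<beta> + \<gamma> and then separated. Dividing by \<delta> forces the case
  distinction.\<close>

lemma Hoelder_sum3:
  fixes f g h :: "'a \<Rightarrow> ennreal"
  assumes "\<alpha> \<ge> 0" "\<beta> \<ge> 0" "\<gamma> \<ge> 0" "\<alpha> + \<beta> + \<gamma> = 1"
  shows "(\<Sum>\<^sup>+x. epowr (f x) \<alpha> * epowr (g x) \<beta> * epowr (h x) \<gamma>)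
      \<le> epowr (\<Sum>\<^sup>+x. f x) \<alpha> * epowr (\<Sum>\<^sup>+x. g x) \<beta>
         * epowr (\<Sum>\<^sup>+x. h x) \<gamma>"
proof (cases "\<beta> + \<gamma> = 0")
  case True
  then have "\<beta> = 0" "\<gamma> = 0" "\<alpha> = 1" using assms by auto
  then show ?thesis by simp
next
  case False
  define \<delta> where "\<delta> = \<beta> + \<gamma>"
  have \<delta>: "\<delta> > 0" using False assms by (simp add: \<delta>_def)
  have "(\<Sum>\<^sup>+x. epowr (f x) \<alpha> * epowr (g x) \<beta> * epowr (h x) \<gamma>)
     = (\<Sum>\<^sup>+x. epowr (f x) \<alpha> * epowr (epowr (g x) (\<beta> / \<delta>) * epowr (h x) (\<gamma> / \<delta>)) \<delta>)"
    using assms \<delta> by (simp add: epowr_mult epowr_epowr mult.assoc)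
  also have "\<dots> \<le> epowr (\<Sum>\<^sup>+x. f x) \<alpha>
      * epowr (\<Sum>\<^sup>+x. epowr (g x) (\<beta> / \<delta>) * epowr (h x) (\<gamma> / \<delta>)) \<delta>"
    using assms \<delta> by (intro Hoelder_sum) (auto simp: \<delta>_def)
  also have "\<dots> \<le> epowr (\<Sum>\<^sup>+x. f x) \<alpha>
      * epowr (epowr (\<Sum>\<^sup>+x. g x) (\<beta> / \<delta>) * epowr (\<Sum>\<^sup>+x. h x) (\<gamma> / \<delta>)) \<delta>"
    using assms \<delta>
    by (intro mult_left_mono epowr_mono Hoelder_sum) (auto simp: \<delta>_def simp flip: add_divide_distrib)
  also have "\<dots> = epowr (\<Sum>\<^sup>+x. f x) \<alpha> * epowr (\<Sum>\<^sup>+x. g x) \<beta>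
         * epowr (\<Sum>\<^sup>+x. h x) \<gamma>"
    using assms \<delta> by (simp add: epowr_mult epowr_epowr mult.assoc)
  finally show ?thesis .
qed

lemma nn_integral_count_shift:
  fixes f :: "int \<Rightarrow> ennreal"
  shows "(\<Sum>\<^sup>+k. f (k - n)) = (\<Sum>\<^sup>+k. f k)"
    and "(\<Sum>\<^sup>+n. f (k - n)) = (\<Sum>\<^sup>+k. f k)"
proof -
  have "bij (\<lambda>k. k - n)"
    by (rule bij_betw_byWitness[where f' = "\<lambda>k. k + n"]) auto
  then show "(\<Sum>\<^sup>+k. f (k - n)) = (\<Sum>\<^sup>+k. f k)"
    by (rule nn_integral_bij_count_space)
  have "bij (\<lambda>n. k - n)"
    by (rule bij_betw_byWitness[where f' = "\<lambda>n. k - n"]) auto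
  then show "(\<Sum>\<^sup>+n. f (k - n)) = (\<Sum>\<^sup>+k. f k)"
    by (rule nn_integral_bij_count_space)
qed

lemma nn_integral_count_swap:
  fixes f :: "int \<Rightarrow> int \<Rightarrow> ennreal"
  shows "(\<Sum>\<^sup>+n. (\<Sum>\<^sup>+k. f n k))
       = (\<Sum>\<^sup>+k. (\<Sum>\<^sup>+n. f n k))"
proof -
  interpret pair_sigma_finite "count_space (UNIV :: int set)" "count_space (UNIV :: int set)"
    by (simp add: pair_sigma_finite_def sigma_finite_measure_count_space)
  have "(\<lambda>(n, k). f n k) \<in> borel_measurable (count_space (UNIV :: int set) \<Otimes>\<^sub>M count_space (UNIV :: int set))"
    by (simp add: pair_measure_countable)
  from Fubini'[OF this] show ?thesis by simp
qed

text \<open>The exponent \<open>\<alpha>\<close> is \<open>1 / r\<close>; the value \<open>\<alpha> = 0\<close> is Hoelder's inequality, i.e. \<open>r = \<infinity>\<close>.\<close>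
lemma Young_pointwise:
  fixes w b :: "int \<Rightarrow> ennreal"
  assumes vt: "v > 0" "t > 0" and ex: "0 \<le> \<alpha>" "\<alpha> \<le> 1 / v" "\<alpha> \<le> 1 / t" "1 / v + 1 / t = 1 + \<alpha>"
  shows "(\<Sum>\<^sup>+k. w (k - n) * b k)
    \<le> epowr (\<Sum>\<^sup>+k. epowr (w (k - n)) v * epowr (b k) t) \<alpha>
      * epowr (\<Sum>\<^sup>+k. epowr (w k) v) (1 / v - \<alpha>)
      * epowr (\<Sum>\<^sup>+k. epowr (b k) t) (1 / t - \<alpha>)"
proof -
  \<comment> \<open>Each factor is split so that the product w^v b^t appears with exponent \<alpha>.
    The three exponents \<alpha>, 1/v - \<alpha> and 1/t - \<alpha> add up to 1 by the relation
    between v, t and \<alpha>.\<close>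
  have "w (k - n) * b k = epowr (epowr (w (k - n)) v * epowr (b k) t) \<alpha>
      * epowr (epowr (w (k - n)) v) (1 / v - \<alpha>) * epowr (epowr (b k) t) (1 / t - \<alpha>)" for k
  proof -
    have *: "epowr (epowr x u) \<alpha> * epowr (epowr x u) (1 / u - \<alpha>) = x" if "u > 0" "\<alpha> \<le> 1 / u" for x u
      using that ex by (subst epowr_add[symmetric]) (auto simp: epowr_epowr)
    show ?thesis
      using ex by (subst (1) *[OF vt(1) ex(2), symmetric], subst (1) *[OF vt(2) ex(3), symmetric])
        (simp add: epowr_mult mult_ac)
  qed
  then show ?thesis
    using ex Hoelder_sum3[of \<alpha> "1 / v - \<alpha>" "1 / t - \<alpha>"
        "\<lambda>k. epowr (w (k - n)) v * epowr (b k) t" "\<lambda>k. epowr (w (k - n)) v" "\<lambda>k. epowr (b k) t"]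
    by (simp add: nn_integral_count_shift(1)[of "\<lambda>k. epowr (w k) v"])
qed

text \<open>The pointwise bound is raised to the power r. Its only factor depending on n is then S n
  to the first power, and by Tonelli S sums to W * B; this completes the exponents r/v - 1 and r/t -
  1 to r/v and r/t.\<close>

lemma Young_sum:
  fixes w b :: "int \<Rightarrow> ennreal"
  assumes vt: "v > 0" "t > 0" "r > 0" and ex: "1 / r \<le> 1 / v" "1 / r \<le> 1 / t" "1 / v + 1 / t = 1 + 1 / r"
  shows "(\<Sum>\<^sup>+n. epowr (\<Sum>\<^sup>+k. w (k - n) * b k) r)
    \<le> epowr (\<Sum>\<^sup>+k. epowr (w k) v) (r / v)
      * epowr (\<Sum>\<^sup>+k. epowr (b k) t) (r / t)"
proof -
  define W where "W = (\<Sum>\<^sup>+k. epowr (w k) v)"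
  define B where "B = (\<Sum>\<^sup>+k. epowr (b k) t)"
  define S where "S n = (\<Sum>\<^sup>+k. epowr (w (k - n)) v * epowr (b k) t)" for n
  have "epowr (\<Sum>\<^sup>+k. w (k - n) * b k) r
      \<le> epowr (epowr (S n) (1 / r) * epowr W (1 / v - 1 / r) * epowr B (1 / t - 1 / r)) r" for n
    unfolding S_def W_def B_def using assms by (intro epowr_mono Young_pointwise) auto
  moreover have "epowr (epowr (S n) (1 / r) * epowr W (1 / v - 1 / r) * epowr B (1 / t - 1 / r)) r
      = S n * (epowr W (r / v - 1) * epowr B (r / t - 1))" for n
    using assms by (simp add: epowr_mult epowr_epowr left_diff_distrib mult.assoc)
  ultimately have "(\<Sum>\<^sup>+n. epowr (\<Sum>\<^sup>+k. w (k - n) * b k) r)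
     \<le> (\<Sum>\<^sup>+n. S n * (epowr W (r / v - 1) * epowr B (r / t - 1)))"
    by (intro nn_integral_mono) metis
  also have "\<dots> = (\<Sum>\<^sup>+n. S n) * (epowr W (r / v - 1) * epowr B (r / t - 1))"
    by (simp add: nn_integral_multc)
  also have "(\<Sum>\<^sup>+n. S n) = W * B"
    unfolding S_def
    by (subst nn_integral_count_swap)
       (simp add: nn_integral_multc nn_integral_cmult W_def B_def nn_integral_count_shift(2)[of "\<lambda>k. epowr (w k) v"])
  also have "W * B * (epowr W (r / v - 1) * epowr B (r / t - 1))
      = (epowr W 1 * epowr W (r / v - 1)) * (epowr B 1 * epowr B (r / t - 1))"
    by (simp add: mult_ac)
  also have "\<dots> = epowr W (r / v) * epowr B (r / t)"
    using assms by (subst (1 2) epowr_add[symmetric]) (auto simp: field_simps)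
  finally show ?thesis unfolding W_def B_def .
qed

section \<open>The Japanese bracket and the summability of its powers over the integers\<close>

lemma jbracket_ge_1: "jbracket x \<ge> 1"
  and jbracket_pos: "jbracket x > 0"
  and jbracket_ge_abs: "\<bar>x\<bar> \<le> jbracket x"
  and jbracket_minus [simp]: "jbracket (- x) = jbracket x"
  and jbracket_0 [simp]: "jbracket 0 = 1"
  by (auto simp: jbracket_def real_le_rsqrt add_pos_nonneg)

text \<open>The two closed half-lines cover the integers and overlap in 0, hence an inequality
  rather than an equality. It brings sums over the integers down to series over the
  naturals.\<close>

lemma nn_integral_count_int_even:
  fixes f :: "int \<Rightarrow> ennreal"
  assumes "\<And>k. f (- k) = f k"
  shows "(\<Sum>\<^sup>+k. f k) \<le> 2 * (\<Sum>\<^sup>+n. f (int n))"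
proof -
  have "(\<Sum>\<^sup>+k. f k)
      \<le> (\<Sum>\<^sup>+k. f k * indicator {0..} k + f k * indicator {..0} k)"
    by (intro nn_integral_mono) (auto simp: indicator_def)
  also have "\<dots> = (\<Sum>\<^sup>+k. f k * indicator {0..} k) + (\<Sum>\<^sup>+k. f k * indicator {..0} k)"
    by (simp add: nn_integral_add)
  also have "(\<Sum>\<^sup>+k. f k * indicator {0..} k) = (\<integral>\<^sup>+k. f k \<partial>count_space {0..})"
    by (subst nn_integral_count_space_indicator) auto
  also have "\<dots> = (\<Sum>\<^sup>+n. f (int n))"
    by (rule nn_integral_bij_count_space[symmetric])
       (rule bij_betw_byWitness[where f' = nat], auto)
  also have "(\<Sum>\<^sup>+k. f k * indicator {..0} k) = (\<integral>\<^sup>+k. f k \<partial>count_space {..0})"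
    by (subst nn_integral_count_space_indicator) auto
  also have "\<dots> = (\<Sum>\<^sup>+n. f (- int n))"
    by (rule nn_integral_bij_count_space[symmetric])
       (rule bij_betw_byWitness[where f' = "\<lambda>k. nat (- k)"], auto)
  finally show ?thesis using assms by (simp add: mult_2)
qed

lemma sum_jbracket_powr_finite:
  assumes "a < -1"
  shows "(\<Sum>\<^sup>+k. ennreal (jbracket (of_int (k::int)) powr a)) < top"
proof -
  have "summable (\<lambda>n. real n powr a)"
    using assms by (simp add: summable_real_powr_iff)
  then have "summable (\<lambda>n. jbracket (real n) powr a)"
  \<comment> \<open>The comparison starts at 1 because \<open>0 powr a\<close> is 0 while the
    bracket of 0 is 1.\<close>
  proof (rule summable_comparison_test'[where N = 1])
    fix n :: nat assume "n \<ge> 1"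
    then show "norm (jbracket (real n) powr a) \<le> real n powr a"
      using jbracket_ge_abs[of "real n"] assms by (auto intro!: powr_mono2')
  qed
  then have "(\<Sum>\<^sup>+n. ennreal (jbracket (real n) powr a)) < top"
    by (simp add: nn_integral_count_space_nat suminf_ennreal2 top.not_eq_extremum[symmetric])
  then show ?thesis
    using nn_integral_count_int_even[of "\<lambda>k. ennreal (jbracket (of_int k) powr a)"]
    by (auto simp: ennreal_mult_less_top intro: le_less_trans)
qed

section \<open>Mixed norms of Peetre-type averages\<close>

text \<open>The relation between weighted norms H and local norms a from which all upper bounds
  follow. Stated for bare sequences, it lets the line and the circle share the sequence-space part;
  the bounds below provide one constant for all pairs H, a.\<close>

definition peetre_dominated :: "real \<Rightarrow> real \<Rightarrow> (int \<Rightarrow> ennreal) \<Rightarrow> (int \<Rightarrow> ennreal) \<Rightarrow> bool" where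
  "peetre_dominated \<theta> C H a \<longleftrightarrow>
    (\<forall>n. (H n)\<^sup>2 \<le> ennreal C * (\<Sum>\<^sup>+k. ennreal (jbracket (of_int (k - n)) powr (2 * \<theta>)) * (a k)\<^sup>2))"

lemma lp_norm_finite: "P > 0 \<Longrightarrow> lp_norm (ereal P) a = epowr (\<Sum>\<^sup>+n. epowr (a n) P) (1 / P)"
  by (simp add: lp_norm_def ennpowr_eq_epowr)

lemma lp_norm_PInf: "lp_norm \<infinity> a = (SUP n. a n)"
  by (simp add: lp_norm_def)

lemma lp_norm_mono:
  assumes "p \<ge> 2" "\<And>n. a n \<le> b n"
  shows "lp_norm p a \<le> lp_norm p b"
proof (cases p)
  case (real P)
  then show ?thesis
    using assms by (auto simp: lp_norm_finite intro!: epowr_mono nn_integral_mono)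
qed (use assms in \<open>auto simp: lp_norm_PInf intro!: SUP_mono'\<close>)

lemma lp_norm_cmult:
  assumes "p \<ge> 2"
  shows "lp_norm p (\<lambda>n. c * a n) = c * lp_norm p a"
proof (cases p)
  case (real P)
  then have "P > 0" using assms by auto
  then show ?thesis
    by (simp add: real lp_norm_finite epowr_mult nn_integral_cmult epowr_epowr)
qed (use assms in \<open>auto simp: lp_norm_PInf SUP_mult_left_ennreal\<close>)

text \<open>Constants arise as finite extended reals that may be 0, whereas
  \<open>lesssim_on\<close> asks for a positive real.\<close>

lemma bound_by_positive_real:
  fixes K :: ennreal
  assumes "K < top"
  obtains C :: real where "C > 0" "K \<le> ennreal C"
proof
  show "max 1 (enn2real K) > 0" by simp
  show "K \<le> ennreal (max 1 (enn2real K))"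
    using assms by (metis ennreal_enn2real ennreal_leI max.cobounded2)
qed

lemma epowr_jbracket: "v > 0 \<Longrightarrow> epowr (ennreal (jbracket x powr a)) v = ennreal (jbracket x powr (a * v))"
  using jbracket_pos[of x] by (simp add: epowr_ennreal powr_powr)

text \<open>The squares of H are dominated by a convolution with the squares of a, so the exponents
  2r and 2t become r and t in Young's inequality. The condition on \<theta> and v says that the
  weight lies in l^v.\<close>

lemma peetre_dominated_lp:
  assumes rt: "1 \<le> t" "t \<le> r" and v: "1 / v + 1 / t = 1 + 1 / r" "2 * \<theta> * v < -1" "v > 0"
  shows "\<exists>C'>0. \<forall>H a. peetre_dominated \<theta> C H a \<longrightarrow> lp_norm (ereal (2 * r)) H \<le> ennreal C' * lp_norm (ereal (2 * t)) a"
proof -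
  define w where "w k = ennreal (jbracket (of_int k) powr (2 * \<theta>))" for k :: int
  define W where "W = (\<Sum>\<^sup>+k. epowr (w k) v)"
  have "W < top"
    unfolding W_def w_def using v sum_jbracket_powr_finite[of "2 * \<theta> * v"] by (simp add: epowr_jbracket)
  \<comment> \<open>The square root of C times the l^v norm of the weight: undoing the square halves
    the exponent 1/v.\<close>
  define K where "K = epowr (ennreal C) (1 / 2) * epowr W (1 / (2 * v))"
  have "K < top"
    unfolding K_def using \<open>W < top\<close> v by (auto simp: ennreal_mult_less_top intro!: epowr_less_top)
  then obtain C' where C': "C' > 0" "K \<le> ennreal C'" by (rule bound_by_positive_real)
  have "lp_norm (ereal (2 * r)) H \<le> ennreal C' * lp_norm (ereal (2 * t)) a"
    if "peetre_dominated \<theta> C H a" for H a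
  proof -
    define S where "S n = (\<Sum>\<^sup>+k. w (k - n) * (a k)\<^sup>2)" for n
    have H: "(H n)\<^sup>2 \<le> ennreal C * S n" for n
      using that unfolding peetre_dominated_def S_def w_def by blast
    have "epowr (H n) (2 * r) \<le> epowr (ennreal C) r * epowr (S n) r" for n
    proof -
      have "epowr (H n) (2 * r) = epowr ((H n)\<^sup>2) r"
        using rt by (simp add: epowr_epowr flip: epowr_2)
      also have "\<dots> \<le> epowr (ennreal C * S n) r"
        using rt H by (intro epowr_mono) auto
      finally show ?thesis using rt by (simp add: epowr_mult)
    qed
    then have "(\<Sum>\<^sup>+n. epowr (H n) (2 * r))
        \<le> (\<Sum>\<^sup>+n. epowr (ennreal C) r * epowr (S n) r)"
      by (intro nn_integral_mono)
    also have "\<dots> = epowr (ennreal C) r * (\<Sum>\<^sup>+n. epowr (S n) r)"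
      by (simp add: nn_integral_cmult)
    also have "\<dots> \<le> epowr (ennreal C) r * (epowr W (r / v) * epowr (\<Sum>\<^sup>+k. epowr ((a k)\<^sup>2) t) (r / t))"
    proof -
      have "1 / r \<le> 1 / t" using rt by (simp add: frac_le)
      moreover have "1 / t \<le> 1" using rt by simp
      then have "1 / r \<le> 1 / v" using v(1) by linarith
      ultimately show ?thesis
        unfolding S_def W_def using rt v by (intro mult_left_mono Young_sum) auto
    qed
    also have "(\<Sum>\<^sup>+k. epowr ((a k)\<^sup>2) t) = (\<Sum>\<^sup>+k. epowr (a k) (2 * t))"
      using rt by (simp add: epowr_epowr flip: epowr_2)
    finally have "lp_norm (ereal (2 * r)) H \<le> epowr (epowr (ennreal C) r * (epowr W (r / v) *
        epowr (\<Sum>\<^sup>+k. epowr (a k) (2 * t)) (r / t))) (1 / (2 * r))"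
      using rt by (auto simp: lp_norm_finite intro!: epowr_mono)
    also have "\<dots> = K * lp_norm (ereal (2 * t)) a"
      using rt v by (simp add: lp_norm_finite epowr_mult epowr_epowr K_def mult_ac)
    also have "\<dots> \<le> ennreal C' * lp_norm (ereal (2 * t)) a"
      using C' by (intro mult_right_mono) auto
    finally show ?thesis .
  qed
  with C' show ?thesis by blast
qed

lemma le_epowr_half: "x\<^sup>2 \<le> y \<Longrightarrow> x \<le> epowr y (1 / 2)" for x y :: ennreal
  using epowr_le_iff[of 2 x y] by (simp add: epowr_2)

text \<open>The endpoint r = t = \<infinity> of Young's inequality with v = 1: the supremum is
  pulled out of the sum, and what remains is the total mass of the weight.\<close>

lemma peetre_dominated_sup:
  assumes "\<theta> < - 1 / 2"
  shows "\<exists>C'>0. \<forall>H a. peetre_dominated \<theta> C H a \<longrightarrow> lp_norm \<infinity> H \<le> ennreal C' * lp_norm \<infinity> a"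
proof -
  define w where "w k = ennreal (jbracket (of_int k) powr (2 * \<theta>))" for k :: int
  define W where "W = (\<Sum>\<^sup>+k. w k)"
  have "W < top"
    unfolding W_def w_def using assms by (intro sum_jbracket_powr_finite) auto
  then have "epowr (ennreal C * W) (1 / 2) < top"
    by (intro epowr_less_top) (auto simp: ennreal_mult_less_top)
  then obtain C' where C': "C' > 0" "epowr (ennreal C * W) (1 / 2) \<le> ennreal C'"
    by (rule bound_by_positive_real)
  have "H n \<le> ennreal C' * lp_norm \<infinity> a" if "peetre_dominated \<theta> C H a" for H a n
  proof -
    have "(H n)\<^sup>2 \<le> ennreal C * (\<Sum>\<^sup>+k. w (k - n) * (a k)\<^sup>2)"
      using that unfolding peetre_dominated_def w_def by blast
    also have "\<dots> \<le> ennreal C * (\<Sum>\<^sup>+k. w (k - n) * (lp_norm \<infinity> a)\<^sup>2)"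
      by (intro mult_left_mono nn_integral_mono power_mono) (auto simp: lp_norm_PInf intro: SUP_upper)
    also have "\<dots> = (ennreal C * W) * (lp_norm \<infinity> a)\<^sup>2"
      by (simp add: nn_integral_multc nn_integral_count_shift(1) W_def mult.assoc)
    finally have "H n \<le> epowr ((ennreal C * W) * (lp_norm \<infinity> a)\<^sup>2) (1 / 2)"
      by (rule le_epowr_half)
    also have "\<dots> = epowr (ennreal C * W) (1 / 2) * lp_norm \<infinity> a"
      by (simp add: epowr_mult epowr_epowr flip: epowr_2)
    also have "\<dots> \<le> ennreal C' * lp_norm \<infinity> a"
      using C' by (intro mult_right_mono) auto
    finally show ?thesis .
  qed
  then show ?thesis
    using C'(1) by (auto simp: lp_norm_PInf[of "H" for H] intro!: exI[of _ C'] SUP_least)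
qed

text \<open>The endpoint r = \<infinity> with t finite, which is Hoelder's inequality: the weight
  has to lie in l^v for the exponent v conjugate to t.\<close>

lemma peetre_dominated_lp_sup:
  assumes "\<theta> < 0" "t \<ge> 1" "1 - 1 / t < - 2 * \<theta>"
  shows "\<exists>C'>0. \<forall>H a. peetre_dominated \<theta> C H a \<longrightarrow> lp_norm \<infinity> H \<le> ennreal C' * lp_norm (ereal (2 * t)) a"
proof -
  define w where "w k = ennreal (jbracket (of_int k) powr (2 * \<theta>))" for k :: int
  have w_le_1: "w k \<le> 1" for k
    using assms jbracket_ge_1[of "of_int k"] powr_mono[of "2 * \<theta>" 0 "jbracket (of_int k)"]
    by (simp add: w_def ennreal_le_1)
  have "\<exists>W<top. \<forall>b n. (\<Sum>\<^sup>+k. w (k - n) * b k) \<le> W * epowr (\<Sum>\<^sup>+k. epowr (b k) t) (1 / t)"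
  proof (cases "t = 1")
    \<comment> \<open>The conjugate exponent is infinite here, and the weight is bounded by 1 since
      \<theta> < 0.\<close>
    case True
    have "(\<Sum>\<^sup>+k. w (k - n) * b k) \<le> (\<Sum>\<^sup>+k. 1 * b k)" for b n
      by (intro nn_integral_mono mult_right_mono w_le_1) auto
    then show ?thesis using True by (intro exI[of _ 1]) auto
  next
    case False
    define v where "v = 1 / (1 - 1 / t)"
    have v: "v > 0" "1 / v + 1 / t = 1 + 0" "2 * \<theta> * v < -1"
      using assms False by (auto simp: v_def field_simps)
    define W where "W = epowr (\<Sum>\<^sup>+k. epowr (w k) v) (1 / v)"
    have "W < top"
      unfolding W_def w_def using v sum_jbracket_powr_finite[of "2 * \<theta> * v"]
      by (intro epowr_less_top) (auto simp: epowr_jbracket)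
    moreover have "(\<Sum>\<^sup>+k. w (k - n) * b k)
        \<le> W * epowr (\<Sum>\<^sup>+k. epowr (b k) t) (1 / t)" for b n
      using Young_pointwise[of v t 0 w n b] v assms by (simp add: W_def)
    ultimately show ?thesis by blast
  qed
  then obtain W where W: "W < top" "\<And>b n. (\<Sum>\<^sup>+k. w (k - n) * b k)
      \<le> W * epowr (\<Sum>\<^sup>+k. epowr (b k) t) (1 / t)" by blast
  then have "epowr (ennreal C * W) (1 / 2) < top"
    by (intro epowr_less_top) (auto simp: ennreal_mult_less_top)
  then obtain C' where C': "C' > 0" "epowr (ennreal C * W) (1 / 2) \<le> ennreal C'"
    by (rule bound_by_positive_real)
  have "H n \<le> ennreal C' * lp_norm (ereal (2 * t)) a" if "peetre_dominated \<theta> C H a" for H a n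
  proof -
    have "(H n)\<^sup>2 \<le> ennreal C * (\<Sum>\<^sup>+k. w (k - n) * (a k)\<^sup>2)"
      using that unfolding peetre_dominated_def w_def by blast
    also have "\<dots> \<le> ennreal C * (W * epowr (\<Sum>\<^sup>+k. epowr ((a k)\<^sup>2) t) (1 / t))"
      by (intro mult_left_mono W) auto
    finally have "H n \<le> epowr (ennreal C * (W * epowr (\<Sum>\<^sup>+k. epowr ((a k)\<^sup>2) t) (1 / t))) (1 / 2)"
      by (rule le_epowr_half)
    also have "\<dots> = epowr (ennreal C * W) (1 / 2) * lp_norm (ereal (2 * t)) a"
      using assms by (simp add: epowr_mult epowr_epowr lp_norm_finite mult_ac flip: epowr_2)
    also have "\<dots> \<le> ennreal C' * lp_norm (ereal (2 * t)) a"
      using C' by (intro mult_right_mono) auto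
    finally show ?thesis .
  qed
  then show ?thesis
    using C'(1) by (auto simp: lp_norm_PInf intro!: exI[of _ C'] SUP_least)
qed

lemma peetre_dominated_diag:
  assumes "\<theta> < - 1 / 2" "2 \<le> p"
  shows "\<exists>C'>0. \<forall>H a. peetre_dominated \<theta> C H a \<longrightarrow> lp_norm p H \<le> ennreal C' * lp_norm p a"
proof (cases p)
  case (real P)
  then show ?thesis
    using peetre_dominated_lp[of "P / 2" "P / 2" 1 \<theta> C] assms by simp
qed (use assms peetre_dominated_sup in auto)

lemma peetre_dominated_offdiag:
  assumes "\<theta> < 0" "2 \<le> q" "q < p" "1 / q > 1 / p + 1 / 2 + ereal \<theta>"
  shows "\<exists>C'>0. \<forall>H a. peetre_dominated \<theta> C H a \<longrightarrow> lp_norm p H \<le> ennreal C' * lp_norm q a"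
proof -
  obtain Q where Q: "q = ereal Q" "Q \<ge> 2"
    using assms by (cases q) auto
  show ?thesis
  proof (cases p)
    case (real P)
    then have P: "Q < P" "1 / Q > 1 / P + 1 / 2 + \<theta>"
      using assms Q by (auto simp: one_ereal_def numeral_eq_ereal)
    \<comment> \<open>Solved from 1/v + 2/Q = 1 + 2/P. With this value -2\<theta> > 1/v is a
      rearrangement of 1/Q > 1/P + 1/2 + \<theta>.\<close>
    define v where "v = 1 / (1 + 2 / P - 2 / Q)"
    have "2 / Q \<le> 1" "2 / P > 0" using P Q by auto
    then have "1 + 2 / P - 2 / Q > 0" by linarith
    then have v: "v > 0" "1 / v + 1 / (Q / 2) = 1 + 1 / (P / 2)" by (auto simp: v_def)
    have "- 2 * \<theta> > 1 / v"
      using P by (simp add: v_def)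
    then have "2 * \<theta> * v < -1" using v by (simp add: field_simps)
    with v show ?thesis
      using peetre_dominated_lp[of "Q / 2" "P / 2" v \<theta> C] P Q real by simp
  next
    case PInf
    then have "1 / Q > 1 / 2 + \<theta>"
      using assms Q by (auto simp: one_ereal_def numeral_eq_ereal zero_ereal_def)
    then show ?thesis
      using peetre_dominated_lp_sup[of \<theta> "Q / 2" C] Q PInf assms(1) by simp
  qed (use assms in auto)
qed

text \<open>Hoelder's inequality for |a|^Q = (<n>^s |a|)^Q <n>^(-sQ). The second factor is summable
  at its exponent exactly when s > 1/Q - 1/p.\<close>

lemma lp_norm_weighted_embedding:
  assumes "2 \<le> Q" "ereal Q < p" "ereal s > 1 / ereal Q - 1 / p"
  shows "\<exists>C'>0. \<forall>a. lp_norm (ereal Q) a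
      \<le> ennreal C' * lp_norm p (\<lambda>n. ennreal (jbracket (of_int n) powr s) * a n)"
proof -
  \<comment> \<open>This is Q/p, and 0 for p = \<infinity>. The assumption on s then reads s * Q >
    \<beta>, that is, -s * Q / \<beta> < -1.\<close>
  define \<alpha> where "\<alpha> = Q * real_of_ereal (1 / p)"
  define \<beta> where "\<beta> = 1 - \<alpha>"
  have \<alpha>: "0 \<le> \<alpha>" "\<alpha> < 1" "s * Q > \<beta>"
    using assms by (cases p; auto simp: \<alpha>_def \<beta>_def one_ereal_def zero_ereal_def field_simps)+
  define W where "W = epowr (\<Sum>\<^sup>+k. ennreal (jbracket (of_int (k::int)) powr (- s * Q / \<beta>))) \<beta>"
  have "- s * Q / \<beta> < -1" using \<alpha> by (simp add: \<beta>_def field_simps)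
  then have "W < top"
    unfolding W_def using \<alpha> by (intro epowr_less_top sum_jbracket_powr_finite) (auto simp: \<beta>_def)
  then have "epowr W (1 / Q) < top" using assms by (intro epowr_less_top) auto
  then obtain C' where C': "C' > 0" "epowr W (1 / Q) \<le> ennreal C'"
    by (rule bound_by_positive_real)
  have "lp_norm (ereal Q) a \<le> ennreal C' * lp_norm p (\<lambda>n. ennreal (jbracket (of_int n) powr s) * a n)" for a
  proof -
    define d where "d n = ennreal (jbracket (of_int n) powr s) * a n" for n
    define N where "N = lp_norm p d"
    have "epowr (a n) Q = epowr (d n) Q * epowr (ennreal (jbracket (of_int n) powr (- s * Q / \<beta>))) \<beta>" for n
    proof -
      have "\<beta> > 0" using \<alpha> by (simp add: \<beta>_def)
      have "epowr (d n) Q * epowr (ennreal (jbracket (of_int n) powr (- s * Q / \<beta>))) \<beta>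
          = epowr (a n) Q * (ennreal (jbracket (of_int n) powr (s * Q)) * ennreal (jbracket (of_int n) powr (- s * Q)))"
        using assms \<open>\<beta> > 0\<close> by (simp add: d_def epowr_mult epowr_jbracket mult_ac)
      also have "ennreal (jbracket (of_int n) powr (s * Q)) * ennreal (jbracket (of_int n) powr (- s * Q)) = 1"
        using jbracket_pos[of "of_int n"]
        by (simp add: powr_minus flip: ennreal_mult)
      finally show ?thesis by simp
    qed
    moreover have "(\<Sum>\<^sup>+n. epowr (d n) Q * epowr (ennreal (jbracket (of_int n) powr (- s * Q / \<beta>))) \<beta>)
        \<le> epowr N Q * W"
    proof (cases p)
      case (real P)
      then have P: "P > Q" "\<alpha> = Q / P" using assms by (auto simp: \<alpha>_def one_ereal_def)
      have "epowr (d n) Q = epowr (epowr (d n) P) \<alpha>" for n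
        using P assms by (simp add: epowr_epowr)
      moreover have "epowr N Q = epowr (\<Sum>\<^sup>+n. epowr (d n) P) \<alpha>"
        using P assms by (simp add: N_def real lp_norm_finite epowr_epowr)
      ultimately show ?thesis
        unfolding W_def using \<alpha> by (simp only:) (intro Hoelder_sum, auto simp: \<beta>_def)
    next
      case PInf
      then have "\<beta> = 1" by (simp add: \<beta>_def \<alpha>_def)
      have "(\<Sum>\<^sup>+n. epowr (d n) Q * epowr (ennreal (jbracket (of_int n) powr (- s * Q / \<beta>))) \<beta>)
          \<le> (\<Sum>\<^sup>+n. epowr N Q * epowr (ennreal (jbracket (of_int n) powr (- s * Q / \<beta>))) \<beta>)"
        using assms PInf
        by (intro nn_integral_mono mult_right_mono epowr_mono) (auto simp: N_def lp_norm_PInf intro: SUP_upper)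
      also have "\<dots> = epowr N Q * W"
        by (simp add: W_def \<open>\<beta> = 1\<close> nn_integral_cmult)
      finally show ?thesis .
    qed (use assms in auto)
    ultimately have "lp_norm (ereal Q) a \<le> epowr (epowr N Q * W) (1 / Q)"
      using assms by (auto simp: lp_norm_finite intro!: epowr_mono)
    also have "\<dots> = epowr W (1 / Q) * N"
      using assms by (simp add: epowr_mult epowr_epowr mult.commute)
    also have "\<dots> \<le> ennreal C' * N" using C' by (intro mult_right_mono) auto
    finally show ?thesis by (simp add: N_def d_def[abs_def])
  qed
  with C' show ?thesis by blast
qed

lemma one_div_ereal: "P > 0 \<Longrightarrow> 1 / ereal P = ereal (1 / P)"
  by (simp add: one_ereal_def)

text \<open>Chain of two estimates through an intermediate space l^(1/\<kappa>): H is first bounded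
  by the norm of a in that space, which in turn is controlled by the weighted l^p norm.\<close>

lemma peetre_dominated_weighted:
  assumes "- 1 / 2 \<le> \<theta>" "\<theta> < 0" "2 \<le> q" "q < p" "1 / q > 1 / p + 1 / 2 + ereal \<theta>" "s > 1 / 2 + \<theta>"
  shows "\<exists>C'>0. \<forall>H a. peetre_dominated \<theta> C H a \<longrightarrow>
      lp_norm p H \<le> ennreal C' * lp_norm p (\<lambda>n. ennreal (jbracket (of_int n) powr s) * a n)"
proof -
  obtain \<rho> where \<rho>: "1 / p = ereal \<rho>" "\<rho> \<ge> 0" "p = ereal (1 / \<rho>) \<and> \<rho> > 0 \<or> p = \<infinity>"
  proof (cases p)
    case (real P)
    then have "P > 0" using assms by (cases q) auto
    then show thesis using real by (intro that[of "1 / P"]) (auto simp: one_div_ereal)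
  next
    case PInf
    then show thesis by (intro that[of 0]) auto
  qed (use assms in auto)
  obtain Q where Q: "q = ereal Q" "Q \<ge> 2" using assms by (cases q) auto
  have "1 / q = ereal (1 / Q)" using Q by (simp add: one_div_ereal)
  moreover have half: "(1::ereal) / 2 = ereal (1 / 2)"
    using one_div_ereal[of 2] by simp
  ultimately have "\<rho> + 1 / 2 + \<theta> < 1 / Q"
    using assms(5) \<rho>(1) by simp
  moreover have "1 / Q \<le> 1 / 2" using Q by simp
  ultimately have "\<rho> + 1 / 2 + \<theta> < min (1 / Q) (\<rho> + s)" using assms by auto
  \<comment> \<open>The lower bound on \<kappa> is the condition for bounding H by the
    l^(1/\<kappa>) norm, the bound \<rho> + s the one for the weighted embedding. The bound 1/Q
    ensures 1/\<kappa> \<ge> 2.\<close>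
  then obtain \<kappa> where \<kappa>: "\<rho> + 1 / 2 + \<theta> < \<kappa>" "\<kappa> < 1 / Q" "\<kappa> < \<rho> + s"
    using dense by (metis min_less_iff_conj)
  have "\<kappa> > 0" using \<kappa>(1) \<rho>(2) assms(1) by linarith
  have "1 / \<kappa> \<ge> 2" using \<kappa>(2) \<open>1 / Q \<le> 1 / 2\<close> \<open>\<kappa> > 0\<close> by (simp add: field_simps)
  have lt: "ereal (1 / \<kappa>) < p"
    using \<rho>(3)
  proof
    assume *: "p = ereal (1 / \<rho>) \<and> \<rho> > 0"
    have "\<rho> < \<kappa>" using \<kappa>(1) assms(1) by linarith
    then have "1 / \<kappa> < 1 / \<rho>" using * by (intro divide_strict_left_mono) auto
    then show ?thesis using * by simp
  qed simp
  have inv: "1 / ereal (1 / \<kappa>) = ereal \<kappa>"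
    using \<open>\<kappa> > 0\<close> by (simp add: one_div_ereal)
  have "\<exists>C'>0. \<forall>H a. peetre_dominated \<theta> C H a \<longrightarrow> lp_norm p H \<le> ennreal C' * lp_norm (ereal (1 / \<kappa>)) a"
    using assms(2) \<open>1 / \<kappa> \<ge> 2\<close> lt
  proof (intro peetre_dominated_offdiag)
    show "1 / ereal (1 / \<kappa>) > 1 / p + 1 / 2 + ereal \<theta>"
      unfolding inv \<rho>(1) half using \<kappa>(1) by (simp only: plus_ereal.simps less_ereal.simps)
  qed auto
  then obtain C1 where C1: "C1 > 0" "\<And>H a. peetre_dominated \<theta> C H a \<Longrightarrow> lp_norm p H \<le> ennreal C1 * lp_norm (ereal (1 / \<kappa>)) a"
    by blast
  have "\<exists>C'>0. \<forall>a. lp_norm (ereal (1 / \<kappa>)) a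
      \<le> ennreal C' * lp_norm p (\<lambda>n. ennreal (jbracket (of_int n) powr s) * a n)"
    using \<kappa> \<rho>(1) \<open>1 / \<kappa> \<ge> 2\<close> lt
    by (intro lp_norm_weighted_embedding) (auto simp: inv)
  then obtain C2 where C2: "C2 > 0" "\<And>a. lp_norm (ereal (1 / \<kappa>)) a
      \<le> ennreal C2 * lp_norm p (\<lambda>n. ennreal (jbracket (of_int n) powr s) * a n)"
    by blast
  have "lp_norm p H \<le> ennreal (C1 * C2) * lp_norm p (\<lambda>n. ennreal (jbracket (of_int n) powr s) * a n)"
    if "peetre_dominated \<theta> C H a" for H a
  proof -
    have "lp_norm p H \<le> ennreal C1 * (ennreal C2 * lp_norm p (\<lambda>n. ennreal (jbracket (of_int n) powr s) * a n))"
      using C1(2)[OF that] C2(2)[of a] by (meson mult_left_mono order_trans zero_le)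
    then show ?thesis using C1 C2 by (simp add: ennreal_mult mult.assoc)
  qed
  then show ?thesis using C1 C2 by (intro exI[of _ "C1 * C2"]) auto
qed

section \<open>Schwartz functions and tame multipliers\<close>

definition der :: "(real \<Rightarrow> complex) \<Rightarrow> real \<Rightarrow> complex" where
  "der g = (\<lambda>x. vector_derivative g (at x))"

lemma nth_deriv_0 [simp]: "nth_deriv 0 g = g"
  by (simp add: nth_deriv_def)

lemma nth_deriv_Suc: "nth_deriv (Suc k) g = der (nth_deriv k g)"
  by (simp add: nth_deriv_def der_def)

lemma nth_deriv_Suc': "nth_deriv (Suc k) g = nth_deriv k (der g)"
  by (induction k) (simp_all add: nth_deriv_Suc)

lemma der_eqI: "(\<And>x. (g has_vector_derivative g' x) (at x)) \<Longrightarrow> der g = g'"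
  by (auto simp: der_def vector_derivative_at)

lemma nth_deriv_cong_open:
  assumes "open S" "\<And>y. y \<in> S \<Longrightarrow> g y = h y" "x \<in> S"
  shows "nth_deriv k g x = nth_deriv k h x"
  using assms(3)
proof (induction k arbitrary: x)
  case (Suc k)
  have "\<forall>\<^sub>F y in nhds x. nth_deriv k g y = nth_deriv k h y"
    using Suc assms by (auto simp: eventually_nhds intro!: exI[of _ S])
  then show ?case
    by (auto simp: nth_deriv_Suc der_def intro!: vector_derivative_cong_eq)
qed (use assms in auto)

text \<open>One scheme for two classical spaces: with rapid decay for P it is Schwartz space, with
  polynomial growth for P the smooth functions all of whose derivatives are polynomially
  bounded.\<close>

definition all_derivs :: "((real \<Rightarrow> complex) \<Rightarrow> bool) \<Rightarrow> (real \<Rightarrow> complex) set" where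
  "all_derivs P = {g. \<forall>k. (\<forall>x. nth_deriv k g differentiable (at x)) \<and> P (nth_deriv k g)}"

text \<open>Iterated derivatives of composite functions have no convenient closed form. It is enough
  to exhibit a class X that is closed under differentiation and satisfies P throughout: then every
  iterated derivative stays in X.\<close>

lemma all_derivs_coinduct:
  assumes "g \<in> X"
    and "\<And>g. g \<in> X \<Longrightarrow> \<exists>g'\<in>X. \<forall>x. (g has_vector_derivative g' x) (at x)"
    and "\<And>g. g \<in> X \<Longrightarrow> P g"
  shows "g \<in> all_derivs P"
proof -
  have "nth_deriv k g \<in> X" for k
  proof (induction k)
    case (Suc k)
    then obtain g' where "g' \<in> X" "\<forall>x. (nth_deriv k g has_vector_derivative g' x) (at x)"
      using assms(2) by blast
    then show ?case using der_eqI[of "nth_deriv k g" g'] by (simp add: nth_deriv_Suc)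
  qed (simp add: assms(1))
  then show ?thesis
    unfolding all_derivs_def using assms(2,3) by (blast intro: differentiableI_vector)
qed

lemma all_derivs_der: "g \<in> all_derivs P \<Longrightarrow> der g \<in> all_derivs P"
  unfolding all_derivs_def by (auto simp flip: nth_deriv_Suc')

lemma all_derivs_has_vector_derivative:
  "g \<in> all_derivs P \<Longrightarrow> (g has_vector_derivative der g x) (at x)"
proof -
  assume "g \<in> all_derivs P"
  then have "nth_deriv 0 g differentiable (at x)" unfolding all_derivs_def by blast
  then show ?thesis by (simp add: der_def vector_derivative_works)
qed

lemma all_derivsD: "g \<in> all_derivs P \<Longrightarrow> P g"
proof -
  assume "g \<in> all_derivs P"
  then have "P (nth_deriv 0 g)" unfolding all_derivs_def by blast
  then show ?thesis by simp
qed

lemma all_derivs_nth_deriv: "g \<in> all_derivs P \<Longrightarrow> nth_deriv k g \<in> all_derivs P"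
  by (induction k) (auto simp: nth_deriv_Suc intro: all_derivs_der)

lemma all_derivs_mono: "g \<in> all_derivs P \<Longrightarrow> (\<And>g. P g \<Longrightarrow> Q g) \<Longrightarrow> g \<in> all_derivs Q"
  unfolding all_derivs_def by auto

lemma all_derivs_linear:
  assumes "g \<in> all_derivs P" "h \<in> all_derivs P"
    and "\<And>g h. P g \<Longrightarrow> P h \<Longrightarrow> P (\<lambda>x. a * g x + b * h x)"
  shows "(\<lambda>x. a * g x + b * h x) \<in> all_derivs P"
    and "nth_deriv k (\<lambda>x. a * g x + b * h x) = (\<lambda>x. a * nth_deriv k g x + b * nth_deriv k h x)"
proof -
  have d: "((\<lambda>x. a * g x + b * h x) has_vector_derivative a * der g x + b * der h x) (at x)"
    if "g \<in> all_derivs P" "h \<in> all_derivs P" for g h x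
    using that[THEN all_derivs_has_vector_derivative] by (auto intro!: derivative_eq_intros)
  let ?X = "(\<lambda>(g, h) x. a * g x + b * h x) ` (all_derivs P \<times> all_derivs P)"
  show "(\<lambda>x. a * g x + b * h x) \<in> all_derivs P"
  proof (rule all_derivs_coinduct[where X = ?X])
    show "(\<lambda>x. a * g x + b * h x) \<in> ?X" using assms(1,2) by force
  next
    fix f assume "f \<in> ?X"
    then obtain g h where f: "f = (\<lambda>x. a * g x + b * h x)" and gh: "g \<in> all_derivs P" "h \<in> all_derivs P" by auto
    have "(\<lambda>x. a * der g x + b * der h x) \<in> ?X" using gh[THEN all_derivs_der] by force
    then show "\<exists>g'\<in>?X. \<forall>x. (f has_vector_derivative g' x) (at x)"
      by (rule bexI[rotated]) (simp add: f d gh)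
    show "P f" unfolding f by (rule assms(3)[OF all_derivsD[OF gh(1)] all_derivsD[OF gh(2)]])
  qed
  show "nth_deriv k (\<lambda>x. a * g x + b * h x) = (\<lambda>x. a * nth_deriv k g x + b * nth_deriv k h x)"
  proof (induction k)
    case (Suc k)
    have "((\<lambda>x. a * nth_deriv k g x + b * nth_deriv k h x) has_vector_derivative
        a * der (nth_deriv k g) x + b * der (nth_deriv k h) x) (at x)" for x
      by (rule d[OF all_derivs_nth_deriv[OF assms(1)] all_derivs_nth_deriv[OF assms(2)]])
    then have "der (\<lambda>x. a * nth_deriv k g x + b * nth_deriv k h x)
        = (\<lambda>x. a * der (nth_deriv k g) x + b * der (nth_deriv k h) x)"
      by (rule der_eqI)
    then show ?case by (simp add: nth_deriv_Suc Suc)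
  qed simp
qed

text \<open>The closure of the products under differentiation: the derivative of a product is a sum
  of two products. It takes the place of the Leibniz formula in the coinduction for
  \<open>all_derivs_mult\<close>.\<close>

inductive_set sum_prods :: "(real \<Rightarrow> complex) set \<Rightarrow> (real \<Rightarrow> complex) set \<Rightarrow> (real \<Rightarrow> complex) set"
  for A B where
  prod: "g \<in> A \<Longrightarrow> h \<in> B \<Longrightarrow> (\<lambda>x. g x * h x) \<in> sum_prods A B"
| add: "g \<in> sum_prods A B \<Longrightarrow> h \<in> sum_prods A B \<Longrightarrow> (\<lambda>x. g x + h x) \<in> sum_prods A B"

lemma all_derivs_mult:
  assumes "g \<in> all_derivs P" "h \<in> all_derivs Q"
    and prod: "\<And>g h. P g \<Longrightarrow> Q h \<Longrightarrow> R (\<lambda>x. g x * h x)"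
    and add: "\<And>g h. R g \<Longrightarrow> R h \<Longrightarrow> R (\<lambda>x. g x + h x)"
  shows "(\<lambda>x. g x * h x) \<in> all_derivs R"
proof (rule all_derivs_coinduct)
  show "(\<lambda>x. g x * h x) \<in> sum_prods (all_derivs P) (all_derivs Q)"
    by (intro sum_prods.prod assms)
next
  fix g assume "g \<in> sum_prods (all_derivs P) (all_derivs Q)"
  then show "\<exists>g'\<in>sum_prods (all_derivs P) (all_derivs Q). \<forall>x. (g has_vector_derivative g' x) (at x)"
  proof induction
    case (prod g h)
    have "(\<lambda>x. g x * der h x + der g x * h x) \<in> sum_prods (all_derivs P) (all_derivs Q)"
      using prod by (intro sum_prods.intros all_derivs_der)
    moreover have "((\<lambda>x. g x * h x) has_vector_derivative g x * der h x + der g x * h x) (at x)" for x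
      using prod by (auto intro!: has_vector_derivative_mult all_derivs_has_vector_derivative)
    ultimately show ?case by (rule_tac bexI) auto
  next
    case (add g h)
    then obtain g' h' where "g' \<in> sum_prods (all_derivs P) (all_derivs Q)" "\<forall>x. (g has_vector_derivative g' x) (at x)"
       "h' \<in> sum_prods (all_derivs P) (all_derivs Q)" "\<forall>x. (h has_vector_derivative h' x) (at x)" by blast
    then show ?case
      by (intro bexI[of _ "\<lambda>x. g' x + h' x"] sum_prods.add) (auto intro!: has_vector_derivative_add)
  qed
next
  fix g assume "g \<in> sum_prods (all_derivs P) (all_derivs Q)"
  then show "R g"
  proof induction
    case (prod g h)
    show ?case by (rule assms(3)[OF all_derivsD[OF prod(1)] all_derivsD[OF prod(2)]])
  next
    case (add g h)
    show ?case by (rule assms(4)[OF add(3,4)])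
  qed
qed

text \<open>Each differentiation brings out a factor a, so the coinductive class, and with it the
  hypothesis on P, carries a real factor c.\<close>

lemma all_derivs_affine:
  assumes "g \<in> all_derivs P" and P: "\<And>g c. P g \<Longrightarrow> P (\<lambda>x. complex_of_real c * g (a * x + b))"
  shows "(\<lambda>x. g (a * x + b)) \<in> all_derivs P"
proof (rule all_derivs_coinduct[where X = "{\<lambda>x. complex_of_real c * g (a * x + b) | c g. g \<in> all_derivs P}"])
  show "(\<lambda>x. g (a * x + b)) \<in> {\<lambda>x. complex_of_real c * g (a * x + b) | c g. g \<in> all_derivs P}"
    using assms by (auto intro!: exI[of _ 1] exI[of _ g])
next
  fix h assume "h \<in> {\<lambda>x. complex_of_real c * g (a * x + b) | c g. g \<in> all_derivs P}"
  then obtain c g where h: "h = (\<lambda>x. complex_of_real c * g (a * x + b))" and g: "g \<in> all_derivs P" by blast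
  have "((\<lambda>x. g (a * x + b)) has_vector_derivative a *\<^sub>R der g (a * x + b)) (at x)" for x
  proof -
    have "((\<lambda>x. a * x + b) has_vector_derivative a) (at x)"
      by (auto intro!: derivative_eq_intros)
    from vector_diff_chain_at[OF this all_derivs_has_vector_derivative[OF g]] show ?thesis
      by (simp add: o_def)
  qed
  then have "(h has_vector_derivative complex_of_real (c * a) * der g (a * x + b)) (at x)" for x
    unfolding h by (auto intro!: derivative_eq_intros simp: scaleR_conv_of_real)
  then show "\<exists>g'\<in>{\<lambda>x. complex_of_real c * g (a * x + b) | c g. g \<in> all_derivs P}.
      \<forall>x. (h has_vector_derivative g' x) (at x)"
    using all_derivs_der[OF g] by (intro bexI[of _ "\<lambda>x. complex_of_real (c * a) * der g (a * x + b)"]) blast+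
next
  fix h assume "h \<in> {\<lambda>x. complex_of_real c * g (a * x + b) | c g. g \<in> all_derivs P}"
  then obtain c g where h: "h = (\<lambda>x. complex_of_real c * g (a * x + b))" and g: "g \<in> all_derivs P" by blast
  show "P h" unfolding h by (rule P[OF all_derivsD[OF g]])
qed

section \<open>Rapid decay and polynomial growth\<close>

definition rapid :: "(real \<Rightarrow> complex) \<Rightarrow> bool" where
  "rapid g \<longleftrightarrow> (\<forall>j. \<exists>C. \<forall>x. (1 + \<bar>x\<bar>) ^ j * cmod (g x) \<le> C)"

definition tame :: "(real \<Rightarrow> complex) \<Rightarrow> bool" where
  "tame g \<longleftrightarrow> (\<exists>j C. \<forall>x. cmod (g x) \<le> C * (1 + \<bar>x\<bar>) ^ j)"

text \<open>Links the weight 1 + |x|, which behaves well under products and translations, to the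
  monomials in the definition of \<open>schwartz\<close>. The nontrivial direction uses (1 + |x|)^j
  \<le> 2^j (1 + |x|^j).\<close>

lemma rapid_iff: "rapid g \<longleftrightarrow> (\<forall>j. bounded (range (\<lambda>x. x ^ j *\<^sub>R g x)))"
proof
  assume r: "rapid g"
  show "\<forall>j. bounded (range (\<lambda>x. x ^ j *\<^sub>R g x))"
  proof
    fix j
    obtain C where C: "\<And>x. (1 + \<bar>x\<bar>) ^ j * cmod (g x) \<le> C" using r unfolding rapid_def by blast
    have "norm (x ^ j *\<^sub>R g x) \<le> C" for x
    proof -
      have "norm (x ^ j *\<^sub>R g x) = \<bar>x\<bar> ^ j * cmod (g x)" by (simp add: power_abs)
      also have "\<dots> \<le> (1 + \<bar>x\<bar>) ^ j * cmod (g x)" by (intro mult_right_mono power_mono) auto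
      finally show ?thesis using C[of x] by simp
    qed
    then show "bounded (range (\<lambda>x. x ^ j *\<^sub>R g x))" by (auto simp: bounded_iff)
  qed
next
  assume b: "\<forall>j. bounded (range (\<lambda>x. x ^ j *\<^sub>R g x))"
  show "rapid g" unfolding rapid_def
  proof
    fix j
    have "\<exists>C. \<forall>x. norm (x ^ j *\<^sub>R g x) \<le> C" for j
      using b[rule_format, of j] by (auto simp: bounded_iff)
    then obtain C where C: "\<And>j x. \<bar>x\<bar> ^ j * cmod (g x) \<le> C j"
      by (simp add: power_abs) metis
    have "(1 + \<bar>x\<bar>) ^ j * cmod (g x) \<le> 2 ^ j * (C 0 + C j)" for x
    proof -
      have "(1 + \<bar>x\<bar>) ^ j \<le> (2 * max 1 \<bar>x\<bar>) ^ j" by (intro power_mono) auto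
      also have "\<dots> \<le> 2 ^ j * (1 + \<bar>x\<bar> ^ j)"
        by (cases "\<bar>x\<bar> \<le> 1") (auto simp: power_mult_distrib max_def)
      finally have "(1 + \<bar>x\<bar>) ^ j * cmod (g x) \<le> 2 ^ j * (1 + \<bar>x\<bar> ^ j) * cmod (g x)"
        by (intro mult_right_mono) auto
      also have "\<dots> = 2 ^ j * (\<bar>x\<bar> ^ 0 * cmod (g x) + \<bar>x\<bar> ^ j * cmod (g x))" by (simp add: algebra_simps)
      also have "\<dots> \<le> 2 ^ j * (C 0 + C j)" by (intro mult_left_mono add_mono C) auto
      finally show ?thesis .
    qed
    then show "\<exists>C. \<forall>x. (1 + \<bar>x\<bar>) ^ j * cmod (g x) \<le> C" by blast
  qed
qed

lemma schwartz_eq: "schwartz = all_derivs rapid"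
  unfolding schwartz_def smooth_def all_derivs_def by (auto simp: rapid_iff)

lemma rapid_add: "rapid g \<Longrightarrow> rapid h \<Longrightarrow> rapid (\<lambda>x. g x + h x)"
proof (unfold rapid_def, rule allI)
  fix j
  assume a: "\<forall>j. \<exists>C. \<forall>x. (1 + \<bar>x\<bar>) ^ j * cmod (g x) \<le> C" "\<forall>j. \<exists>C. \<forall>x. (1 + \<bar>x\<bar>) ^ j * cmod (h x) \<le> C"
  obtain C C' where "\<And>x. (1 + \<bar>x\<bar>) ^ j * cmod (g x) \<le> C" "\<And>x. (1 + \<bar>x\<bar>) ^ j * cmod (h x) \<le> C'"
    using a by blast
  then have "(1 + \<bar>x\<bar>) ^ j * (cmod (g x) + cmod (h x)) \<le> C + C'" for x
    by (simp add: distrib_left add_mono)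
  moreover have "(1 + \<bar>x\<bar>) ^ j * cmod (g x + h x) \<le> (1 + \<bar>x\<bar>) ^ j * (cmod (g x) + cmod (h x))" for x
    by (intro mult_left_mono norm_triangle_ineq) auto
  ultimately show "\<exists>C. \<forall>x. (1 + \<bar>x\<bar>) ^ j * cmod (g x + h x) \<le> C" by (meson order_trans)
qed

lemma rapid_tame_mult: "tame g \<Longrightarrow> rapid h \<Longrightarrow> rapid (\<lambda>x. g x * h x)"
proof (unfold rapid_def, rule allI)
  fix j
  assume "tame g" and h: "\<forall>j. \<exists>C. \<forall>x. (1 + \<bar>x\<bar>) ^ j * cmod (h x) \<le> C"
  then obtain i C where C: "\<And>x. cmod (g x) \<le> C * (1 + \<bar>x\<bar>) ^ i" unfolding tame_def by blast
  obtain C' where C': "\<And>x. (1 + \<bar>x\<bar>) ^ (j + i) * cmod (h x) \<le> C'" using h by blast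
  have "(1 + \<bar>x\<bar>) ^ j * cmod (g x * h x) \<le> \<bar>C\<bar> * C'" for x
  proof -
    have "cmod (g x) \<le> \<bar>C\<bar> * (1 + \<bar>x\<bar>) ^ i"
      using C[of x] by (rule order_trans) (intro mult_right_mono, auto)
    then have "(1 + \<bar>x\<bar>) ^ j * cmod (g x * h x) \<le> (1 + \<bar>x\<bar>) ^ j * (\<bar>C\<bar> * (1 + \<bar>x\<bar>) ^ i * cmod (h x))"
      unfolding norm_mult by (intro mult_left_mono mult_right_mono) auto
    also have "\<dots> = \<bar>C\<bar> * ((1 + \<bar>x\<bar>) ^ (j + i) * cmod (h x))" by (simp add: power_add)
    also have "\<dots> \<le> \<bar>C\<bar> * C'" by (intro mult_left_mono C') auto
    finally show ?thesis .
  qed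
  then show "\<exists>C. \<forall>x. (1 + \<bar>x\<bar>) ^ j * cmod (g x * h x) \<le> C" by blast
qed

lemma tame_const [simp]: "tame (\<lambda>x. c)"
  unfolding tame_def by (intro exI[of _ 0] exI[of _ "cmod c"]) simp

lemma rapid_imp_bounded: "rapid g \<Longrightarrow> \<exists>C. \<forall>x. cmod (g x) \<le> C"
  unfolding rapid_def by (metis mult.left_neutral power_0)

lemma rapid_imp_tame: "rapid g \<Longrightarrow> tame g"
  using rapid_imp_bounded[of g] unfolding tame_def by (metis mult.right_neutral power_0)

lemma rapid_linear: "rapid g \<Longrightarrow> rapid h \<Longrightarrow> rapid (\<lambda>x. a * g x + b * h x)"
  by (intro rapid_add rapid_tame_mult tame_const)

text \<open>From 1 + |x| \<le> (1 + |b|) (1 + |ax + b|), valid for |a| = 1. This covers translations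
  and the reflection.\<close>

lemma rapid_affine:
  assumes "rapid g" "\<bar>a\<bar> = 1"
  shows "rapid (\<lambda>x. c * g (a * x + b))"
proof -
  have "rapid (\<lambda>x. g (a * x + b))"
    unfolding rapid_def
  proof
    fix j
    obtain C where C: "\<And>x. (1 + \<bar>x\<bar>) ^ j * cmod (g x) \<le> C" using assms unfolding rapid_def by blast
    have "(1 + \<bar>x\<bar>) ^ j * cmod (g (a * x + b)) \<le> (1 + \<bar>b\<bar>) ^ j * C" for x
    proof -
      have "\<bar>a * x\<bar> \<le> \<bar>a * x + b\<bar> + \<bar>b\<bar>" by linarith
      moreover have "\<bar>a * x\<bar> = \<bar>x\<bar>" using assms by (simp add: abs_mult)
      moreover have "0 \<le> \<bar>b\<bar> * \<bar>a * x + b\<bar>" by simp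
      ultimately have "1 + \<bar>x\<bar> \<le> (1 + \<bar>b\<bar>) * (1 + \<bar>a * x + b\<bar>)"
        unfolding distrib_left distrib_right by linarith
      then have "(1 + \<bar>x\<bar>) ^ j \<le> ((1 + \<bar>b\<bar>) * (1 + \<bar>a * x + b\<bar>)) ^ j" by (intro power_mono) auto
      then have "(1 + \<bar>x\<bar>) ^ j * cmod (g (a * x + b)) \<le> (1 + \<bar>b\<bar>) ^ j * ((1 + \<bar>a * x + b\<bar>) ^ j * cmod (g (a * x + b)))"
        by (simp add: power_mult_distrib mult_right_mono flip: mult.assoc)
      also have "\<dots> \<le> (1 + \<bar>b\<bar>) ^ j * C" by (intro mult_left_mono C) auto
      finally show ?thesis .
    qed
    then show "\<exists>C. \<forall>x. (1 + \<bar>x\<bar>) ^ j * cmod (g (a * x + b)) \<le> C" by blast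
  qed
  then show ?thesis by (intro rapid_tame_mult tame_const)
qed

text \<open>The space O_M of slowly increasing smooth functions, which multiply Schwartz space into
  itself.\<close>

abbreviation tame_smooth :: "(real \<Rightarrow> complex) set" where
  "tame_smooth \<equiv> all_derivs tame"

lemma schwartz_imp_tame_smooth: "\<phi> \<in> schwartz \<Longrightarrow> \<phi> \<in> tame_smooth"
  unfolding schwartz_eq by (erule all_derivs_mono) (rule rapid_imp_tame)

lemma schwartz_mult: "m \<in> tame_smooth \<Longrightarrow> \<phi> \<in> schwartz \<Longrightarrow> (\<lambda>x. m x * \<phi> x) \<in> schwartz"
  unfolding schwartz_eq by (rule all_derivs_mult[where P = tame and Q = rapid]) (auto intro: rapid_tame_mult rapid_add)

lemma schwartz_linear: "\<phi> \<in> schwartz \<Longrightarrow> \<eta> \<in> schwartz \<Longrightarrow> (\<lambda>x. a * \<phi> x + b * \<eta> x) \<in> schwartz"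
  and nth_deriv_schwartz_linear: "\<phi> \<in> schwartz \<Longrightarrow> \<eta> \<in> schwartz \<Longrightarrow>
    nth_deriv k (\<lambda>x. a * \<phi> x + b * \<eta> x) = (\<lambda>x. a * nth_deriv k \<phi> x + b * nth_deriv k \<eta> x)"
  unfolding schwartz_eq
  by (rule all_derivs_linear(1); simp add: rapid_linear)
     (rule all_derivs_linear(2)[where P = rapid]; simp add: rapid_linear)

lemma schwartz_add: "\<phi> \<in> schwartz \<Longrightarrow> \<eta> \<in> schwartz \<Longrightarrow> (\<lambda>x. \<phi> x + \<eta> x) \<in> schwartz"
  and schwartz_cmult: "\<phi> \<in> schwartz \<Longrightarrow> (\<lambda>x. a * \<phi> x) \<in> schwartz"
  using schwartz_linear[of \<phi> \<eta> 1 1] schwartz_linear[of \<phi> \<phi> a 0] by simp_all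

lemma schwartz_sum:
  assumes "finite K" "K \<noteq> {}" "\<And>k. k \<in> K \<Longrightarrow> \<phi> k \<in> schwartz"
  shows "(\<lambda>x. \<Sum>k\<in>K. \<phi> k x) \<in> schwartz"
  using assms by (induction K rule: finite_ne_induct) (auto intro: schwartz_add)

lemma schwartz_affine:
  assumes "\<phi> \<in> schwartz" "\<bar>a\<bar> = 1"
  shows "(\<lambda>x. \<phi> (a * x + b)) \<in> schwartz"
  unfolding schwartz_eq
  by (rule all_derivs_affine[OF assms(1)[unfolded schwartz_eq] rapid_affine[OF _ assms(2)]])

lemma schwartz_translate: "\<phi> \<in> schwartz \<Longrightarrow> (\<lambda>x. \<phi> (x - b)) \<in> schwartz"
  using schwartz_affine[of \<phi> 1 "- b"] by simp

lemma schwartz_reflect: "\<phi> \<in> schwartz \<Longrightarrow> (\<lambda>x. \<phi> (- x)) \<in> schwartz"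
  using schwartz_affine[of \<phi> "-1" 0] by simp

lemma schwartz_der: "\<phi> \<in> schwartz \<Longrightarrow> der \<phi> \<in> schwartz"
  and schwartz_nth_deriv: "\<phi> \<in> schwartz \<Longrightarrow> nth_deriv k \<phi> \<in> schwartz"
  and schwartz_has_vector_derivative: "\<phi> \<in> schwartz \<Longrightarrow> (\<phi> has_vector_derivative der \<phi> x) (at x)"
  and schwartz_rapid: "\<phi> \<in> schwartz \<Longrightarrow> rapid \<phi>"
  unfolding schwartz_eq
  by (erule all_derivs_der all_derivs_nth_deriv all_derivs_has_vector_derivative all_derivsD)+

section \<open>The algebra of multipliers, with the powers of the Japanese bracket\<close>

lemma tame_add: "tame g \<Longrightarrow> tame h \<Longrightarrow> tame (\<lambda>x. g x + h x)"
proof -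
  assume "tame g" "tame h"
  then obtain i j C D where C: "\<And>x. cmod (g x) \<le> C * (1 + \<bar>x\<bar>) ^ i" and D: "\<And>x. cmod (h x) \<le> D * (1 + \<bar>x\<bar>) ^ j"
    unfolding tame_def by blast
  have "cmod (g x + h x) \<le> (\<bar>C\<bar> + \<bar>D\<bar>) * (1 + \<bar>x\<bar>) ^ max i j" for x
  proof -
    have "cmod (g x + h x) \<le> C * (1 + \<bar>x\<bar>) ^ i + D * (1 + \<bar>x\<bar>) ^ j"
      using norm_triangle_ineq[of "g x" "h x"] C[of x] D[of x] by linarith
    also have "\<dots> \<le> \<bar>C\<bar> * (1 + \<bar>x\<bar>) ^ max i j + \<bar>D\<bar> * (1 + \<bar>x\<bar>) ^ max i j"
      by (intro add_mono mult_mono power_increasing) auto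
    finally show ?thesis by (simp add: distrib_right)
  qed
  then show ?thesis unfolding tame_def by blast
qed

lemma tame_mult: "tame g \<Longrightarrow> tame h \<Longrightarrow> tame (\<lambda>x. g x * h x)"
proof -
  assume "tame g" "tame h"
  then obtain i j C D where C: "\<And>x. cmod (g x) \<le> C * (1 + \<bar>x\<bar>) ^ i" and D: "\<And>x. cmod (h x) \<le> D * (1 + \<bar>x\<bar>) ^ j"
    unfolding tame_def by blast
  have "cmod (g x * h x) \<le> (C * D) * (1 + \<bar>x\<bar>) ^ (i + j)" for x
  proof -
    have "cmod (g x * h x) \<le> (C * (1 + \<bar>x\<bar>) ^ i) * (D * (1 + \<bar>x\<bar>) ^ j)"
      unfolding norm_mult
      using C[of x] D[of x] norm_ge_zero[of "g x"] norm_ge_zero[of "h x"] by (intro mult_mono) linarith+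
    then show ?thesis by (simp add: power_add mult_ac)
  qed
  then show ?thesis unfolding tame_def by blast
qed

lemma tame_smooth_mult: "g \<in> tame_smooth \<Longrightarrow> h \<in> tame_smooth \<Longrightarrow> (\<lambda>x. g x * h x) \<in> tame_smooth"
  by (rule all_derivs_mult[where P = tame and Q = tame]) (auto intro: tame_mult tame_add)

lemma tame_smooth_const: "(\<lambda>x. c) \<in> tame_smooth"
  by (rule all_derivs_coinduct[where X = "range (\<lambda>c x. c)"]) (auto intro!: exI[of _ 0])

lemma tame_of_real: "tame complex_of_real"
  unfolding tame_def by (intro exI[of _ 1]) auto

lemma tame_smooth_id: "complex_of_real \<in> tame_smooth"
proof (rule all_derivs_coinduct[where X = "insert complex_of_real (range (\<lambda>c x. c))"])
  fix g :: "real \<Rightarrow> complex" assume "g \<in> insert complex_of_real (range (\<lambda>c x. c))"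
  then consider "g = complex_of_real" | c where "g = (\<lambda>x. c)" by blast
  then show "\<exists>g'\<in>insert complex_of_real (range (\<lambda>c x. c)). \<forall>x. (g has_vector_derivative g' x) (at x)"
  proof cases
    case 1
    have "(complex_of_real has_vector_derivative 1) (at x)" for x
      using has_vector_derivative_of_real[of "\<lambda>x. x" 1 "at x"] by simp
    then show ?thesis using 1 by (intro bexI[of _ "\<lambda>x. 1"]) auto
  next
    case 2
    then show ?thesis by (intro bexI[of _ "\<lambda>x. 0"]) auto
  qed
  show "tame g"
    using \<open>g \<in> _\<close> tame_of_real by auto
qed simp

lemma schwartz_times_power: "\<phi> \<in> schwartz \<Longrightarrow> (\<lambda>x. (c * complex_of_real x) ^ k * \<phi> x) \<in> schwartz"
proof (rule schwartz_mult)
  show "(\<lambda>x. (c * complex_of_real x) ^ k) \<in> tame_smooth"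
    by (induction k) (auto intro!: tame_smooth_mult tame_smooth_const tame_smooth_id)
qed

text \<open>Differentiating <x - n>^b yields b (x - n) <x - n>^(b - 2). The factor g absorbs the
  polynomial x - n and the exponent b is free, so the family is closed under derivatives.\<close>

inductive_set jbracket_family :: "(real \<Rightarrow> complex) set" where
  base: "g \<in> tame_smooth \<Longrightarrow> (\<lambda>x. g x * complex_of_real (jbracket (x - n) powr b)) \<in> jbracket_family"
| add: "g \<in> jbracket_family \<Longrightarrow> h \<in> jbracket_family \<Longrightarrow> (\<lambda>x. g x + h x) \<in> jbracket_family"

lemma jbracket_powr_eq: "jbracket x powr b = (1 + x\<^sup>2) powr (b / 2)"
  by (simp add: jbracket_def powr_half_sqrt[symmetric] powr_powr add_nonneg_nonneg)

lemma jbracket_le: "jbracket x \<le> 1 + \<bar>x\<bar>"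
  unfolding jbracket_def by (intro real_le_lsqrt) (auto simp: power2_eq_square algebra_simps)

lemma tame_jbracket: "tame (\<lambda>x. complex_of_real (jbracket (x - n) powr b))"
  unfolding tame_def
proof (intro exI allI)
  fix x
  define j where "j = nat \<lceil>max 0 b\<rceil>"
  have "jbracket (x - n) powr b \<le> jbracket (x - n) powr real j"
    using jbracket_ge_1 by (intro powr_mono) (auto simp: j_def, linarith)
  also have "\<dots> = jbracket (x - n) ^ j" using jbracket_pos by (simp add: powr_realpow)
  also have "\<dots> \<le> ((1 + \<bar>n\<bar>) * (1 + \<bar>x\<bar>)) ^ j"
  proof (intro power_mono)
    have "jbracket (x - n) \<le> 1 + \<bar>x - n\<bar>" by (rule jbracket_le)
    also have "\<dots> \<le> 1 + \<bar>x\<bar> + \<bar>n\<bar> + \<bar>n\<bar> * \<bar>x\<bar>" by (simp add: add_increasing2)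
    finally show "jbracket (x - n) \<le> (1 + \<bar>n\<bar>) * (1 + \<bar>x\<bar>)" by (simp add: algebra_simps)
  qed (use jbracket_pos[of "x - n"] in simp)
  finally show "cmod (complex_of_real (jbracket (x - n) powr b)) \<le> (1 + \<bar>n\<bar>) ^ nat \<lceil>max 0 b\<rceil> * (1 + \<bar>x\<bar>) ^ nat \<lceil>max 0 b\<rceil>"
    by (simp add: power_mult_distrib j_def)
qed

lemma jbracket_powr_has_vector_derivative:
  "((\<lambda>x. complex_of_real (jbracket (x - n) powr b)) has_vector_derivative
    complex_of_real b * complex_of_real (x - n) * complex_of_real (jbracket (x - n) powr (b - 2))) (at x)"
proof -
  have "1 + (x - n)\<^sup>2 > 0" by (simp add: add_pos_nonneg)
  then have "((\<lambda>x. (1 + (x - n)\<^sup>2) powr (b / 2)) has_real_derivative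
      (b / 2) * (1 + (x - n)\<^sup>2) powr (b / 2 - 1) * (2 * (x - n))) (at x)"
    by (auto intro!: derivative_eq_intros)
  moreover have "b / 2 - 1 = (b - 2) / 2" by (simp add: field_simps)
  then have "(b / 2) * (1 + (x - n)\<^sup>2) powr (b / 2 - 1) * (2 * (x - n)) = b * (x - n) * (1 + (x - n)\<^sup>2) powr ((b - 2) / 2)"
    by (simp only: mult_ac) simp
  ultimately have "((\<lambda>x. jbracket (x - n) powr b) has_real_derivative b * (x - n) * jbracket (x - n) powr (b - 2)) (at x)"
    by (simp only: jbracket_powr_eq)
  then have "((\<lambda>x. complex_of_real (jbracket (x - n) powr b)) has_vector_derivative
    complex_of_real (b * (x - n) * jbracket (x - n) powr (b - 2))) (at x)"
    by (rule has_vector_derivative_of_real)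
  then show ?thesis by simp
qed

lemma tame_smooth_jbracket: "(\<lambda>x. complex_of_real (jbracket (x - n) powr b)) \<in> tame_smooth"
proof (rule all_derivs_coinduct)
  show "(\<lambda>x. complex_of_real (jbracket (x - n) powr b)) \<in> jbracket_family"
    using jbracket_family.base[OF tame_smooth_const[of 1], of n b] by simp
next
  fix g assume "g \<in> jbracket_family"
  then show "\<exists>g'\<in>jbracket_family. \<forall>x. (g has_vector_derivative g' x) (at x)"
  proof induction
    case (base g n b)
    have "(\<lambda>x. complex_of_real b * (g x * (complex_of_real x + - complex_of_real n))) \<in> tame_smooth"
      using base all_derivs_linear(1)[OF tame_smooth_id tame_smooth_const[of "- complex_of_real n"], of 1 1]
      by (intro tame_smooth_mult tame_smooth_const) (auto intro: tame_add tame_mult)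
    then have "(\<lambda>x. complex_of_real b * (g x * (complex_of_real x + - complex_of_real n)) * complex_of_real (jbracket (x - n) powr (b - 2))
        + der g x * complex_of_real (jbracket (x - n) powr b)) \<in> jbracket_family"
      using base by (intro jbracket_family.intros all_derivs_der)
    moreover have "((\<lambda>x. g x * complex_of_real (jbracket (x - n) powr b)) has_vector_derivative
        g x * (complex_of_real b * complex_of_real (x - n) * complex_of_real (jbracket (x - n) powr (b - 2)))
        + der g x * complex_of_real (jbracket (x - n) powr b)) (at x)" for x
      by (intro has_vector_derivative_mult all_derivs_has_vector_derivative[OF base] jbracket_powr_has_vector_derivative)
    ultimately show ?case by (rule_tac bexI) (auto simp: mult_ac)
  next
    case (add g h)
    then obtain g' h' where "g' \<in> jbracket_family" "\<forall>x. (g has_vector_derivative g' x) (at x)"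
       "h' \<in> jbracket_family" "\<forall>x. (h has_vector_derivative h' x) (at x)" by blast
    then show ?case
      by (intro bexI[of _ "\<lambda>x. g' x + h' x"] jbracket_family.add) (auto intro!: has_vector_derivative_add)
  qed
next
  fix g assume "g \<in> jbracket_family"
  then show "tame g"
  proof induction
    case (base g n b)
    show ?case by (rule tame_mult[OF all_derivsD[OF base] tame_jbracket])
  next
    case (add g h)
    show ?case by (rule tame_add[OF add(3,4)])
  qed
qed

section \<open>Boundedness, decay and integrability of Schwartz functions\<close>

lemma schwartz_bounded: "\<phi> \<in> schwartz \<Longrightarrow> \<exists>C. \<forall>x. cmod (\<phi> x) \<le> C"
  by (intro rapid_imp_bounded schwartz_rapid)

lemma schwartz_continuous: "\<phi> \<in> schwartz \<Longrightarrow> continuous_on UNIV \<phi>"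
  by (intro continuous_at_imp_continuous_on) (auto intro: has_vector_derivative_continuous schwartz_has_vector_derivative)

lemma schwartz_measurable [measurable_dest]: "\<phi> \<in> schwartz \<Longrightarrow> \<phi> \<in> borel_measurable borel"
  by (intro borel_measurable_continuous_onI schwartz_continuous)

lemma schwartz_decay:
  assumes "\<phi> \<in> schwartz"
  obtains C where "C \<ge> 0" "\<And>x. cmod (\<phi> x) \<le> C * inverse (1 + x\<^sup>2)"
proof -
  obtain C where C: "\<And>x. (1 + \<bar>x\<bar>) ^ 2 * cmod (\<phi> x) \<le> C"
    using schwartz_rapid[OF assms] unfolding rapid_def by blast
  have "cmod (\<phi> x) \<le> C * inverse (1 + x\<^sup>2)" for x
  proof -
    have "1 + x\<^sup>2 \<le> (1 + \<bar>x\<bar>) ^ 2" by (simp add: power2_eq_square algebra_simps)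
    then have "(1 + x\<^sup>2) * cmod (\<phi> x) \<le> C"
      using C[of x] mult_right_mono[of "1 + x\<^sup>2" "(1 + \<bar>x\<bar>) ^ 2" "cmod (\<phi> x)"] by simp
    then show ?thesis
      by (metis add_pos_nonneg divide_inverse mult.commute pos_le_divide_eq zero_le_power2 zero_less_one)
  qed
  moreover have "C \<ge> 0" using order_trans[OF norm_ge_zero[of "\<phi> 0"], of C] C[of 0] by simp
  ultimately show thesis using that by blast
qed

lemma integrable_inverse_1_plus_square_lborel: "integrable lborel (\<lambda>x::real. inverse (1 + x\<^sup>2))"
  using integrable_inverse_1_plus_square by (simp add: set_integrable_def einterval_def)

lemma schwartz_integrable:
  assumes "\<phi> \<in> schwartz"
  shows "integrable lborel \<phi>"
proof -
  obtain C where C: "\<And>x. cmod (\<phi> x) \<le> C * inverse (1 + x\<^sup>2)" using schwartz_decay[OF assms] by blast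
  show ?thesis
  proof (rule Bochner_Integration.integrable_bound)
    show "integrable lborel (\<lambda>x. C * inverse (1 + x\<^sup>2))"
      by (intro integrable_mult_right integrable_inverse_1_plus_square_lborel)
    show "AE x in lborel. norm (\<phi> x) \<le> norm (C * inverse (1 + x\<^sup>2))"
    proof (intro AE_I2)
      fix x show "norm (\<phi> x) \<le> norm (C * inverse (1 + x\<^sup>2))"
        using C[of x] by (metis abs_ge_self order_trans real_norm_def)
    qed
  qed (use assms in \<open>simp add: schwartz_measurable\<close>)
qed

section \<open>The Fourier transform on Schwartz functions\<close>

text \<open>The Fourier kernel as a function of both variables, so that its symmetry can be used
  after exchanging integrals.\<close>

definition osc :: "real \<Rightarrow> real \<Rightarrow> complex" where
  "osc x \<xi> = exp (- \<i> * complex_of_real (x * \<xi>))"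

lemma norm_osc [simp]: "cmod (osc x \<xi>) = 1"
  by (simp add: osc_def norm_exp_eq_Re)

lemma osc_commute: "osc x \<xi> = osc \<xi> x"
  by (simp add: osc_def mult.commute)

lemma osc_minus: "osc (- x) \<xi> = cnj (osc x \<xi>)" "osc x (- \<xi>) = cnj (osc x \<xi>)"
  by (simp_all add: osc_def exp_cnj)

lemma osc_add: "osc (x + y) \<xi> = osc x \<xi> * osc y \<xi>" "osc x (\<xi> + \<zeta>) = osc x \<xi> * osc x \<zeta>"
  by (simp_all add: osc_def exp_add[symmetric] algebra_simps)

lemma osc_0 [simp]: "osc 0 \<xi> = 1" "osc x 0 = 1"
  by (simp_all add: osc_def)

lemma osc_measurable [measurable]: "(\<lambda>(x, \<xi>). osc x \<xi>) \<in> borel_measurable (borel \<Otimes>\<^sub>M borel)"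
  unfolding osc_def split_beta by measurable

lemma osc_measurable1 [measurable]: "(\<lambda>x. osc x \<xi>) \<in> borel_measurable borel" "osc x \<in> borel_measurable borel"
  unfolding osc_def by measurable

lemma fourier_fun_osc: "fourier_fun \<phi> \<xi> = complex_of_real (1 / sqrt (2 * pi)) * (\<integral>x. \<phi> x * osc x \<xi> \<partial>lborel)"
  by (simp add: fourier_fun_def osc_def)

lemma inv_fourier_fun_eq: "inv_fourier_fun \<phi> x = fourier_fun \<phi> (- x)"
  by (simp add: fourier_fun_def inv_fourier_fun_def mult.commute)

lemma integrable_mult_osc:
  assumes "integrable lborel \<phi>"
  shows "integrable lborel (\<lambda>x. \<phi> x * osc x \<xi>)"
proof (rule Bochner_Integration.integrable_bound[OF assms])
  show "AE x in lborel. norm (\<phi> x * osc x \<xi>) \<le> norm (\<phi> x)" by (simp add: norm_mult)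
qed (use borel_measurable_integrable[OF assms] in measurable)

lemma fourier_fun_linear:
  assumes "integrable lborel \<phi>" "integrable lborel \<eta>"
  shows "fourier_fun (\<lambda>x. a * \<phi> x + b * \<eta> x) \<xi> = a * fourier_fun \<phi> \<xi> + b * fourier_fun \<eta> \<xi>"
proof -
  have "(\<integral>x. (a * \<phi> x + b * \<eta> x) * osc x \<xi> \<partial>lborel)
      = (\<integral>x. a * (\<phi> x * osc x \<xi>) + b * (\<eta> x * osc x \<xi>) \<partial>lborel)"
    by (simp add: algebra_simps)
  also have "\<dots> = a * (\<integral>x. \<phi> x * osc x \<xi> \<partial>lborel) + b * (\<integral>x. \<eta> x * osc x \<xi> \<partial>lborel)"
    using assms[THEN integrable_mult_osc] by simp
  finally show ?thesis by (simp add: fourier_fun_osc algebra_simps)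
qed

lemma sqrt_2pi_ge_1: "sqrt (2 * pi) \<ge> 1"
  using pi_gt3 by simp

lemma norm_fourier_fun_le: "cmod (fourier_fun \<phi> \<xi>) \<le> (\<integral>x. cmod (\<phi> x) \<partial>lborel)"
proof -
  have "cmod (\<integral>x. \<phi> x * osc x \<xi> \<partial>lborel) \<le> (\<integral>x. cmod (\<phi> x * osc x \<xi>) \<partial>lborel)"
    by (rule integral_norm_bound)
  then have *: "cmod (\<integral>x. \<phi> x * osc x \<xi> \<partial>lborel) \<le> (\<integral>x. cmod (\<phi> x) \<partial>lborel)" by (simp add: norm_mult)
  have "cmod (fourier_fun \<phi> \<xi>) = 1 / sqrt (2 * pi) * cmod (\<integral>x. \<phi> x * osc x \<xi> \<partial>lborel)"
    by (simp add: fourier_fun_osc norm_mult norm_divide)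
  also have "\<dots> \<le> 1 * cmod (\<integral>x. \<phi> x * osc x \<xi> \<partial>lborel)"
    using sqrt_2pi_ge_1 by (intro mult_right_mono) auto
  finally show ?thesis using * by simp
qed

text \<open>First-order Taylor expansion of exp(it) at t = -x(\<zeta> - \<xi>), whose remainder is
  at most t^2/2. The bound is quadratic in the increment with the explicit factor x^2.\<close>

lemma osc_remainder: "cmod (osc x \<zeta> - osc x \<xi> - complex_of_real (\<zeta> - \<xi>) * (- \<i> * complex_of_real x * osc x \<xi>))
    \<le> (x * (\<zeta> - \<xi>))\<^sup>2"
proof -
  define t where "t = - (x * (\<zeta> - \<xi>))"
  have "osc x \<zeta> = osc x \<xi> * exp (\<i> * complex_of_real t)"
    by (simp add: osc_def t_def exp_add[symmetric] algebra_simps)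
  then have "osc x \<zeta> - osc x \<xi> - complex_of_real (\<zeta> - \<xi>) * (- \<i> * complex_of_real x * osc x \<xi>)
      = osc x \<xi> * (exp (\<i> * complex_of_real t) - (\<Sum>k\<le>1. (\<i> * complex_of_real t) ^ k / fact k))"
    by (simp add: t_def algebra_simps)
  then have "cmod (osc x \<zeta> - osc x \<xi> - complex_of_real (\<zeta> - \<xi>) * (- \<i> * complex_of_real x * osc x \<xi>))
      = cmod (exp (\<i> * complex_of_real t) - (\<Sum>k\<le>1. (\<i> * complex_of_real t) ^ k / fact k))"
    by (simp only: norm_mult norm_osc)
  also have "\<dots> \<le> \<bar>t\<bar> ^ Suc 1 / fact (Suc 1)" by (rule iexp_approx1)
  also have "\<dots> = (x * (\<zeta> - \<xi>))\<^sup>2 / 2"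
    by (simp add: t_def power2_abs del: One_nat_def flip: power2_eq_square)
  also have "\<dots> \<le> (x * (\<zeta> - \<xi>))\<^sup>2" by simp
  finally show ?thesis .
qed

lemma schwartz_times_id: "\<phi> \<in> schwartz \<Longrightarrow> (\<lambda>x. c * complex_of_real x * \<phi> x) \<in> schwartz"
  using schwartz_times_power[of \<phi> c 1] by simp

text \<open>Differentiation under the integral sign: the quadratic remainder, integrated against
  |\<phi>|, costs (\<zeta> - \<xi>)^2 times the integral of x^2 |\<phi>|, which is finite for a
  Schwartz function.\<close>

lemma fourier_fun_has_vector_derivative:
  assumes "\<phi> \<in> schwartz"
  shows "(fourier_fun \<phi> has_vector_derivative fourier_fun (\<lambda>x. - \<i> * complex_of_real x * \<phi> x) \<xi>) (at \<xi>)"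
proof -
  define \<eta> where "\<eta> = (\<lambda>x. - \<i> * complex_of_real x * \<phi> x)"
  have \<eta>: "\<eta> \<in> schwartz" unfolding \<eta>_def by (rule schwartz_times_id[OF assms])
  have int: "integrable lborel (\<lambda>x. x\<^sup>2 * cmod (\<phi> x))"
    using integrable_norm[OF schwartz_integrable[OF schwartz_times_power[OF assms, of 1 2]]]
    by (simp add: norm_mult norm_power)
  define K where "K = (\<integral>x. x\<^sup>2 * cmod (\<phi> x) \<partial>lborel)"
  have bound: "cmod (fourier_fun \<phi> \<zeta> - fourier_fun \<phi> \<xi> - (\<zeta> - \<xi>) *\<^sub>R fourier_fun \<eta> \<xi>) \<le> (\<zeta> - \<xi>)\<^sup>2 * K" for \<zeta>
  proof -
    let ?r = "\<lambda>x. osc x \<zeta> - osc x \<xi> - complex_of_real (\<zeta> - \<xi>) * (- \<i> * complex_of_real x * osc x \<xi>)"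
    note i = integrable_mult_osc[OF schwartz_integrable]
    have "(\<integral>x. \<phi> x * ?r x \<partial>lborel) = (\<integral>x. \<phi> x * osc x \<zeta> - \<phi> x * osc x \<xi> - complex_of_real (\<zeta> - \<xi>) * (\<eta> x * osc x \<xi>) \<partial>lborel)"
      by (simp add: \<eta>_def algebra_simps)
    also have "\<dots> = (\<integral>x. \<phi> x * osc x \<zeta> \<partial>lborel) - (\<integral>x. \<phi> x * osc x \<xi> \<partial>lborel)
        - complex_of_real (\<zeta> - \<xi>) * (\<integral>x. \<eta> x * osc x \<xi> \<partial>lborel)"
      using i[OF assms] i[OF \<eta>] by simp
    finally have eq: "(\<integral>x. \<phi> x * ?r x \<partial>lborel) = (\<integral>x. \<phi> x * osc x \<zeta> \<partial>lborel) - (\<integral>x. \<phi> x * osc x \<xi> \<partial>lborel)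
        - complex_of_real (\<zeta> - \<xi>) * (\<integral>x. \<eta> x * osc x \<xi> \<partial>lborel)" .
    have "fourier_fun \<phi> \<zeta> - fourier_fun \<phi> \<xi> - (\<zeta> - \<xi>) *\<^sub>R fourier_fun \<eta> \<xi>
        = complex_of_real (1 / sqrt (2 * pi)) * (\<integral>x. \<phi> x * ?r x \<partial>lborel)"
      unfolding fourier_fun_osc eq scaleR_conv_of_real by (simp only: right_diff_distrib mult_ac)
    then have "cmod (fourier_fun \<phi> \<zeta> - fourier_fun \<phi> \<xi> - (\<zeta> - \<xi>) *\<^sub>R fourier_fun \<eta> \<xi>)
       \<le> 1 * cmod (\<integral>x. \<phi> x * ?r x \<partial>lborel)"
      using sqrt_2pi_ge_1 by (simp only: norm_mult) (intro mult_right_mono, auto simp: norm_divide)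
    also have "\<dots> \<le> (\<integral>x. cmod (\<phi> x * ?r x) \<partial>lborel)"
      using integral_norm_bound[of lborel "\<lambda>x. \<phi> x * ?r x"] by simp
    also have "\<dots> \<le> (\<integral>x. (\<zeta> - \<xi>)\<^sup>2 * (x\<^sup>2 * cmod (\<phi> x)) \<partial>lborel)"
    proof (rule integral_mono')
      show "integrable lborel (\<lambda>x. (\<zeta> - \<xi>)\<^sup>2 * (x\<^sup>2 * cmod (\<phi> x)))" by (intro integrable_mult_right int)
      show "cmod (\<phi> x * ?r x) \<le> (\<zeta> - \<xi>)\<^sup>2 * (x\<^sup>2 * cmod (\<phi> x))" for x
        using mult_left_mono[OF osc_remainder[of x \<zeta> \<xi>], of "cmod (\<phi> x)"]
        by (simp add: norm_mult power_mult_distrib mult_ac)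
    qed auto
    also have "\<dots> = (\<zeta> - \<xi>)\<^sup>2 * K" by (simp add: K_def)
    finally show ?thesis .
  qed
  have "(fourier_fun \<phi> has_derivative (\<lambda>h. h *\<^sub>R fourier_fun \<eta> \<xi>)) (at \<xi>)"
  proof (rule has_derivativeI_sandwich[of 1, where H = "\<lambda>\<zeta>. \<bar>\<zeta> - \<xi>\<bar> * K"])
    fix \<zeta> assume "\<zeta> \<noteq> \<xi>"
    then show "norm (fourier_fun \<phi> \<zeta> - fourier_fun \<phi> \<xi> - (\<zeta> - \<xi>) *\<^sub>R fourier_fun \<eta> \<xi>) / norm (\<zeta> - \<xi>) \<le> \<bar>\<zeta> - \<xi>\<bar> * K"
      using bound[of \<zeta>] by (simp add: divide_le_eq power2_eq_square mult_ac)
  qed (auto intro!: bounded_linear_scaleR_left tendsto_eq_intros)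
  then show ?thesis by (simp add: has_vector_derivative_def \<eta>_def)
qed

lemma osc_has_vector_derivative:
  "((\<lambda>x. osc x \<xi>) has_vector_derivative - \<i> * complex_of_real \<xi> * osc x \<xi>) (at x)"
proof -
  have "((\<lambda>z. exp (- \<i> * complex_of_real \<xi> * z)) has_field_derivative
      exp (- \<i> * complex_of_real \<xi> * complex_of_real x) * (- \<i> * complex_of_real \<xi>)) (at (complex_of_real x))"
    by (auto intro!: derivative_eq_intros)
  from has_vector_derivative_real_field[OF this] show ?thesis
    by (simp add: osc_def mult_ac)
qed

lemma tame_smooth_osc: "(\<lambda>x. osc x \<xi>) \<in> tame_smooth"
proof (rule all_derivs_coinduct[where X = "range (\<lambda>c x. c * osc x \<xi>)"])
  show "(\<lambda>x. osc x \<xi>) \<in> range (\<lambda>c x. c * osc x \<xi>)" by (auto intro: image_eqI[of _ _ 1])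
next
  fix g assume "g \<in> range (\<lambda>c x. c * osc x \<xi>)"
  then obtain c where g: "g = (\<lambda>x. c * osc x \<xi>)" by blast
  have "(g has_vector_derivative (c * (- \<i> * complex_of_real \<xi>)) * osc x \<xi>) (at x)" for x
    unfolding g mult.assoc[of c] by (intro has_vector_derivative_mult_right osc_has_vector_derivative)
  moreover have "(\<lambda>x. (c * (- \<i> * complex_of_real \<xi>)) * osc x \<xi>) \<in> range (\<lambda>c x. c * osc x \<xi>)"
    by (rule rangeI)
  ultimately show "\<exists>g'\<in>range (\<lambda>c x. c * osc x \<xi>). \<forall>x. (g has_vector_derivative g' x) (at x)"
    by (rule_tac bexI[rotated]) auto
  show "tame g" unfolding tame_def g
    by (intro exI[of _ 0] exI[of _ "cmod c"]) (simp add: norm_mult)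
qed

lemma schwartz_tendsto_0:
  assumes "\<phi> \<in> schwartz"
  shows "(\<phi> \<longlongrightarrow> 0) at_top" "(\<phi> \<longlongrightarrow> 0) at_bot"
proof -
  obtain C where C: "\<And>x. cmod (\<phi> x) \<le> C * inverse (1 + x\<^sup>2)" using schwartz_decay[OF assms] by blast
  have "((\<lambda>x::real. C * inverse (1 + x\<^sup>2)) \<longlongrightarrow> 0) at_top" "((\<lambda>x::real. C * inverse (1 + x\<^sup>2)) \<longlongrightarrow> 0) at_bot"
    by real_asymp+
  then show "(\<phi> \<longlongrightarrow> 0) at_top" "(\<phi> \<longlongrightarrow> 0) at_bot"
    using C by (auto intro!: Lim_null_comparison[of \<phi> "\<lambda>x. C * inverse (1 + x\<^sup>2)"])
qed

lemma integral_der_schwartz: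
  assumes "\<phi> \<in> schwartz"
  shows "(\<integral>x. der \<phi> x \<partial>lborel) = 0"
proof -
  have eq: "einterval (-\<infinity>) \<infinity> = UNIV" by (simp add: einterval_def)
  have "(LBINT x=-\<infinity>..\<infinity>. der \<phi> x) = 0 - 0"
  proof (rule interval_integral_FTC_integrable)
    show "(\<phi> has_vector_derivative der \<phi> x) (at x)" for x
      by (rule schwartz_has_vector_derivative[OF assms])
    show "isCont (der \<phi>) x" for x
      by (rule has_vector_derivative_continuous[OF schwartz_has_vector_derivative[OF schwartz_der[OF assms]]])
    show "set_integrable lborel (einterval (-\<infinity>) \<infinity>) (der \<phi>)"
      using schwartz_integrable[OF schwartz_der[OF assms]] by (simp add: eq set_integrable_def)
    show "((\<phi> \<circ> real_of_ereal) \<longlongrightarrow> 0) (at_right (-\<infinity>))" "((\<phi> \<circ> real_of_ereal) \<longlongrightarrow> 0) (at_left \<infinity>)"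
      using schwartz_tendsto_0[OF assms] by (simp_all add: ereal_tendsto_simps)
  qed simp
  then show ?thesis
    by (simp add: interval_lebesgue_integral_def eq set_lebesgue_integral_def)
qed

text \<open>Integration by parts: the product of \<phi> with the kernel is again Schwartz, so its
  derivative integrates to 0.\<close>

lemma fourier_fun_der:
  assumes "\<phi> \<in> schwartz"
  shows "fourier_fun (der \<phi>) \<xi> = \<i> * complex_of_real \<xi> * fourier_fun \<phi> \<xi>"
proof -
  have "(\<lambda>x. osc x \<xi> * \<phi> x) \<in> schwartz" by (intro schwartz_mult tame_smooth_osc assms)
  from integral_der_schwartz[OF this] have "(\<integral>x. der (\<lambda>x. osc x \<xi> * \<phi> x) x \<partial>lborel) = 0" .
  moreover have "der (\<lambda>x. osc x \<xi> * \<phi> x) = (\<lambda>x. osc x \<xi> * der \<phi> x + der (\<lambda>x. osc x \<xi>) x * \<phi> x)"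
    by (intro der_eqI has_vector_derivative_mult all_derivs_has_vector_derivative[OF tame_smooth_osc]
        schwartz_has_vector_derivative assms)
  moreover have "der (\<lambda>x. osc x \<xi>) = (\<lambda>x. - \<i> * complex_of_real \<xi> * osc x \<xi>)"
    by (rule der_eqI[OF osc_has_vector_derivative])
  ultimately have "0 = (\<integral>x. der \<phi> x * osc x \<xi> - \<i> * complex_of_real \<xi> * (\<phi> x * osc x \<xi>) \<partial>lborel)"
    by (simp add: algebra_simps)
  also have "\<dots> = (\<integral>x. der \<phi> x * osc x \<xi> \<partial>lborel) - \<i> * complex_of_real \<xi> * (\<integral>x. \<phi> x * osc x \<xi> \<partial>lborel)"
    using integrable_mult_osc[OF schwartz_integrable[OF assms], of \<xi>]
      integrable_mult_osc[OF schwartz_integrable[OF schwartz_der[OF assms]], of \<xi>] by simp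
  finally show ?thesis by (simp add: fourier_fun_osc)
qed

lemma fourier_fun_nth_deriv:
  assumes "\<phi> \<in> schwartz"
  shows "fourier_fun (nth_deriv j \<phi>) \<xi> = (\<i> * complex_of_real \<xi>) ^ j * fourier_fun \<phi> \<xi>"
  by (induction j) (simp_all add: nth_deriv_Suc fourier_fun_der schwartz_nth_deriv[OF assms])

lemma norm_power_fourier_fun_le:
  assumes "\<phi> \<in> schwartz"
  shows "\<bar>\<xi>\<bar> ^ j * cmod (fourier_fun \<phi> \<xi>) \<le> (\<integral>x. cmod (nth_deriv j \<phi> x) \<partial>lborel)"
  using norm_fourier_fun_le[of "nth_deriv j \<phi>" \<xi>]
  by (simp add: fourier_fun_nth_deriv[OF assms] norm_mult norm_power)

text \<open>The transforms of Schwartz functions are closed under differentiation, which becomes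
  multiplication by -ix before the transform. Their decay comes from differentiating before the
  transform.\<close>

lemma schwartz_fourier_fun:
  assumes "\<phi> \<in> schwartz"
  shows "fourier_fun \<phi> \<in> schwartz"
  unfolding schwartz_eq
proof (rule all_derivs_coinduct[where X = "fourier_fun ` schwartz"])
  fix g assume "g \<in> fourier_fun ` schwartz"
  then obtain \<eta> where g: "g = fourier_fun \<eta>" and \<eta>: "\<eta> \<in> schwartz" by blast
  show "\<exists>g'\<in>fourier_fun ` schwartz. \<forall>x. (g has_vector_derivative g' x) (at x)"
    using fourier_fun_has_vector_derivative[OF \<eta>] schwartz_times_id[OF \<eta>, of "- \<i>"] unfolding g by blast
  have "norm (\<xi> ^ j *\<^sub>R g \<xi>) \<le> (\<integral>x. cmod (nth_deriv j \<eta> x) \<partial>lborel)" for j \<xi>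
    using norm_power_fourier_fun_le[OF \<eta>] by (simp add: g power_abs)
  then show "rapid g"
    unfolding rapid_iff bounded_iff by blast
qed (use assms in blast)

lemma schwartz_inv_fourier_fun: "\<phi> \<in> schwartz \<Longrightarrow> inv_fourier_fun \<phi> \<in> schwartz"
  using schwartz_reflect[OF schwartz_fourier_fun] by (simp add: inv_fourier_fun_eq[abs_def])

lemma nth_deriv_fourier_fun:
  assumes "\<phi> \<in> schwartz"
  shows "nth_deriv k (fourier_fun \<phi>) = fourier_fun (\<lambda>x. (- \<i> * complex_of_real x) ^ k * \<phi> x)"
proof (induction k)
  case (Suc k)
  have "der (fourier_fun (\<lambda>x. (- \<i> * complex_of_real x) ^ k * \<phi> x))
      = fourier_fun (\<lambda>x. - \<i> * complex_of_real x * ((- \<i> * complex_of_real x) ^ k * \<phi> x))"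
    by (rule der_eqI, rule fourier_fun_has_vector_derivative, rule schwartz_times_power[OF assms])
  then show ?case by (simp add: nth_deriv_Suc Suc mult.assoc)
qed simp

text \<open>A seminorm of the transform is controlled by a single L^1 norm, so that its convergence
  to 0 becomes a matter of dominated convergence.\<close>

lemma schwartz_seminorm_fourier_le:
  assumes "\<phi> \<in> schwartz"
  shows "schwartz_seminorm j k (fourier_fun \<phi>)
      \<le> (\<integral>x. cmod (nth_deriv j (\<lambda>x. (- \<i> * complex_of_real x) ^ k * \<phi> x) x) \<partial>lborel)"
  unfolding schwartz_seminorm_def
proof (rule cSUP_least)
  fix \<xi> :: real
  show "cmod (\<xi> ^ j *\<^sub>R nth_deriv k (fourier_fun \<phi>) \<xi>)
      \<le> (\<integral>x. cmod (nth_deriv j (\<lambda>x. (- \<i> * complex_of_real x) ^ k * \<phi> x) x) \<partial>lborel)"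
    using norm_power_fourier_fun_le[OF schwartz_times_power[OF assms, of "- \<i>" k], of \<xi> j]
    by (simp add: nth_deriv_fourier_fun[OF assms] power_abs)
qed simp

section \<open>Fourier inversion and Plancherel's inequality\<close>

lemma fourier_fun_measurable [measurable]:
  assumes [measurable]: "\<phi> \<in> borel_measurable borel"
  shows "fourier_fun \<phi> \<in> borel_measurable borel"
  unfolding fourier_fun_osc[abs_def] by measurable

lemma borel_measurable_cnj [measurable (raw)]:
  "f \<in> borel_measurable M \<Longrightarrow> (\<lambda>x. cnj (f x)) \<in> borel_measurable M"
  by (rule measurable_compose, assumption, rule borel_measurable_continuous_onI) (intro continuous_intros)

text \<open>The multiplication formula, by Fubini and the symmetry of the kernel. Inversion,
  Plancherel's inequality and the transform of square-integrable functions all rest on it.\<close>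

lemma integral_fourier_fun_mult:
  assumes f: "integrable lborel f" and g: "integrable lborel g"
  shows "(\<integral>\<xi>. fourier_fun f \<xi> * g \<xi> \<partial>lborel) = (\<integral>x. f x * fourier_fun g x \<partial>lborel)"
proof -
  have [measurable]: "f \<in> borel_measurable borel" "g \<in> borel_measurable borel"
    using f g by (auto dest: borel_measurable_integrable)
  have "integrable (lborel \<Otimes>\<^sub>M lborel) (\<lambda>(x, \<xi>). f x * osc x \<xi> * g \<xi>)"
  proof (rule lborel_pair.Fubini_integrable)
    show "integrable lborel (\<lambda>x. \<integral>\<xi>. norm (case (x, \<xi>) of (x, \<xi>) \<Rightarrow> f x * osc x \<xi> * g \<xi>) \<partial>lborel)"
      using f by (simp add: norm_mult)
    show "AE x in lborel. integrable lborel (\<lambda>\<xi>. case (x, \<xi>) of (x, \<xi>) \<Rightarrow> f x * osc x \<xi> * g \<xi>)"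
      using integrable_mult_osc[OF g] by (auto intro!: AE_I2 integrable_mult_right simp: mult_ac osc_commute)
  qed measurable
  from lborel_pair.Fubini_integral[OF this]
  have "(\<integral>\<xi>. (\<integral>x. f x * osc x \<xi> * g \<xi> \<partial>lborel) \<partial>lborel) = (\<integral>x. (\<integral>\<xi>. f x * osc x \<xi> * g \<xi> \<partial>lborel) \<partial>lborel)" .
  also have "(\<lambda>\<xi>. (\<integral>x. f x * osc x \<xi> * g \<xi> \<partial>lborel)) = (\<lambda>\<xi>. (\<integral>x. f x * osc x \<xi> \<partial>lborel) * g \<xi>)" by simp
  also have "(\<lambda>x. (\<integral>\<xi>. f x * osc x \<xi> * g \<xi> \<partial>lborel)) = (\<lambda>x. f x * (\<integral>\<xi>. g \<xi> * osc \<xi> x \<partial>lborel))"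
    by (rule ext, subst integral_mult_right_zero[symmetric]) (simp add: mult_ac osc_commute)
  finally show ?thesis
    by (simp add: fourier_fun_osc mult.assoc mult.left_commute[of _ "complex_of_real (1 / sqrt (2 * pi))"] del: of_real_divide)
qed

section \<open>Gaussian factors, and Fourier inversion by regularization\<close>

definition gauss :: "real \<Rightarrow> real \<Rightarrow> real" where
  "gauss \<sigma> \<xi> = exp (- (\<sigma> * \<xi>)\<^sup>2 / 2)"

lemma gauss_pos: "gauss \<sigma> \<xi> > 0" and gauss_le_1: "gauss \<sigma> \<xi> \<le> 1"
  by (simp_all add: gauss_def)

lemma gauss_measurable [measurable]: "gauss \<sigma> \<in> borel_measurable borel"
  unfolding gauss_def by measurable

lemma gauss_eq_normal_density:
  assumes "\<sigma> > 0"
  shows "gauss \<sigma> \<xi> = sqrt (2 * pi) * std_normal_density (\<sigma> * \<xi>)"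
    "gauss \<sigma> \<xi> = sqrt (2 * pi) / \<sigma> * normal_density 0 (1 / \<sigma>) \<xi>"
  using assms by (simp_all add: gauss_def normal_density_def real_sqrt_mult real_sqrt_divide power_mult_distrib power_divide field_simps)

lemma integrable_gauss:
  assumes "\<sigma> > 0"
  shows "integrable lborel (gauss \<sigma>)"
proof -
  have "gauss \<sigma> = (\<lambda>\<xi>. sqrt (2 * pi) / \<sigma> * normal_density 0 (1 / \<sigma>) \<xi>)"
    using gauss_eq_normal_density(2)[OF assms] by auto
  then show ?thesis using assms by simp
qed

lemma integrable_complex_gauss: "\<sigma> > 0 \<Longrightarrow> integrable lborel (\<lambda>\<xi>. complex_of_real (gauss \<sigma> \<xi>))"
  by (intro integrable_of_real integrable_gauss)

lemma std_normal_fourier: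
  "(\<integral>x. complex_of_real (std_normal_density x) * osc x t \<partial>lborel) = complex_of_real (exp (- t\<^sup>2 / 2))"
proof -
  have "char std_normal_distribution (- t) = (\<integral>x. std_normal_density x *\<^sub>R iexp (- t * x) \<partial>lborel)"
    unfolding char_def by (subst integral_density) auto
  also have "\<dots> = (\<integral>x. complex_of_real (std_normal_density x) * osc x t \<partial>lborel)"
    by (simp add: osc_def scaleR_conv_of_real mult_ac)
  finally show ?thesis by (simp add: char_std_normal_distribution)
qed

text \<open>The characteristic function of the standard normal distribution, after rescaling. The
  result is an approximate identity as \<sigma> tends to 0, with total mass sqrt(2 pi).\<close>

lemma fourier_fun_gauss:
  assumes "\<sigma> > 0"
  shows "fourier_fun (\<lambda>\<xi>. complex_of_real (gauss \<sigma> \<xi>)) z = complex_of_real (sqrt (2 * pi) * normal_density 0 \<sigma> z)"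
proof -
  have "(\<integral>\<xi>. complex_of_real (gauss \<sigma> \<xi>) * osc \<xi> z \<partial>lborel)
      = \<bar>1 / \<sigma>\<bar> *\<^sub>R (\<integral>x. complex_of_real (gauss \<sigma> (0 + 1 / \<sigma> * x)) * osc (0 + 1 / \<sigma> * x) z \<partial>lborel)"
    using assms by (intro lborel_integral_real_affine) auto
  also have "(\<lambda>x. complex_of_real (gauss \<sigma> (0 + 1 / \<sigma> * x)) * osc (0 + 1 / \<sigma> * x) z)
      = (\<lambda>x. complex_of_real (sqrt (2 * pi)) * (complex_of_real (std_normal_density x) * osc x (z / \<sigma>)))"
    using assms by (auto simp: gauss_eq_normal_density(1) osc_def)
  also have "(\<integral>x. complex_of_real (sqrt (2 * pi)) * (complex_of_real (std_normal_density x) * osc x (z / \<sigma>)) \<partial>lborel)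
      = complex_of_real (sqrt (2 * pi)) * complex_of_real (exp (- (z / \<sigma>)\<^sup>2 / 2))"
    unfolding integral_mult_right_zero std_normal_fourier ..
  finally have "fourier_fun (\<lambda>\<xi>. complex_of_real (gauss \<sigma> \<xi>)) z
      = complex_of_real (1 / \<sigma> * exp (- (z / \<sigma>)\<^sup>2 / 2))"
    using assms by (simp add: fourier_fun_osc scaleR_conv_of_real)
  also have "1 / \<sigma> * exp (- (z / \<sigma>)\<^sup>2 / 2) = sqrt (2 * pi) * normal_density 0 \<sigma> z"
    using assms by (simp add: normal_density_def real_sqrt_mult power_divide)
  finally show ?thesis .
qed

lemma integrable_gauss_osc: "\<sigma> > 0 \<Longrightarrow> integrable lborel (\<lambda>\<xi>. complex_of_real (gauss \<sigma> \<xi>) * cnj (osc \<xi> x))"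
  using integrable_mult_osc[OF integrable_complex_gauss, of \<sigma> "- x"] by (simp add: osc_minus)

lemma fourier_fun_gauss_osc:
  assumes "\<sigma> > 0"
  shows "fourier_fun (\<lambda>\<xi>. complex_of_real (gauss \<sigma> \<xi>) * cnj (osc \<xi> x)) y
    = complex_of_real (sqrt (2 * pi) * normal_density 0 \<sigma> (y - x))"
proof -
  have "fourier_fun (\<lambda>\<xi>. complex_of_real (gauss \<sigma> \<xi>) * cnj (osc \<xi> x)) y
      = fourier_fun (\<lambda>\<xi>. complex_of_real (gauss \<sigma> \<xi>)) (y - x)"
    unfolding fourier_fun_osc by (simp add: mult.assoc osc_minus(2)[symmetric] flip: osc_add(2))
  then show ?thesis using fourier_fun_gauss[OF assms] by simp
qed

lemma gauss_tendsto_1: "(\<lambda>n. gauss (1 / (real n + 1)) \<xi>) \<longlonglongrightarrow> 1"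
proof -
  have "(\<lambda>n. exp (- (1 / (real n + 1) * \<xi>)\<^sup>2 / 2)) \<longlonglongrightarrow> exp (- (0 * \<xi>)\<^sup>2 / 2)"
    by (intro tendsto_intros LIMSEQ_inverse_real_of_nat[unfolded inverse_eq_divide of_nat_Suc, simplified add.commute[of 1]]) auto
  then show ?thesis by (simp add: gauss_def)
qed

text \<open>The inversion integral with a Gaussian factor has two limits as \<sigma> tends to 0.
  Directly, dominated convergence gives the inversion integral itself; after the multiplication
  formula the same quantity is an average of \<eta> against normal densities concentrating at
  x.\<close>

lemma fourier_inversion_schwartz:
  assumes "\<eta> \<in> schwartz"
  shows "inv_fourier_fun (fourier_fun \<eta>) = \<eta>"
proof
  fix x
  define \<sigma> where "\<sigma> n = 1 / (real n + 1)" for n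
  have \<sigma>: "\<sigma> n > 0" for n by (simp add: \<sigma>_def)
  have \<sigma>0: "\<sigma> \<longlonglongrightarrow> 0"
    unfolding \<sigma>_def[abs_def] by real_asymp
  note int = schwartz_integrable[OF assms] schwartz_integrable[OF schwartz_fourier_fun[OF assms]]
  have [measurable]: "\<eta> \<in> borel_measurable borel" "fourier_fun \<eta> \<in> borel_measurable borel"
    using int by (auto dest: borel_measurable_integrable)
  obtain C where C: "\<And>x. cmod (\<eta> x) \<le> C" using schwartz_bounded[OF assms] by blast
  let ?L = "\<lambda>n. (\<integral>\<xi>. fourier_fun \<eta> \<xi> * (complex_of_real (gauss (\<sigma> n) \<xi>) * cnj (osc \<xi> x)) \<partial>lborel)"
  have "?L n = complex_of_real (sqrt (2 * pi)) * (\<integral>z. \<eta> (x + \<sigma> n * z) * complex_of_real (std_normal_density z) \<partial>lborel)" for n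
  proof -
    have "?L n = (\<integral>y. \<eta> y * complex_of_real (sqrt (2 * pi) * normal_density 0 (\<sigma> n) (y - x)) \<partial>lborel)"
      using integral_fourier_fun_mult[OF int(1) integrable_gauss_osc[OF \<sigma>]] fourier_fun_gauss_osc[OF \<sigma>] by simp
    also have "\<dots> = \<bar>\<sigma> n\<bar> *\<^sub>R (\<integral>z. \<eta> (x + \<sigma> n * z) * complex_of_real (sqrt (2 * pi) * normal_density 0 (\<sigma> n) (x + \<sigma> n * z - x)) \<partial>lborel)"
      using \<sigma>[of n] by (intro lborel_integral_real_affine) auto
    also have "(\<lambda>z. \<eta> (x + \<sigma> n * z) * complex_of_real (sqrt (2 * pi) * normal_density 0 (\<sigma> n) (x + \<sigma> n * z - x)))
        = (\<lambda>z. complex_of_real (sqrt (2 * pi) / \<sigma> n) * (\<eta> (x + \<sigma> n * z) * complex_of_real (std_normal_density z)))"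
    proof
      fix z
      have "normal_density 0 (\<sigma> n) (\<sigma> n * z) = std_normal_density z / \<sigma> n"
        using \<sigma>[of n] by (simp add: normal_density_def real_sqrt_mult power_mult_distrib)
      then show "\<eta> (x + \<sigma> n * z) * complex_of_real (sqrt (2 * pi) * normal_density 0 (\<sigma> n) (x + \<sigma> n * z - x))
        = complex_of_real (sqrt (2 * pi) / \<sigma> n) * (\<eta> (x + \<sigma> n * z) * complex_of_real (std_normal_density z))"
        by simp
    qed
    finally show ?thesis
      using \<sigma>[of n] by (simp add: scaleR_conv_of_real)
  qed
  moreover have "(\<lambda>n. complex_of_real (sqrt (2 * pi)) * (\<integral>z. \<eta> (x + \<sigma> n * z) * complex_of_real (std_normal_density z) \<partial>lborel))
     \<longlonglongrightarrow> complex_of_real (sqrt (2 * pi)) * (\<integral>z. \<eta> x * complex_of_real (std_normal_density z) \<partial>lborel)"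
  proof (rule tendsto_mult[OF tendsto_const], rule integral_dominated_convergence[where w = "\<lambda>z. C * std_normal_density z"])
    have lim: "(\<lambda>n. \<eta> (x + \<sigma> n * z) * complex_of_real (std_normal_density z)) \<longlonglongrightarrow> \<eta> x * complex_of_real (std_normal_density z)" for z
    proof -
    have "isCont \<eta> x"
      using schwartz_continuous[OF assms] by (simp add: continuous_on_eq_continuous_at)
    moreover have "(\<lambda>n. x + \<sigma> n * z) \<longlonglongrightarrow> x + 0 * z" by (intro tendsto_intros \<sigma>0)
    ultimately have "(\<lambda>n. \<eta> (x + \<sigma> n * z)) \<longlonglongrightarrow> \<eta> x" by (auto intro: isCont_tendsto_compose)
    then show ?thesis
      by (intro tendsto_intros)
    qed
    show "AE z in lborel. (\<lambda>n. \<eta> (x + \<sigma> n * z) * complex_of_real (std_normal_density z)) \<longlonglongrightarrow> \<eta> x * complex_of_real (std_normal_density z)"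
      using lim by simp
    show "AE z in lborel. norm (\<eta> (x + \<sigma> n * z) * complex_of_real (std_normal_density z)) \<le> C * std_normal_density z" for n
      using C by (simp add: norm_mult mult_right_mono)
  qed auto
  moreover have "?L \<longlonglongrightarrow> (\<integral>\<xi>. fourier_fun \<eta> \<xi> * (complex_of_real 1 * cnj (osc \<xi> x)) \<partial>lborel)"
  proof (rule integral_dominated_convergence[where w = "\<lambda>\<xi>. cmod (fourier_fun \<eta> \<xi>)"]; (rule AE_I2)?)
    show "(\<lambda>n. fourier_fun \<eta> \<xi> * (complex_of_real (gauss (\<sigma> n) \<xi>) * cnj (osc \<xi> x)))
        \<longlonglongrightarrow> fourier_fun \<eta> \<xi> * (complex_of_real 1 * cnj (osc \<xi> x))" for \<xi>
      unfolding \<sigma>_def by (intro tendsto_intros gauss_tendsto_1)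
    show "norm (fourier_fun \<eta> \<xi> * (complex_of_real (gauss (\<sigma> n) \<xi>) * cnj (osc \<xi> x))) \<le> cmod (fourier_fun \<eta> \<xi>)" for \<xi> n
      using gauss_pos[of "\<sigma> n" \<xi>] gauss_le_1[of "\<sigma> n" \<xi>] by (simp add: norm_mult mult_left_le)
  qed (use int in auto)
  ultimately have "(\<integral>\<xi>. fourier_fun \<eta> \<xi> * (complex_of_real 1 * cnj (osc \<xi> x)) \<partial>lborel)
      = complex_of_real (sqrt (2 * pi)) * (\<integral>z. \<eta> x * complex_of_real (std_normal_density z) \<partial>lborel)"
    by (metis (no_types, lifting) LIMSEQ_unique ext)
  moreover have "(\<integral>z. \<eta> x * complex_of_real (std_normal_density z) \<partial>lborel) = \<eta> x"
    by (simp add: integral_complex_of_real)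
  ultimately show "inv_fourier_fun (fourier_fun \<eta>) x = \<eta> x"
    by (simp add: inv_fourier_fun_eq fourier_fun_osc osc_minus)
qed

text \<open>Fatou's lemma. The threshold N serves Cauchy sequences, whose differences are bounded
  only from some index on.\<close>

lemma nn_integral_le_of_tendsto:
  fixes u :: "nat \<Rightarrow> 'a \<Rightarrow> ennreal"
  assumes [measurable]: "\<And>n. u n \<in> borel_measurable M"
    and lim: "AE x in M. (\<lambda>n. u n x) \<longlonglongrightarrow> f x" and le: "\<And>n. n \<ge> N \<Longrightarrow> (\<integral>\<^sup>+x. u n x \<partial>M) \<le> B"
  shows "(\<integral>\<^sup>+x. f x \<partial>M) \<le> B"
proof -
  have "(\<integral>\<^sup>+x. f x \<partial>M) = (\<integral>\<^sup>+x. liminf (\<lambda>n. u n x) \<partial>M)"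
    using lim by (intro nn_integral_cong_AE) (auto simp: lim_imp_Liminf elim!: eventually_mono)
  also have "\<dots> \<le> liminf (\<lambda>n. \<integral>\<^sup>+x. u n x \<partial>M)" by (rule nn_integral_liminf) simp
  also have "\<dots> \<le> B"
    using le by (intro Liminf_le) (auto simp: eventually_sequentially)
  finally show ?thesis .
qed


text \<open>A Schur test: the product of the two moduli is at most half the sum of their squares,
  and the kernel has mass 1 in each variable separately.\<close>

lemma gaussian_bilinear_form_le:
  assumes [measurable]: "f \<in> borel_measurable borel" and \<sigma>: "\<sigma> > 0"
  shows "(\<integral>\<^sup>+x. \<integral>\<^sup>+y. ennreal (cmod (f x) * cmod (f y) * normal_density 0 \<sigma> (y - x)) \<partial>lborel \<partial>lborel)
    \<le> (\<integral>\<^sup>+x. ennreal ((cmod (f x))\<^sup>2) \<partial>lborel)"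
proof -
  define k where "k z = normal_density 0 \<sigma> z" for z
  have k0: "k z \<ge> 0" for z by (simp add: k_def)
  have [measurable]: "k \<in> borel_measurable borel" unfolding k_def by measurable
  have k1: "(\<integral>\<^sup>+z. ennreal (k z) \<partial>lborel) = 1"
    using \<sigma> unfolding k_def by (subst nn_integral_eq_integral) auto
  have ky: "(\<integral>\<^sup>+y. ennreal (k (y - x)) \<partial>lborel) = 1" for x
    using nn_integral_real_affine[of "\<lambda>z. ennreal (k (z - x))" 1 x] k1 by simp
  have kx: "(\<integral>\<^sup>+x. ennreal (k (y - x)) \<partial>lborel) = 1" for y
    using nn_integral_real_affine[of "\<lambda>x. ennreal (k (y - x))" "- 1" y] k1 by simp
  define S where "S x = ennreal ((cmod (f x))\<^sup>2 / 2)" for x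
  have [measurable]: "S \<in> borel_measurable borel" unfolding S_def by measurable
  have "(\<integral>\<^sup>+x. \<integral>\<^sup>+y. ennreal (cmod (f x) * cmod (f y) * k (y - x)) \<partial>lborel \<partial>lborel)
      \<le> (\<integral>\<^sup>+x. \<integral>\<^sup>+y. S x * ennreal (k (y - x)) + S y * ennreal (k (y - x)) \<partial>lborel \<partial>lborel)"
  proof (intro nn_integral_mono)
    fix x y
    have "cmod (f x) * cmod (f y) \<le> (cmod (f x))\<^sup>2 / 2 + (cmod (f y))\<^sup>2 / 2"
      using sum_squares_bound[of "cmod (f x)" "cmod (f y)"] by simp
    then have "cmod (f x) * cmod (f y) * k (y - x) \<le> ((cmod (f x))\<^sup>2 / 2 + (cmod (f y))\<^sup>2 / 2) * k (y - x)"
      by (intro mult_right_mono k0)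
    then show "ennreal (cmod (f x) * cmod (f y) * k (y - x)) \<le> S x * ennreal (k (y - x)) + S y * ennreal (k (y - x))"
      using k0 by (simp add: S_def distrib_right ennreal_leI flip: ennreal_mult ennreal_plus)
  qed
  also have "\<dots> = (\<integral>\<^sup>+x. \<integral>\<^sup>+y. S x * ennreal (k (y - x)) \<partial>lborel \<partial>lborel) + (\<integral>\<^sup>+x. \<integral>\<^sup>+y. S y * ennreal (k (y - x)) \<partial>lborel \<partial>lborel)"
    by (simp add: nn_integral_add)
  also have "(\<integral>\<^sup>+x. \<integral>\<^sup>+y. S y * ennreal (k (y - x)) \<partial>lborel \<partial>lborel) = (\<integral>\<^sup>+y. \<integral>\<^sup>+x. S y * ennreal (k (y - x)) \<partial>lborel \<partial>lborel)"
    by (rule lborel_pair.Fubini') measurable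
  also have "(\<integral>\<^sup>+x. \<integral>\<^sup>+y. S x * ennreal (k (y - x)) \<partial>lborel \<partial>lborel) = (\<integral>\<^sup>+x. S x \<partial>lborel)"
    by (simp add: nn_integral_cmult ky)
  also have "(\<integral>\<^sup>+y. \<integral>\<^sup>+x. S y * ennreal (k (y - x)) \<partial>lborel \<partial>lborel) = (\<integral>\<^sup>+x. S x \<partial>lborel)"
    by (simp add: nn_integral_cmult kx)
  also have "(\<integral>\<^sup>+x. S x \<partial>lborel) + (\<integral>\<^sup>+x. S x \<partial>lborel) = (\<integral>\<^sup>+x. S x + S x \<partial>lborel)"
    by (simp add: nn_integral_add)
  also have "\<dots> = (\<integral>\<^sup>+x. ennreal ((cmod (f x))\<^sup>2) \<partial>lborel)"
    by (simp add: S_def flip: ennreal_plus)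
  finally show ?thesis by (simp add: k_def)
qed

text \<open>Without integrability the Bochner integral is 0 by convention, so the inequality is
  unconditional.\<close>

lemma norm_integral_le_nn_integral:
  fixes f :: "'a \<Rightarrow> 'b :: {banach, second_countable_topology}"
  shows "ennreal (norm (\<integral>x. f x \<partial>M)) \<le> (\<integral>\<^sup>+x. norm (f x) \<partial>M)"
  by (cases "integrable M f") (simp_all add: integral_norm_bound_ennreal not_integrable_integral_eq)

text \<open>With a Gaussian factor, the multiplication formula turns the square integral of the
  transform into a bilinear form in f with a normal density as kernel, which the Schur test bounds
  uniformly in the regularization. Fatou's lemma then removes the factor. The right-hand side may be
  infinite.\<close>

lemma Plancherel_le:
  assumes f: "integrable lborel f"
  shows "(\<integral>\<^sup>+\<xi>. ennreal ((cmod (fourier_fun f \<xi>))\<^sup>2) \<partial>lborel) \<le> (\<integral>\<^sup>+x. ennreal ((cmod (f x))\<^sup>2) \<partial>lborel)"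
proof (rule nn_integral_le_of_tendsto)
  have [measurable]: "f \<in> borel_measurable borel"
    using f by (auto dest: borel_measurable_integrable)
  define \<sigma> where "\<sigma> n = 1 / (real n + 1)" for n
  have \<sigma>: "\<sigma> n > 0" for n by (simp add: \<sigma>_def)
  let ?u = "\<lambda>n \<xi>. ennreal ((cmod (fourier_fun f \<xi>))\<^sup>2 * gauss (\<sigma> n) \<xi>)"
  show "?u n \<in> borel_measurable lborel" for n by measurable
  show "AE \<xi> in lborel. (\<lambda>n. ?u n \<xi>) \<longlonglongrightarrow> ennreal ((cmod (fourier_fun f \<xi>))\<^sup>2)"
  proof (intro AE_I2 tendsto_ennrealI)
    show "(\<lambda>n. (cmod (fourier_fun f \<xi>))\<^sup>2 * gauss (\<sigma> n) \<xi>) \<longlonglongrightarrow> (cmod (fourier_fun f \<xi>))\<^sup>2" for \<xi>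
      using tendsto_mult[OF tendsto_const gauss_tendsto_1, of "(cmod (fourier_fun f \<xi>))\<^sup>2" \<xi>] by (simp add: \<sigma>_def)
  qed
  define A where "A = (\<integral>x. cmod (f x) \<partial>lborel)"
  have A: "cmod (fourier_fun f \<xi>) \<le> A" for \<xi> unfolding A_def by (rule norm_fourier_fun_le)
  then have "A \<ge> 0" using norm_ge_zero order_trans by blast
  show "(\<integral>\<^sup>+\<xi>. ?u n \<xi> \<partial>lborel) \<le> (\<integral>\<^sup>+x. ennreal ((cmod (f x))\<^sup>2) \<partial>lborel)" for n
  proof -
    \<comment> \<open>Pairing the transform of f with g gives the regularized square integral. The
      Gaussian factor makes g integrable, the transform of f being bounded, so that the
      multiplication formula applies to f and g.\<close>
    define g where "g \<xi> = cnj (fourier_fun f \<xi>) * complex_of_real (gauss (\<sigma> n) \<xi>)" for \<xi>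
    have g: "integrable lborel g"
    proof (rule Bochner_Integration.integrable_bound)
      show "integrable lborel (\<lambda>\<xi>. A * gauss (\<sigma> n) \<xi>)" by (intro integrable_mult_right integrable_gauss \<sigma>)
      show "g \<in> borel_measurable lborel" unfolding g_def[abs_def] by measurable
      show "AE \<xi> in lborel. norm (g \<xi>) \<le> norm (A * gauss (\<sigma> n) \<xi>)"
        using A gauss_pos[of "\<sigma> n"] \<open>A \<ge> 0\<close>
        by (auto simp: g_def norm_mult abs_mult intro!: mult_mono)
    qed
    have Fg: "fourier_fun g x = cnj (\<integral>y. f y * complex_of_real (normal_density 0 (\<sigma> n) (y - x)) \<partial>lborel)" for x
    proof -
      have "(\<integral>\<xi>. g \<xi> * osc \<xi> x \<partial>lborel)
          = (\<integral>\<xi>. cnj (fourier_fun f \<xi> * (complex_of_real (gauss (\<sigma> n) \<xi>) * cnj (osc \<xi> x))) \<partial>lborel)"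
        by (intro Bochner_Integration.integral_cong) (simp_all add: g_def mult_ac)
      then have "fourier_fun g x = complex_of_real (1 / sqrt (2 * pi)) *
          cnj (\<integral>\<xi>. fourier_fun f \<xi> * (complex_of_real (gauss (\<sigma> n) \<xi>) * cnj (osc \<xi> x)) \<partial>lborel)"
        unfolding fourier_fun_osc[of g] Bochner_Integration.integral_cnj by (rule arg_cong)
      also have "(\<integral>\<xi>. fourier_fun f \<xi> * (complex_of_real (gauss (\<sigma> n) \<xi>) * cnj (osc \<xi> x)) \<partial>lborel)
          = (\<integral>y. complex_of_real (sqrt (2 * pi)) * (f y * complex_of_real (normal_density 0 (\<sigma> n) (y - x))) \<partial>lborel)"
        using integral_fourier_fun_mult[OF f integrable_gauss_osc[OF \<sigma>]] fourier_fun_gauss_osc[OF \<sigma>]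
        by (simp add: mult_ac)
      finally show ?thesis by simp
    qed
    have eq: "cmod (fourier_fun f \<xi> * g \<xi>) = (cmod (fourier_fun f \<xi>))\<^sup>2 * gauss (\<sigma> n) \<xi>" for \<xi>
      using gauss_pos[of "\<sigma> n" \<xi>] by (simp add: g_def norm_mult power2_eq_square)
    have "(\<integral>\<^sup>+\<xi>. ?u n \<xi> \<partial>lborel) = ennreal (\<integral>\<xi>. (cmod (fourier_fun f \<xi>))\<^sup>2 * gauss (\<sigma> n) \<xi> \<partial>lborel)"
    proof -
      have "integrable lborel (\<lambda>\<xi>. fourier_fun f \<xi> * g \<xi>)"
      proof (rule Bochner_Integration.integrable_bound)
        show "integrable lborel (\<lambda>\<xi>. A * cmod (g \<xi>))" using g by simp
        show "(\<lambda>\<xi>. fourier_fun f \<xi> * g \<xi>) \<in> borel_measurable lborel" unfolding g_def[abs_def] by measurable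
        show "AE \<xi> in lborel. norm (fourier_fun f \<xi> * g \<xi>) \<le> norm (A * cmod (g \<xi>))"
          using A \<open>A \<ge> 0\<close> by (auto simp: norm_mult abs_mult intro!: mult_right_mono)
      qed
      from integrable_norm[OF this] show ?thesis
        unfolding eq by (intro nn_integral_eq_integral) (simp_all add: gauss_pos less_imp_le)
    qed
    also have "(\<integral>\<xi>. (cmod (fourier_fun f \<xi>))\<^sup>2 * gauss (\<sigma> n) \<xi> \<partial>lborel) = cmod (\<integral>\<xi>. fourier_fun f \<xi> * g \<xi> \<partial>lborel)"
    proof -
      have "(\<integral>\<xi>. fourier_fun f \<xi> * g \<xi> \<partial>lborel) = (\<integral>\<xi>. complex_of_real ((cmod (fourier_fun f \<xi>))\<^sup>2 * gauss (\<sigma> n) \<xi>) \<partial>lborel)"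
        by (intro Bochner_Integration.integral_cong) (simp_all add: g_def mult.assoc[symmetric] complex_norm_square[symmetric])
      moreover have "(\<integral>\<xi>. (cmod (fourier_fun f \<xi>))\<^sup>2 * gauss (\<sigma> n) \<xi> \<partial>lborel) \<ge> 0"
        using gauss_pos[of "\<sigma> n"] by (intro integral_nonneg_AE AE_I2 mult_nonneg_nonneg) (auto simp: less_imp_le)
      ultimately show ?thesis unfolding integral_complex_of_real by simp
    qed
    also have "(\<integral>\<xi>. fourier_fun f \<xi> * g \<xi> \<partial>lborel)
        = (\<integral>x. f x * cnj (\<integral>y. f y * complex_of_real (normal_density 0 (\<sigma> n) (y - x)) \<partial>lborel) \<partial>lborel)"
      unfolding integral_fourier_fun_mult[OF f g] Fg ..
    also have "ennreal (cmod \<dots>) \<le> (\<integral>\<^sup>+x. ennreal (cmod (f x * cnj (\<integral>y. f y * complex_of_real (normal_density 0 (\<sigma> n) (y - x)) \<partial>lborel))) \<partial>lborel)"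
      by (rule norm_integral_le_nn_integral)
    also have "\<dots> \<le> (\<integral>\<^sup>+x. ennreal (cmod (f x)) * (\<integral>\<^sup>+y. ennreal (cmod (f y * complex_of_real (normal_density 0 (\<sigma> n) (y - x)))) \<partial>lborel) \<partial>lborel)"
    proof (intro nn_integral_mono)
      fix x
      have "ennreal (cmod (f x * cnj (\<integral>y. f y * complex_of_real (normal_density 0 (\<sigma> n) (y - x)) \<partial>lborel)))
          = ennreal (cmod (f x)) * ennreal (cmod (\<integral>y. f y * complex_of_real (normal_density 0 (\<sigma> n) (y - x)) \<partial>lborel))"
        unfolding norm_mult complex_mod_cnj by (intro ennreal_mult) auto
      also have "\<dots> \<le> ennreal (cmod (f x)) * (\<integral>\<^sup>+y. ennreal (cmod (f y * complex_of_real (normal_density 0 (\<sigma> n) (y - x)))) \<partial>lborel)"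
        by (intro mult_left_mono norm_integral_le_nn_integral) auto
      finally show "ennreal (cmod (f x * cnj (\<integral>y. f y * complex_of_real (normal_density 0 (\<sigma> n) (y - x)) \<partial>lborel)))
          \<le> ennreal (cmod (f x)) * (\<integral>\<^sup>+y. ennreal (cmod (f y * complex_of_real (normal_density 0 (\<sigma> n) (y - x)))) \<partial>lborel)" .
    qed
    also have "\<dots> = (\<integral>\<^sup>+x. \<integral>\<^sup>+y. ennreal (cmod (f x) * cmod (f y) * normal_density 0 (\<sigma> n) (y - x)) \<partial>lborel \<partial>lborel)"
      by (simp add: norm_mult ennreal_mult mult.assoc nn_integral_cmult)
    also have "\<dots> \<le> (\<integral>\<^sup>+x. ennreal ((cmod (f x))\<^sup>2) \<partial>lborel)"
      by (intro gaussian_bilinear_form_le \<sigma>) measurable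
    finally show ?thesis .
  qed
qed


section \<open>Square-integrable functions and their Fourier transform\<close>

definition sqnorm :: "(real \<Rightarrow> complex) \<Rightarrow> ennreal" where
  "sqnorm g = (\<integral>\<^sup>+x. ennreal ((cmod (g x))\<^sup>2) \<partial>lborel)"

definition square_integrable :: "(real \<Rightarrow> complex) \<Rightarrow> bool" where
  "square_integrable g \<longleftrightarrow> g \<in> borel_measurable borel \<and> sqnorm g < \<infinity>"

lemma square_integrable_measurable [measurable_dest]: "square_integrable g \<Longrightarrow> g \<in> borel_measurable borel"
  by (simp add: square_integrable_def)

lemma square_integrable_iff:
  "square_integrable g \<longleftrightarrow> g \<in> borel_measurable borel \<and> integrable lborel (\<lambda>x. (cmod (g x))\<^sup>2)"
  unfolding square_integrable_def sqnorm_def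
  by (auto simp: integrable_iff_bounded)

lemma square_integrable_mult:
  assumes "square_integrable f" "square_integrable g"
  shows "integrable lborel (\<lambda>x. f x * g x)"
proof (rule Bochner_Integration.integrable_bound)
  show "integrable lborel (\<lambda>x. (cmod (f x))\<^sup>2 + (cmod (g x))\<^sup>2)"
    using assms by (simp add: square_integrable_iff)
  have "cmod (f x) * cmod (g x) \<le> (cmod (f x))\<^sup>2 + (cmod (g x))\<^sup>2" for x
    using sum_squares_bound[of "cmod (f x)" "cmod (g x)"] mult_nonneg_nonneg[OF norm_ge_zero[of "f x"] norm_ge_zero[of "g x"]]
    by linarith
  then show "AE x in lborel. norm (f x * g x) \<le> norm ((cmod (f x))\<^sup>2 + (cmod (g x))\<^sup>2)"
    by (simp add: norm_mult)
qed (use assms in measurable)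

lemma schwartz_square_integrable: "\<phi> \<in> schwartz \<Longrightarrow> square_integrable \<phi>"
  unfolding square_integrable_iff
proof
  assume \<phi>: "\<phi> \<in> schwartz"
  then show m: "\<phi> \<in> borel_measurable borel" by measurable
  obtain C where C: "\<And>x. cmod (\<phi> x) \<le> C" using schwartz_bounded[OF \<phi>] by blast
  show "integrable lborel (\<lambda>x. (cmod (\<phi> x))\<^sup>2)"
  proof (rule Bochner_Integration.integrable_bound)
    show "integrable lborel (\<lambda>x. C * cmod (\<phi> x))" using schwartz_integrable[OF \<phi>] by simp
    have "(cmod (\<phi> x))\<^sup>2 \<le> \<bar>C * cmod (\<phi> x)\<bar>" for x
      using mult_right_mono[OF C norm_ge_zero[of "\<phi> x"], of x] by (simp add: power2_eq_square)
    then show "AE x in lborel. norm ((cmod (\<phi> x))\<^sup>2) \<le> norm (C * cmod (\<phi> x))" by simp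
  qed (use m in measurable)
qed

lemma sqnorm_mono:
  assumes "\<And>x. cmod (f x) \<le> C * cmod (g x)" "C \<ge> 0" and [measurable]: "g \<in> borel_measurable borel"
  shows "sqnorm f \<le> ennreal (C\<^sup>2) * sqnorm g"
proof -
  have "sqnorm f \<le> (\<integral>\<^sup>+x. ennreal (C\<^sup>2) * ennreal ((cmod (g x))\<^sup>2) \<partial>lborel)"
    unfolding sqnorm_def
  proof (intro nn_integral_mono)
    fix x
    have "(cmod (f x))\<^sup>2 \<le> (C * cmod (g x))\<^sup>2" by (intro power_mono assms) simp
    then show "ennreal ((cmod (f x))\<^sup>2) \<le> ennreal (C\<^sup>2) * ennreal ((cmod (g x))\<^sup>2)"
      by (simp add: power_mult_distrib ennreal_leI flip: ennreal_mult)
  qed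
  then show ?thesis by (simp add: sqnorm_def nn_integral_cmult)
qed

text \<open>Weak convergence from fast strong convergence. The inequality ab \<le> 2^j a^2 + 2^-j
  b^2 stands in for Cauchy-Schwarz; the rate 8^-j leaves a null sequence after the loss of
  2^j.\<close>

lemma tendsto_integral_mult_of_sqnorm:
  assumes h: "square_integrable h" and hj: "\<And>j. square_integrable (hs j)" and \<eta>: "square_integrable \<eta>"
    and bound: "\<And>j. sqnorm (\<lambda>x. hs j x - h x) \<le> ennreal (c * (1 / 8) ^ j)" and c: "c \<ge> 0"
  shows "(\<lambda>j. \<integral>x. hs j x * \<eta> x \<partial>lborel) \<longlonglongrightarrow> (\<integral>x. h x * \<eta> x \<partial>lborel)"
proof -
  note [measurable] = square_integrable_measurable[OF h] square_integrable_measurable[OF \<eta>] square_integrable_measurable[OF hj]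
  obtain E where E: "sqnorm \<eta> = ennreal E" "E \<ge> 0"
    using \<eta> unfolding square_integrable_def by (cases "sqnorm \<eta>") auto
  have "cmod ((\<integral>x. hs j x * \<eta> x \<partial>lborel) - (\<integral>x. h x * \<eta> x \<partial>lborel)) \<le> (c + E) * (1 / 2) ^ j" for j
  proof -
    have "(\<integral>x. hs j x * \<eta> x \<partial>lborel) - (\<integral>x. h x * \<eta> x \<partial>lborel) = (\<integral>x. (hs j x - h x) * \<eta> x \<partial>lborel)"
      using square_integrable_mult[OF h \<eta>] square_integrable_mult[OF hj \<eta>] by (simp add: left_diff_distrib)
    then have "ennreal (cmod ((\<integral>x. hs j x * \<eta> x \<partial>lborel) - (\<integral>x. h x * \<eta> x \<partial>lborel)))
        \<le> (\<integral>\<^sup>+x. ennreal (cmod ((hs j x - h x) * \<eta> x)) \<partial>lborel)"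
      by (simp only: norm_integral_le_nn_integral)
    also have "\<dots> \<le> (\<integral>\<^sup>+x. ennreal (2 ^ j) * ennreal ((cmod (hs j x - h x))\<^sup>2) + ennreal ((1 / 2) ^ j) * ennreal ((cmod (\<eta> x))\<^sup>2) \<partial>lborel)"
    proof (intro nn_integral_mono)
      fix x
      define a b where "a = cmod (hs j x - h x)" and "b = cmod (\<eta> x)"
      have "a * b \<le> 2 ^ j * a\<^sup>2 + (1 / 2) ^ j * b\<^sup>2"
      proof -
        define p where "p = (2::real) ^ j"
        have p: "p > 0" "(1 / 2) ^ j = 1 / p" by (simp_all add: p_def power_divide)
        have "0 \<le> p * (a * b)" using p by (simp add: a_def b_def)
        moreover have "2 * (p * a) * b \<le> (p * a)\<^sup>2 + b\<^sup>2" by (rule sum_squares_bound)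
        ultimately have "p * (a * b) \<le> (p * a)\<^sup>2 + b\<^sup>2" by (simp only: mult.assoc)
        then have "a * b \<le> ((p * a)\<^sup>2 + b\<^sup>2) / p" using p by (simp add: pos_le_divide_eq mult.commute)
        also have "\<dots> = p * a\<^sup>2 + 1 / p * b\<^sup>2" using p by (simp add: add_divide_distrib power2_eq_square)
        finally show ?thesis using p by (simp add: p_def)
      qed
      then show "ennreal (cmod ((hs j x - h x) * \<eta> x)) \<le> ennreal (2 ^ j) * ennreal ((cmod (hs j x - h x))\<^sup>2) + ennreal ((1 / 2) ^ j) * ennreal ((cmod (\<eta> x))\<^sup>2)"
        by (simp add: norm_mult a_def b_def ennreal_leI flip: ennreal_mult ennreal_plus)
    qed
    also have "\<dots> = ennreal (2 ^ j) * sqnorm (\<lambda>x. hs j x - h x) + ennreal ((1 / 2) ^ j) * sqnorm \<eta>"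
      by (simp add: nn_integral_add nn_integral_cmult sqnorm_def)
    also have "\<dots> \<le> ennreal (2 ^ j) * ennreal (c * (1 / 8) ^ j) + ennreal ((1 / 2) ^ j) * ennreal E"
      using bound E by (intro add_mono mult_left_mono) auto
    also have "\<dots> = ennreal (2 ^ j * (c * (1 / 8) ^ j) + (1 / 2) ^ j * E)"
      using c E by (simp flip: ennreal_mult ennreal_plus)
    finally have "cmod ((\<integral>x. hs j x * \<eta> x \<partial>lborel) - (\<integral>x. h x * \<eta> x \<partial>lborel)) \<le> 2 ^ j * (c * (1 / 8) ^ j) + (1 / 2) ^ j * E"
      using c E by (subst (asm) ennreal_le_iff) auto
    also have "2 ^ j * (c * (1 / 8) ^ j) = c * (1 / 4) ^ j" by (simp flip: power_mult_distrib)
    also have "\<dots> \<le> c * (1 / 2) ^ j" using c by (intro mult_left_mono power_mono) auto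
    finally show ?thesis by (simp add: algebra_simps)
  qed
  moreover have "(\<lambda>j. (c + E) * (1 / 2) ^ j) \<longlonglongrightarrow> 0"
    by (intro tendsto_mult_right_zero LIMSEQ_power_zero) auto
  ultimately have "(\<lambda>j. (\<integral>x. hs j x * \<eta> x \<partial>lborel) - (\<integral>x. h x * \<eta> x \<partial>lborel)) \<longlonglongrightarrow> 0"
    by (rule_tac Lim_null_comparison[OF always_eventually, rotated]) auto
  then show ?thesis by (rule LIM_zero_cancel)
qed

lemma sqnorm_tail:
  assumes "square_integrable g" "e > 0"
  shows "\<exists>R::nat. sqnorm (\<lambda>x. if \<bar>x\<bar> \<le> real R then 0 else g x) \<le> ennreal e"
proof -
  have [measurable]: "g \<in> borel_measurable borel" using assms by measurable
  have "(\<lambda>R::nat. sqnorm (\<lambda>x. if \<bar>x\<bar> \<le> real R then 0 else g x)) \<longlonglongrightarrow> (\<integral>\<^sup>+x. 0 \<partial>(lborel :: real measure))"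
    unfolding sqnorm_def
  proof (rule nn_integral_dominated_convergence[where w = "\<lambda>x. ennreal ((cmod (g x))\<^sup>2)" and u' = "\<lambda>_. 0"
        and u = "\<lambda>R x. ennreal ((cmod (if \<bar>x\<bar> \<le> real R then 0 else g x))\<^sup>2)"])
    show "(\<integral>\<^sup>+x. ennreal ((cmod (g x))\<^sup>2) \<partial>lborel) < \<infinity>"
      using assms by (simp add: square_integrable_def sqnorm_def)
    show "AE x in lborel. (\<lambda>R::nat. ennreal ((cmod (if \<bar>x\<bar> \<le> real R then 0 else g x))\<^sup>2)) \<longlonglongrightarrow> 0"
    proof (rule AE_I2)
      fix x :: real
      have "eventually (\<lambda>R::nat. \<bar>x\<bar> \<le> real R) sequentially"
        using filterlim_real_sequentially unfolding filterlim_at_top by blast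
      then have "eventually (\<lambda>R::nat. ennreal ((cmod (if \<bar>x\<bar> \<le> real R then 0 else g x))\<^sup>2) = 0) sequentially"
        by (rule eventually_mono) simp
      then show "(\<lambda>R::nat. ennreal ((cmod (if \<bar>x\<bar> \<le> real R then 0 else g x))\<^sup>2)) \<longlonglongrightarrow> 0"
        by (rule tendsto_eventually)
    qed
  qed auto
  then have "eventually (\<lambda>R::nat. sqnorm (\<lambda>x. if \<bar>x\<bar> \<le> real R then 0 else g x) < ennreal e) sequentially"
    using assms(2) by (intro order_tendstoD(2)[where y = 0]) auto
  then show ?thesis by (meson eventually_sequentially less_imp_le order_refl)
qed

text \<open>On a bounded interval square integrability implies integrability, by |g| \<le> 1 +
  |g|^2.\<close>

lemma integrable_truncation:
  assumes "square_integrable g" "R \<ge> 0"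
  shows "integrable lborel (\<lambda>x. if \<bar>x\<bar> \<le> R then g x else 0)"
proof (rule Bochner_Integration.integrable_bound)
  show "integrable lborel (\<lambda>x. indicator {-R..R} x + (cmod (g x))\<^sup>2 :: real)"
    using assms by (intro Bochner_Integration.integrable_add integrable_real_indicator) (simp_all add: square_integrable_iff)
  have "cmod (g x) \<le> 1 + (cmod (g x))\<^sup>2" for x
    using sum_squares_bound[of "cmod (g x)" 1] zero_le_power2[of "cmod (g x)"] norm_ge_zero[of "g x"] by (simp, linarith)
  then show "AE x in lborel. norm (if \<bar>x\<bar> \<le> R then g x else 0) \<le> norm (indicator {-R..R} x + (cmod (g x))\<^sup>2 :: real)"
    by (auto simp: indicator_def abs_le_iff)
qed (use assms in measurable)

lemma sqnorm_add_le:
  assumes [measurable]: "f \<in> borel_measurable borel" "g \<in> borel_measurable borel"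
    and "\<And>x. cmod (h x) \<le> cmod (f x) + cmod (g x)"
  shows "sqnorm h \<le> 2 * (sqnorm f + sqnorm g)"
proof -
  have "sqnorm h \<le> (\<integral>\<^sup>+x. 2 * (ennreal ((cmod (f x))\<^sup>2) + ennreal ((cmod (g x))\<^sup>2)) \<partial>lborel)"
    unfolding sqnorm_def
  proof (intro nn_integral_mono)
    fix x
    have "(cmod (h x))\<^sup>2 \<le> (cmod (f x) + cmod (g x))\<^sup>2" by (intro power_mono assms) auto
    also have "\<dots> \<le> 2 * ((cmod (f x))\<^sup>2 + (cmod (g x))\<^sup>2)"
      using sum_squares_bound[of "cmod (f x)" "cmod (g x)"] by (simp add: power2_sum)
    finally have "ennreal ((cmod (h x))\<^sup>2) \<le> ennreal (2 * ((cmod (f x))\<^sup>2 + (cmod (g x))\<^sup>2))" by (rule ennreal_leI)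
    then show "ennreal ((cmod (h x))\<^sup>2) \<le> 2 * (ennreal ((cmod (f x))\<^sup>2) + ennreal ((cmod (g x))\<^sup>2))"
      by (simp add: ennreal_mult)
  qed
  then show ?thesis by (simp add: nn_integral_cmult nn_integral_add sqnorm_def)
qed

text \<open>Completeness of L^2 for sequences with a geometric rate, where the whole sequence
  converges almost everywhere. Fatou's lemma transfers the bound B and the rate to the
  limit.\<close>

lemma L2_Cauchy_limit:
  fixes hs :: "nat \<Rightarrow> real \<Rightarrow> complex"
  assumes meas: "\<And>j. hs j \<in> borel_measurable borel"
    and bound: "\<And>j. sqnorm (hs j) \<le> B" and "B < \<infinity>"
    and cauchy: "\<And>i j. i \<ge> j \<Longrightarrow> sqnorm (\<lambda>x. hs j x - hs i x) \<le> ennreal (c * (1 / 8) ^ j)" and c: "c \<ge> 0"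
  shows "\<exists>h. square_integrable h \<and> sqnorm h \<le> B \<and> (\<forall>j. sqnorm (\<lambda>x. hs j x - h x) \<le> ennreal (c * (1 / 8) ^ j))"
proof -
  note [measurable] = meas
  define h where "h x = lim (\<lambda>j. hs j x)" for x
  have [measurable]: "h \<in> borel_measurable borel" unfolding h_def[abs_def] by measurable
  have conv: "AE x in lborel. (\<lambda>j. hs j x) \<longlonglongrightarrow> h x"
  proof -
    \<comment> \<open>The weight 4^j splits the rate 8^-j evenly: the integrals still sum like 2^-j,
      and finiteness of the sum at x bounds the increments there by a multiple of 2^-j, which makes
      them summable.\<close>
    let ?D = "\<lambda>j x. ennreal (4 ^ j) * ennreal ((cmod (hs j x - hs (Suc j) x))\<^sup>2)"
    have "(\<integral>\<^sup>+x. (\<Sum>j. ?D j x) \<partial>lborel) = (\<Sum>j. \<integral>\<^sup>+x. ?D j x \<partial>lborel)"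
      by (rule nn_integral_suminf) measurable
    also have "\<dots> \<le> (\<Sum>j. ennreal (c * (1 / 2) ^ j))"
    proof (intro suminf_le)
      fix j
      have "(\<integral>\<^sup>+x. ?D j x \<partial>lborel) = ennreal (4 ^ j) * sqnorm (\<lambda>x. hs j x - hs (Suc j) x)"
        by (simp add: nn_integral_cmult sqnorm_def)
      also have "\<dots> \<le> ennreal (4 ^ j) * ennreal (c * (1 / 8) ^ j)"
        by (intro mult_left_mono cauchy) auto
      also have "\<dots> = ennreal (c * (1 / 2) ^ j)"
        using c by (simp flip: ennreal_mult power_mult_distrib)
      finally show "(\<integral>\<^sup>+x. ?D j x \<partial>lborel) \<le> ennreal (c * (1 / 2) ^ j)" .
    qed auto
    also have "\<dots> < top"
      using c by (subst suminf_ennreal2) (auto intro!: summable_mult summable_geometric simp: ennreal_less_top)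
    finally have fin: "(\<integral>\<^sup>+x. (\<Sum>j. ?D j x) \<partial>lborel) < top" .
    have "AE x in lborel. (\<Sum>j. ?D j x) \<noteq> top"
      using fin by (intro nn_integral_noteq_infinite[unfolded infinity_ennreal_def]) auto
    then show ?thesis
    proof (rule AE_mp, intro AE_I2 impI)
      fix x assume fx: "(\<Sum>j. ?D j x) \<noteq> top"
      then obtain K where K: "(\<Sum>j. ?D j x) = ennreal K" "K \<ge> 0" by (cases "(\<Sum>j. ?D j x)") auto
      have le: "cmod (hs j x - hs (Suc j) x) \<le> sqrt K * (1 / 2) ^ j" for j
      proof -
        have "?D j x \<le> (\<Sum>j. ?D j x)" by (rule ennreal_suminf_lessD[THEN less_imp_le] sum_le_suminf[of _ "{j}", simplified]) auto
        then have "4 ^ j * (cmod (hs j x - hs (Suc j) x))\<^sup>2 \<le> K"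
          using K by (simp flip: ennreal_mult)
        then have "(2 ^ j * cmod (hs j x - hs (Suc j) x))\<^sup>2 \<le> K"
        proof -
          have "(4::real) ^ j = (2 ^ j)\<^sup>2" by (simp add: power2_eq_square flip: power_mult_distrib)
          then show ?thesis using \<open>4 ^ j * _ \<le> K\<close> by (simp add: power_mult_distrib)
        qed
        then have "2 ^ j * cmod (hs j x - hs (Suc j) x) \<le> sqrt K" by (rule real_le_rsqrt)
        then show ?thesis by (simp add: field_simps power_divide)
      qed
      have "summable (\<lambda>j. hs (Suc j) x - hs j x)"
      proof (rule summable_comparison_test')
        show "summable (\<lambda>j. sqrt K * (1 / 2) ^ j)" by (intro summable_mult summable_geometric) auto
        show "norm (hs (Suc j) x - hs j x) \<le> sqrt K * (1 / 2) ^ j" for j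
          using le[of j] by (simp add: norm_minus_commute)
      qed
      then have "convergent (\<lambda>n. \<Sum>j<n. hs (Suc j) x - hs j x)" by (simp add: summable_iff_convergent)
      then have "convergent (\<lambda>n. hs n x - hs 0 x)" by (simp add: sum_lessThan_telescope[of "\<lambda>j. hs j x"])
      then have "convergent (\<lambda>n. (hs n x - hs 0 x) + hs 0 x)" by (intro convergent_add convergent_const)
      then show "(\<lambda>j. hs j x) \<longlonglongrightarrow> h x" by (simp add: h_def convergent_LIMSEQ_iff)
    qed
  qed
  have "sqnorm h \<le> B"
    unfolding sqnorm_def
  proof (rule nn_integral_le_of_tendsto)
    show "AE x in lborel. (\<lambda>j. ennreal ((cmod (hs j x))\<^sup>2)) \<longlonglongrightarrow> ennreal ((cmod (h x))\<^sup>2)"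
      using conv by (rule AE_mp) (auto intro!: AE_I2 tendsto_ennrealI tendsto_intros)
    show "(\<integral>\<^sup>+x. ennreal ((cmod (hs j x))\<^sup>2) \<partial>lborel) \<le> B" for j
      using bound[of j] by (simp add: sqnorm_def)
  qed measurable
  moreover have "sqnorm (\<lambda>x. hs j x - h x) \<le> ennreal (c * (1 / 8) ^ j)" for j
    unfolding sqnorm_def
  proof (rule nn_integral_le_of_tendsto)
    show "AE x in lborel. (\<lambda>i. ennreal ((cmod (hs j x - hs i x))\<^sup>2)) \<longlonglongrightarrow> ennreal ((cmod (hs j x - h x))\<^sup>2)"
      using conv by (rule AE_mp) (auto intro!: AE_I2 tendsto_ennrealI tendsto_intros)
    show "(\<integral>\<^sup>+x. ennreal ((cmod (hs j x - hs i x))\<^sup>2) \<partial>lborel) \<le> ennreal (c * (1 / 8) ^ j)" if "i \<ge> j" for i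
      using cauchy[OF that] by (simp add: sqnorm_def)
  qed measurable
  ultimately show ?thesis
    using \<open>B < \<infinity>\<close> by (intro exI[of _ h]) (auto simp: square_integrable_def)
qed

text \<open>The Fourier transform of an L^2 function, characterized by the multiplication formula.
  Truncations with tails below 8^-j are integrable, Plancherel's inequality makes their transforms a
  Cauchy sequence, and both sides of the formula pass to the limit.\<close>

lemma L2_fourier_exists:
  assumes g: "square_integrable g"
  shows "\<exists>h. square_integrable h \<and> sqnorm h \<le> sqnorm g \<and>
    (\<forall>\<eta>\<in>schwartz. (\<integral>x. g x * fourier_fun \<eta> x \<partial>lborel) = (\<integral>x. h x * \<eta> x \<partial>lborel))"
proof -
  note [measurable] = square_integrable_measurable[OF g]
  have "\<forall>j. \<exists>R::nat. sqnorm (\<lambda>x. if \<bar>x\<bar> \<le> real R then 0 else g x) \<le> ennreal ((1 / 8) ^ j)"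
    by (intro allI sqnorm_tail g) simp
  then obtain R :: "nat \<Rightarrow> nat" where R: "\<And>j. sqnorm (\<lambda>x. if \<bar>x\<bar> \<le> real (R j) then 0 else g x) \<le> ennreal ((1 / 8) ^ j)"
    by metis
  define gs where "gs j x = (if \<bar>x\<bar> \<le> real (R j) then g x else 0)" for j x
  have gs_int: "integrable lborel (gs j)" for j unfolding gs_def[abs_def] by (rule integrable_truncation[OF g]) simp
  have [measurable]: "gs j \<in> borel_measurable borel" for j unfolding gs_def[abs_def] by measurable
  have gs_sq: "sqnorm (gs j) \<le> sqnorm g" for j
    using sqnorm_mono[of "gs j" 1 g] by (simp add: gs_def)
  have fin: "sqnorm g < \<infinity>" using g by (simp add: square_integrable_def)
  have gs_diff: "sqnorm (\<lambda>x. gs j x - g x) \<le> ennreal (4 * (1 / 8) ^ j)" for j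
  proof -
    have "sqnorm (\<lambda>x. gs j x - g x) = sqnorm (\<lambda>x. if \<bar>x\<bar> \<le> real (R j) then 0 else g x)"
      unfolding sqnorm_def gs_def by (intro nn_integral_cong) auto
    also have "\<dots> \<le> ennreal (1 * (1 / 8) ^ j)" using R by simp
    also have "\<dots> \<le> ennreal (4 * (1 / 8) ^ j)" by (intro ennreal_leI mult_right_mono) auto
    finally show ?thesis .
  qed
  define hs where "hs j = fourier_fun (gs j)" for j
  have hs_sq: "sqnorm (hs j) \<le> sqnorm g" for j
    using order_trans[OF Plancherel_le[OF gs_int, folded sqnorm_def] gs_sq] by (simp add: hs_def)
  \<comment> \<open>The constant is 4 = 2 (1 + 1): a factor 2 for the square of a sum, and one tail
    of size at most 8^-j for each of the two truncations.\<close>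
  have hs_cauchy: "sqnorm (\<lambda>x. hs j x - hs i x) \<le> ennreal (4 * (1 / 8) ^ j)" if "i \<ge> j" for i j
  proof -
    have "sqnorm (\<lambda>x. hs j x - hs i x) = sqnorm (fourier_fun (\<lambda>x. gs j x - gs i x))"
      using fourier_fun_linear[OF gs_int gs_int, of 1 j "-1" i] by (simp add: hs_def sqnorm_def)
    also have "\<dots> \<le> sqnorm (\<lambda>x. gs j x - gs i x)"
      using gs_int by (intro Plancherel_le[folded sqnorm_def]) simp
    also have "\<dots> \<le> 2 * (sqnorm (\<lambda>x. if \<bar>x\<bar> \<le> real (R j) then 0 else g x) + sqnorm (\<lambda>x. if \<bar>x\<bar> \<le> real (R i) then 0 else g x))"
      by (intro sqnorm_add_le) (auto simp: gs_def)
    also have "\<dots> \<le> 2 * (ennreal ((1 / 8) ^ j) + ennreal ((1 / 8) ^ j))"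
    proof (intro mult_left_mono add_mono R)
      have "sqnorm (\<lambda>x. if \<bar>x\<bar> \<le> real (R i) then 0 else g x) \<le> ennreal ((1 / 8) ^ i)" by (rule R)
      also have "\<dots> \<le> ennreal ((1 / 8) ^ j)" using that by (intro ennreal_leI power_decreasing) auto
      finally show "sqnorm (\<lambda>x. if \<bar>x\<bar> \<le> real (R i) then 0 else g x) \<le> ennreal ((1 / 8) ^ j)" .
    qed auto
    also have "\<dots> = ennreal (4 * (1 / 8) ^ j)"
      by (simp add: ennreal_mult flip: ennreal_plus)
    finally show ?thesis .
  qed
  have "\<exists>h. square_integrable h \<and> sqnorm h \<le> sqnorm g \<and> (\<forall>j. sqnorm (\<lambda>x. hs j x - h x) \<le> ennreal (4 * (1 / 8) ^ j))"
    by (rule L2_Cauchy_limit[OF _ hs_sq fin hs_cauchy]) (auto simp: hs_def)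
  then obtain h where h: "square_integrable h" "sqnorm h \<le> sqnorm g" "\<And>j. sqnorm (\<lambda>x. hs j x - h x) \<le> ennreal (4 * (1 / 8) ^ j)"
    by blast
  have "(\<integral>x. g x * fourier_fun \<eta> x \<partial>lborel) = (\<integral>x. h x * \<eta> x \<partial>lborel)" if \<eta>: "\<eta> \<in> schwartz" for \<eta>
  proof (rule LIMSEQ_unique)
    have sq: "square_integrable (gs j)" "square_integrable (hs j)" for j
      using order.strict_trans1[OF gs_sq fin] order.strict_trans1[OF hs_sq fin] by (auto simp: square_integrable_def hs_def)
    show "(\<lambda>j. \<integral>x. gs j x * fourier_fun \<eta> x \<partial>lborel) \<longlonglongrightarrow> (\<integral>x. g x * fourier_fun \<eta> x \<partial>lborel)"
      by (rule tendsto_integral_mult_of_sqnorm[OF g sq(1) schwartz_square_integrable[OF schwartz_fourier_fun[OF \<eta>]] gs_diff]) simp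
    have "(\<lambda>j. \<integral>x. hs j x * \<eta> x \<partial>lborel) \<longlonglongrightarrow> (\<integral>x. h x * \<eta> x \<partial>lborel)"
      by (rule tendsto_integral_mult_of_sqnorm[OF h(1) sq(2) schwartz_square_integrable[OF \<eta>] h(3)]) simp
    then show "(\<lambda>j. \<integral>x. gs j x * fourier_fun \<eta> x \<partial>lborel) \<longlonglongrightarrow> (\<integral>x. h x * \<eta> x \<partial>lborel)"
      unfolding hs_def integral_fourier_fun_mult[OF gs_int schwartz_integrable[OF \<eta>]] .
  qed
  with h show ?thesis by blast
qed

section \<open>Smooth partitions of the frequency line\<close>

text \<open>Uniform bounds and pointwise convergence to 0 for every derivative: what dominated
  convergence against a Schwartz function needs at each order of differentiation.\<close>

definition vanishing_multipliers :: "(nat \<Rightarrow> real \<Rightarrow> complex) \<Rightarrow> bool" where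
  "vanishing_multipliers a \<longleftrightarrow>
    (\<forall>l. (\<forall>N x. nth_deriv l (a N) differentiable (at x)) \<and>
         (\<exists>B. \<forall>N x. cmod (nth_deriv l (a N) x) \<le> B) \<and>
         (\<forall>x. (\<lambda>N. nth_deriv l (a N) x) \<longlonglongrightarrow> 0))"

lemma vanishing_multipliers_der: "vanishing_multipliers a \<Longrightarrow> vanishing_multipliers (\<lambda>N. der (a N))"
  unfolding vanishing_multipliers_def by (simp add: nth_deriv_Suc'[symmetric])

lemma vanishing_multipliers_tame_smooth: "vanishing_multipliers a \<Longrightarrow> a N \<in> tame_smooth"
  unfolding all_derivs_def tame_def
proof (safe, goal_cases)
  case (1 k x)
  then show ?case unfolding vanishing_multipliers_def by blast
next
  case (2 k)
  then obtain B where "\<And>x. cmod (nth_deriv k (a N) x) \<le> B" unfolding vanishing_multipliers_def by blast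
  then show ?case by (intro exI[of _ 0] exI[of _ B]) simp
qed

text \<open>Induction on the order with a and v generalized: one differentiation replaces the
  product by a v' + a' v, and both summands are of the same kind.\<close>

lemma integral_nth_deriv_vanishing:
  assumes "vanishing_multipliers a" "v \<in> schwartz"
  shows "(\<lambda>N. \<integral>x. cmod (nth_deriv l (\<lambda>x. a N x * v x) x) \<partial>lborel) \<longlonglongrightarrow> 0"
  using assms
proof (induction l arbitrary: a v)
  case 0
  then have "\<exists>B. \<forall>N x. cmod (nth_deriv 0 (a N) x) \<le> B" "\<forall>x. (\<lambda>N. nth_deriv 0 (a N) x) \<longlonglongrightarrow> 0"
    unfolding vanishing_multipliers_def by blast+
  then obtain B where B: "\<And>N x. cmod (a N x) \<le> B" and lim: "\<And>x. (\<lambda>N. a N x) \<longlonglongrightarrow> 0" by auto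
  have s: "(\<lambda>x. a N x * v x) \<in> schwartz" for N
    by (intro schwartz_mult vanishing_multipliers_tame_smooth 0)
  have "(\<lambda>N. \<integral>x. cmod (a N x * v x) \<partial>lborel) \<longlonglongrightarrow> (\<integral>x. 0 \<partial>(lborel :: real measure))"
  proof (rule integral_dominated_convergence[where w = "\<lambda>x. B * cmod (v x)"])
    show "integrable lborel (\<lambda>x. B * cmod (v x))" using schwartz_integrable[OF 0(2)] by simp
    show "(\<lambda>x. cmod (a N x * v x)) \<in> borel_measurable lborel" for N
      using schwartz_measurable[OF s] by measurable
    have "(\<lambda>N. cmod (a N x * v x)) \<longlonglongrightarrow> cmod (0 * v x)" for x by (intro tendsto_intros lim)
    then show "AE x in lborel. (\<lambda>N. cmod (a N x * v x)) \<longlonglongrightarrow> 0" by simp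
    show "AE x in lborel. norm (cmod (a N x * v x)) \<le> B * cmod (v x)" for N
      using B by (auto simp: norm_mult intro!: mult_right_mono)
  qed simp
  then show ?case by simp
next
  case (Suc l)
  have s: "(\<lambda>x. a N x * der v x) \<in> schwartz" "(\<lambda>x. der (a N) x * v x) \<in> schwartz" for N
    by (rule schwartz_mult[OF vanishing_multipliers_tame_smooth[OF Suc.prems(1)] schwartz_der[OF Suc.prems(2)]],
        rule schwartz_mult[OF all_derivs_der[OF vanishing_multipliers_tame_smooth[OF Suc.prems(1)]] Suc.prems(2)])
  have "der (\<lambda>x. a N x * v x) = (\<lambda>x. a N x * der v x + der (a N) x * v x)" for N
    using Suc.prems
    by (intro der_eqI has_vector_derivative_mult all_derivs_has_vector_derivative[OF vanishing_multipliers_tame_smooth]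
        schwartz_has_vector_derivative)
  then have nd: "nth_deriv (Suc l) (\<lambda>x. a N x * v x)
      = (\<lambda>x. nth_deriv l (\<lambda>x. a N x * der v x) x + nth_deriv l (\<lambda>x. der (a N) x * v x) x)" for N
    using nth_deriv_schwartz_linear[OF s(1)[of N] s(2)[of N], of l 1 1] by (simp add: nth_deriv_Suc')
  let ?I = "\<lambda>N. (\<integral>x. cmod (nth_deriv l (\<lambda>x. a N x * der v x) x) \<partial>lborel) + (\<integral>x. cmod (nth_deriv l (\<lambda>x. der (a N) x * v x) x) \<partial>lborel)"
  have "(\<integral>x. cmod (nth_deriv (Suc l) (\<lambda>x. a N x * v x) x) \<partial>lborel) \<le> ?I N" for N
  proof -
    note i = integrable_norm[OF schwartz_integrable[OF schwartz_nth_deriv[OF s(1)]]]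
      integrable_norm[OF schwartz_integrable[OF schwartz_nth_deriv[OF s(2)]]]
    have "(\<integral>x. cmod (nth_deriv (Suc l) (\<lambda>x. a N x * v x) x) \<partial>lborel)
        \<le> (\<integral>x. cmod (nth_deriv l (\<lambda>x. a N x * der v x) x) + cmod (nth_deriv l (\<lambda>x. der (a N) x * v x) x) \<partial>lborel)"
      unfolding nd by (rule integral_mono') (auto intro!: norm_triangle_ineq Bochner_Integration.integrable_add i)
    also have "\<dots> = ?I N" by (rule Bochner_Integration.integral_add[OF i])
    finally show ?thesis .
  qed
  moreover have "?I \<longlonglongrightarrow> 0 + 0"
    using Suc.prems by (intro tendsto_add Suc.IH vanishing_multipliers_der schwartz_der)
  ultimately show ?case
    by (rule_tac Lim_null_comparison[OF always_eventually, rotated]) auto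
qed

lemma schwartz_seminorm_nonneg:
  assumes "\<phi> \<in> schwartz"
  shows "schwartz_seminorm j k \<phi> \<ge> 0"
proof -
  have "bounded (range (\<lambda>x. x ^ j *\<^sub>R nth_deriv k \<phi> x))" using assms by (simp add: schwartz_def)
  then have "bdd_above (range (\<lambda>x. cmod (x ^ j *\<^sub>R nth_deriv k \<phi> x)))"
    by (auto simp: bounded_iff bdd_above_def)
  then show ?thesis
    unfolding schwartz_seminorm_def by (intro cSUP_upper2[where x = 0]) auto
qed

text \<open>The bound of u by finitely many seminorms meets L^1 bounds for the seminorms of a
  transform; each of these finitely many integrals tends to 0.\<close>

lemma tempered_fourier_vanishing:
  assumes u: "u \<in> tempered_distributions" and a: "vanishing_multipliers a" and v: "v \<in> schwartz"
  shows "(\<lambda>N. fourier u (\<lambda>x. a N x * v x)) \<longlonglongrightarrow> 0"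
proof -
  obtain C K where C: "\<And>\<phi>. \<phi> \<in> schwartz \<Longrightarrow> cmod (u \<phi>) \<le> C * (\<Sum>j\<le>K. \<Sum>k\<le>K. schwartz_seminorm j k \<phi>)"
    using u unfolding tempered_distributions_def by blast
  let ?I = "\<lambda>N j k. \<integral>x. cmod (nth_deriv j (\<lambda>x. a N x * ((- \<i> * complex_of_real x) ^ k * v x)) x) \<partial>lborel"
  have s: "(\<lambda>x. a N x * v x) \<in> schwartz" for N by (intro schwartz_mult vanishing_multipliers_tame_smooth a v)
  have "cmod (fourier u (\<lambda>x. a N x * v x)) \<le> \<bar>C\<bar> * (\<Sum>j\<le>K. \<Sum>k\<le>K. ?I N j k)" for N
  proof -
    have "cmod (fourier u (\<lambda>x. a N x * v x)) \<le> C * (\<Sum>j\<le>K. \<Sum>k\<le>K. schwartz_seminorm j k (fourier_fun (\<lambda>x. a N x * v x)))"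
      unfolding fourier_def by (intro C schwartz_fourier_fun s)
    also have "\<dots> \<le> \<bar>C\<bar> * (\<Sum>j\<le>K. \<Sum>k\<le>K. schwartz_seminorm j k (fourier_fun (\<lambda>x. a N x * v x)))"
      by (intro mult_right_mono sum_nonneg schwartz_seminorm_nonneg schwartz_fourier_fun s) auto
    also have "\<dots> \<le> \<bar>C\<bar> * (\<Sum>j\<le>K. \<Sum>k\<le>K. ?I N j k)"
      using schwartz_seminorm_fourier_le[OF s, of _ _ N]
      by (intro mult_left_mono sum_mono) (auto simp: mult.left_commute)
    finally show ?thesis .
  qed
  moreover have "(\<lambda>N. \<bar>C\<bar> * (\<Sum>j\<le>K. \<Sum>k\<le>K. ?I N j k)) \<longlonglongrightarrow> \<bar>C\<bar> * (\<Sum>j\<le>K. \<Sum>k\<le>K. 0)"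
    by (intro tendsto_mult tendsto_const tendsto_sum integral_nth_deriv_vanishing[OF a] schwartz_times_power v)
  ultimately show ?thesis
    by (rule_tac Lim_null_comparison[OF always_eventually, rotated]) auto
qed

lemma fourier_linear:
  assumes u: "u \<in> tempered_distributions" and "\<phi> \<in> schwartz" "\<eta> \<in> schwartz"
  shows "fourier u (\<lambda>x. a * \<phi> x + b * \<eta> x) = a * fourier u \<phi> + b * fourier u \<eta>"
proof -
  have "fourier_fun (\<lambda>x. a * \<phi> x + b * \<eta> x) = (\<lambda>\<xi>. a * fourier_fun \<phi> \<xi> + b * fourier_fun \<eta> \<xi>)"
    using fourier_fun_linear[OF assms(2,3)[THEN schwartz_integrable]] by blast
  then show ?thesis
    using u assms(2,3)[THEN schwartz_fourier_fun]
    unfolding fourier_def tempered_distributions_def linear_functional_on_def by simp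
qed

lemma fourier_sum:
  assumes u: "u \<in> tempered_distributions" and "finite K" "K \<noteq> {}" "\<And>k. k \<in> K \<Longrightarrow> \<phi> k \<in> schwartz"
  shows "fourier u (\<lambda>x. \<Sum>k\<in>K. \<phi> k x) = (\<Sum>k\<in>K. fourier u (\<phi> k))"
  using assms(2-)
proof (induction K rule: finite_ne_induct)
  case (insert k K)
  then show ?case
    using fourier_linear[OF u, of "\<phi> k" "\<lambda>x. \<Sum>k\<in>K. \<phi> k x" 1 1] schwartz_sum[of K \<phi>] by simp
qed simp

lemma nth_deriv_schwartz_translate:
  assumes "\<phi> \<in> schwartz"
  shows "nth_deriv l (\<lambda>x. \<phi> (x - b)) = (\<lambda>x. nth_deriv l \<phi> (x - b))"
proof (induction l)
  case (Suc l)
  have "((\<lambda>x. nth_deriv l \<phi> (x - b)) has_vector_derivative der (nth_deriv l \<phi>) (x - b)) (at x)" for x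
  proof -
    have "((\<lambda>x. x - b) has_vector_derivative 1) (at x)" by (auto intro!: derivative_eq_intros)
    from vector_diff_chain_at[OF this schwartz_has_vector_derivative[OF schwartz_nth_deriv[OF assms]]] show ?thesis
      by (simp add: o_def)
  qed
  then show ?case using der_eqI by (simp add: nth_deriv_Suc Suc)
qed simp

lemma nth_deriv_schwartz_sum:
  assumes "finite K" "K \<noteq> {}" "\<And>k. k \<in> K \<Longrightarrow> \<phi> k \<in> schwartz"
  shows "nth_deriv l (\<lambda>x. \<Sum>k\<in>K. \<phi> k x) = (\<lambda>x. \<Sum>k\<in>K. nth_deriv l (\<phi> k) x)"
  using assms
proof (induction K rule: finite_ne_induct)
  case (insert k K)
  then show ?case
    using nth_deriv_schwartz_linear[of "\<phi> k" "\<lambda>x. \<Sum>k\<in>K. \<phi> k x" l 1 1] schwartz_sum[of K \<phi>] by simp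
qed simp

lemma nth_deriv_const: "nth_deriv l (\<lambda>x. c) = (\<lambda>x. if l = 0 then c else 0)"
proof (induction l)
  case (Suc l)
  have "der (\<lambda>x. if l = 0 then c else 0) = (\<lambda>x. 0)" by (rule der_eqI) simp
  then show ?case by (simp add: nth_deriv_Suc Suc)
qed simp

text \<open>Counts the overlap at a point: 3 for translates of the window (r = 1) and 7 for the
  pieces cut off by the wider window (r = 3).\<close>

lemma card_integers_near: "finite {k::int. \<bar>x - of_int k\<bar> \<le> real r} \<and> card {k::int. \<bar>x - of_int k\<bar> \<le> real r} \<le> 2 * r + 1"
proof -
  have sub: "{k::int. \<bar>x - of_int k\<bar> \<le> real r} \<subseteq> {\<lceil>x\<rceil> - int r..\<lfloor>x\<rfloor> + int r}"
    by (auto simp: abs_le_iff) linarith+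
  have "card {k::int. \<bar>x - of_int k\<bar> \<le> real r} \<le> card {\<lceil>x\<rceil> - int r..\<lfloor>x\<rfloor> + int r}"
    by (intro card_mono sub) simp
  also have "\<dots> \<le> 2 * r + 1" by (simp, linarith)
  finally show ?thesis using finite_subset[OF sub] by simp
qed

section \<open>Translates of the window as a smooth partition of unity\<close>

context
  fixes \<psi> :: "real \<Rightarrow> complex"
  assumes window: "modulation_window \<psi>"
begin

lemma window_schwartz: "\<psi> \<in> schwartz"
  using window by (simp add: modulation_window_def)

lemma window_eq_0: "\<bar>x\<bar> > 1 \<Longrightarrow> \<psi> x = 0"
proof (rule ccontr)
  assume x: "\<bar>x\<bar> > 1" "\<psi> x \<noteq> 0"
  then have "x \<in> closure {\<xi>. \<psi> \<xi> \<noteq> 0}" using closure_subset[of "{\<xi>. \<psi> \<xi> \<noteq> 0}"] by auto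
  then have "x \<in> {-1..1}" using window unfolding modulation_window_def by blast
  then show False using x by auto
qed

lemma nth_deriv_window_eq_0:
  assumes "\<bar>x\<bar> > 1"
  shows "nth_deriv l \<psi> x = 0"
proof -
  have "nth_deriv l \<psi> x = nth_deriv l (\<lambda>x. 0) x"
  proof (rule nth_deriv_cong_open[of "{x. \<bar>x\<bar> > 1}"])
    show "open {x::real. \<bar>x\<bar> > 1}" by (intro open_Collect_less continuous_intros)
  qed (use window_eq_0 assms in auto)
  then show ?thesis by (simp add: nth_deriv_const)
qed

text \<open>By the support condition only finitely many terms of the infinite sum are nonzero at x,
  and F contains all of them.\<close>

lemma window_partial_sum:
  fixes F :: "int set"
  assumes "finite F" "\<And>k. \<bar>x - of_int k\<bar> \<le> 1 \<Longrightarrow> k \<in> F"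
  shows "(\<Sum>k\<in>F. \<psi> (x - of_int k)) = 1"
proof -
  have "((\<lambda>k. \<psi> (x - of_int k)) has_sum (\<Sum>k\<in>F. \<psi> (x - of_int k))) F"
    using assms(1) by (rule has_sum_finite)
  also have "?this \<longleftrightarrow> ((\<lambda>k. \<psi> (x - of_int k)) has_sum (\<Sum>k\<in>F. \<psi> (x - of_int k))) UNIV"
    using assms(2) window_eq_0 by (intro has_sum_cong_neutral) (auto, metis linorder_not_le)
  finally show ?thesis
    using window unfolding modulation_window_def by (blast intro: has_sum_unique)
qed

text \<open>At each point at most three translates contribute to a derivative, whence the uniform
  bounds. Near a fixed point the remainder is identically 0 for large N, so all its derivatives
  vanish there.\<close>

lemma window_remainder_vanishing:
  "vanishing_multipliers (\<lambda>N x. 1 - (\<Sum>k\<in>{- int N..int N}. \<psi> (x - of_int k)))"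
  (is "vanishing_multipliers ?a")
  unfolding vanishing_multipliers_def
proof (intro allI conjI)
  fix l
  have sc: "(\<lambda>x. \<psi> (x - of_int k)) \<in> schwartz" for k :: int by (rule schwartz_translate[OF window_schwartz])
  let ?P = "\<lambda>N x. \<Sum>k\<in>{- int N..int N}. \<psi> (x - of_int k)"
  have P: "?P N \<in> tame_smooth" for N by (intro schwartz_imp_tame_smooth schwartz_sum sc) auto
  have a: "?a N \<in> tame_smooth" and nd: "nth_deriv l (?a N)
      = (\<lambda>x. (if l = 0 then 1 else 0) - (\<Sum>k\<in>{- int N..int N}. nth_deriv l \<psi> (x - of_int k)))" for N
  proof -
    have "tame (\<lambda>x. 1 * g x + -1 * h x)" if "tame g" "tame h" for g h
      by (intro tame_add tame_mult tame_const that)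
    note lin = all_derivs_linear[OF tame_smooth_const[of 1] P this]
    show "?a N \<in> tame_smooth" using lin(1)[of N] by simp
    have "nth_deriv l (?P N) = (\<lambda>x. \<Sum>k\<in>{- int N..int N}. nth_deriv l \<psi> (x - of_int k))"
      using nth_deriv_schwartz_sum[of "{- int N..int N}" "\<lambda>k x. \<psi> (x - of_int k)" l] sc
        nth_deriv_schwartz_translate[OF window_schwartz] by simp
    then show "nth_deriv l (?a N) = (\<lambda>x. (if l = 0 then 1 else 0) - (\<Sum>k\<in>{- int N..int N}. nth_deriv l \<psi> (x - of_int k)))"
      using lin(2)[of l N] by (simp add: nth_deriv_const)
  qed
  show "nth_deriv l (?a N) differentiable (at x)" for N x
    using a[of N] unfolding all_derivs_def by blast
  show "\<exists>B. \<forall>N x. cmod (nth_deriv l (?a N) x) \<le> B"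
  proof -
    obtain B where B: "\<And>x. cmod (nth_deriv l \<psi> x) \<le> B"
      using schwartz_bounded[OF schwartz_nth_deriv[OF window_schwartz]] by blast
    have "B \<ge> 0" using B[of 0] norm_ge_zero order_trans by blast
    have "cmod (nth_deriv l (?a N) x) \<le> 1 + 3 * B" for N x
    proof -
      let ?near = "{k::int. \<bar>x - of_int k\<bar> \<le> real 1}"
      have "cmod (\<Sum>k\<in>{- int N..int N}. nth_deriv l \<psi> (x - of_int k)) \<le> (\<Sum>k\<in>{- int N..int N}. cmod (nth_deriv l \<psi> (x - of_int k)))"
        by (rule norm_sum)
      also have "\<dots> = (\<Sum>k\<in>{- int N..int N} \<inter> ?near. cmod (nth_deriv l \<psi> (x - of_int k)))"
        by (rule sum.mono_neutral_right) (auto, metis nth_deriv_window_eq_0 linorder_not_le)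
      also have "\<dots> \<le> (\<Sum>k\<in>{- int N..int N} \<inter> ?near. B)" by (intro sum_mono B)
      also have "\<dots> = real (card ({- int N..int N} \<inter> ?near)) * B" by simp
      also have "\<dots> \<le> 3 * B"
      proof (intro mult_right_mono \<open>B \<ge> 0\<close>)
        have "card ({- int N..int N} \<inter> ?near) \<le> card ?near"
          using card_integers_near[of x 1] by (intro card_mono) auto
        also have "\<dots> \<le> 3" using card_integers_near[of x 1] by simp
        finally show "real (card ({- int N..int N} \<inter> ?near)) \<le> 3" by simp
      qed
      finally have "cmod (\<Sum>k\<in>{- int N..int N}. nth_deriv l \<psi> (x - of_int k)) \<le> 3 * B" .
      moreover have "cmod (if l = 0 then 1 else 0) \<le> 1" by simp
      ultimately show ?thesis
        unfolding nd using norm_triangle_ineq4 by (smt (verit))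
    qed
    then show ?thesis by blast
  qed
  show "(\<lambda>N. nth_deriv l (?a N) x) \<longlonglongrightarrow> 0" for x
  \<comment> \<open>The margin 2 consists of 1 for the neighbourhood of x on which the remainder has
    to vanish and 1 for the radius of the support of \<psi>.\<close>
  proof (rule tendsto_eventually, rule eventually_sequentiallyI[of "nat \<lceil>\<bar>x\<bar>\<rceil> + 2"])
    fix N assume N: "N \<ge> nat \<lceil>\<bar>x\<bar>\<rceil> + 2"
    have "nth_deriv l (?a N) x = nth_deriv l (\<lambda>x. 0) x"
    proof (rule nth_deriv_cong_open[of "{x-1<..<x+1}"])
      fix y assume y: "y \<in> {x-1<..<x+1}"
      have "(\<Sum>k\<in>{- int N..int N}. \<psi> (y - of_int k)) = 1"
      proof (rule window_partial_sum)
        fix k :: int assume "\<bar>y - of_int k\<bar> \<le> 1"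
        then have "\<bar>of_int k :: real\<bar> \<le> real N" using y N by (simp add: abs_if split: if_splits) linarith+
        then show "k \<in> {- int N..int N}" by auto
      qed simp
      then show "1 - (\<Sum>k\<in>{- int N..int N}. \<psi> (y - of_int k)) = 0" by simp
    qed auto
    then show "nth_deriv l (?a N) x = 0" by (simp add: nth_deriv_const)
  qed
qed

text \<open>A tempered distribution is the limit of its frequency pieces: its value on the remainder
  times v tends to 0.\<close>

lemma fourier_window_decomposition:
  assumes u: "u \<in> tempered_distributions" and v: "v \<in> schwartz"
  shows "(\<lambda>N. \<Sum>k\<in>{- int N..int N}. fourier u (\<lambda>x. \<psi> (x - of_int k) * v x)) \<longlonglongrightarrow> fourier u v"
proof -
  have sc: "(\<lambda>x. \<psi> (x - of_int k) * v x) \<in> schwartz" for k :: int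
    by (intro schwartz_mult schwartz_imp_tame_smooth schwartz_translate window_schwartz v)
  have "fourier u (\<lambda>x. (1 - (\<Sum>k\<in>{- int N..int N}. \<psi> (x - of_int k))) * v x)
      = fourier u v - (\<Sum>k\<in>{- int N..int N}. fourier u (\<lambda>x. \<psi> (x - of_int k) * v x))" for N
  proof -
    have "fourier u (\<lambda>x. 1 * v x + (-1) * (\<Sum>k\<in>{- int N..int N}. \<psi> (x - of_int k) * v x))
       = 1 * fourier u v + (-1) * fourier u (\<lambda>x. \<Sum>k\<in>{- int N..int N}. \<psi> (x - of_int k) * v x)"
      by (intro fourier_linear u v schwartz_sum sc) auto
    moreover have "fourier u (\<lambda>x. \<Sum>k\<in>{- int N..int N}. \<psi> (x - of_int k) * v x)
        = (\<Sum>k\<in>{- int N..int N}. fourier u (\<lambda>x. \<psi> (x - of_int k) * v x))"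
      by (rule fourier_sum[OF u]) (auto intro: sc)
    ultimately show ?thesis
      by (simp add: left_diff_distrib sum_distrib_right)
  qed
  with tempered_fourier_vanishing[OF u window_remainder_vanishing v]
  have "(\<lambda>N. fourier u v - (\<Sum>k\<in>{- int N..int N}. fourier u (\<lambda>x. \<psi> (x - of_int k) * v x))) \<longlonglongrightarrow> 0" by simp
  from tendsto_diff[OF tendsto_const[of "fourier u v"] this] show ?thesis by simp
qed

end

section \<open>Local pieces and almost orthogonal sums\<close>

abbreviation frequency_piece :: "(real \<Rightarrow> complex) \<Rightarrow> int \<Rightarrow> functional \<Rightarrow> functional" where
  "frequency_piece \<psi> k u \<equiv> fourier_multiplier (\<lambda>\<xi>. \<psi> (\<xi> - of_int k)) u"

abbreviation weighted_fourier :: "real \<Rightarrow> int \<Rightarrow> functional \<Rightarrow> functional" where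
  "weighted_fourier \<theta> n u \<equiv> mult_distr (\<lambda>\<xi>. of_real (jbracket (\<xi> - of_int n) powr \<theta>)) (fourier u)"

definition represents :: "functional \<Rightarrow> (real \<Rightarrow> complex) \<Rightarrow> bool" where
  "represents u g \<longleftrightarrow> square_integrable g \<and> (\<forall>\<phi>\<in>schwartz. u \<phi> = (\<integral>x. g x * \<phi> x \<partial>lborel))"

lemma L2_norm_fun_power2: "(L2_norm_fun g)\<^sup>2 = sqnorm g"
  by (simp add: L2_norm_fun_def sqnorm_def ennpowr_eq_epowr epowr_epowr flip: epowr_2)

lemma L2_norm_fun_eq: "L2_norm_fun g = epowr (sqnorm g) (1 / 2)"
  by (simp add: L2_norm_fun_def sqnorm_def ennpowr_eq_epowr)

lemma L2_norm_eq: "L2_norm u = (INF g\<in>{g. represents u g}. L2_norm_fun g)"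
proof -
  have "L2_norm_fun g < \<infinity> \<longleftrightarrow> sqnorm g < \<infinity>" for g
    unfolding L2_norm_fun_power2[symmetric] by (simp add: power_less_top_ennreal)
  then show ?thesis
    unfolding L2_norm_def represents_def square_integrable_def by (simp add: conj_assoc)
qed

lemma L2_norm_lower: "represents u g \<Longrightarrow> L2_norm u \<le> L2_norm_fun g"
  unfolding L2_norm_eq by (rule INF_lower) simp

lemma L2_norm_power2_lower: "represents u g \<Longrightarrow> (L2_norm u)\<^sup>2 \<le> sqnorm g"
  using power_mono[OF L2_norm_lower, of u g 2] by (simp add: L2_norm_fun_power2)

text \<open>Moves a positive factor through the infimum. If u has no representative, both sides of
  the conclusion are compared at \<open>top\<close>.\<close>

lemma L2_norm_greatest_cmult:
  assumes "C > 0" "\<And>g. represents u g \<Longrightarrow> x \<le> ennreal C * L2_norm_fun g"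
  shows "x \<le> ennreal C * L2_norm u"
proof -
  have inv: "ennreal (1 / C) * (ennreal C * y) = y" "ennreal C * (ennreal (1 / C) * y) = y" for y
    using assms(1) by (simp_all add: mult.assoc[symmetric] flip: ennreal_mult)
  have "ennreal (1 / C) * x \<le> L2_norm u"
    unfolding L2_norm_eq
  proof (rule INF_greatest)
    fix g assume "g \<in> {g. represents u g}"
    then have "ennreal (1 / C) * x \<le> ennreal (1 / C) * (ennreal C * L2_norm_fun g)"
      using assms(2) by (intro mult_left_mono) auto
    then show "ennreal (1 / C) * x \<le> L2_norm_fun g" by (simp add: inv)
  qed
  then have "ennreal C * (ennreal (1 / C) * x) \<le> ennreal C * L2_norm u" by (intro mult_left_mono) auto
  then show ?thesis by (simp add: inv)
qed

text \<open>The error is added to the square of the norm, because the later sums run over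
  squares.\<close>

lemma L2_norm_approx:
  assumes "L2_norm u < \<infinity>" "e > 0"
  shows "\<exists>g. represents u g \<and> sqnorm g \<le> (L2_norm u)\<^sup>2 + ennreal e"
proof -
  let ?y = "epowr ((L2_norm u)\<^sup>2 + ennreal e) (1 / 2)"
  have ysq: "?y\<^sup>2 = (L2_norm u)\<^sup>2 + ennreal e" by (simp add: epowr_epowr flip: epowr_2)
  have "L2_norm u < ?y"
  proof (rule ccontr)
    assume "\<not> L2_norm u < ?y"
    then have "?y\<^sup>2 \<le> (L2_norm u)\<^sup>2" by (intro power_mono) auto
    note this[unfolded ysq]
    moreover have "(L2_norm u)\<^sup>2 < top" using assms(1) by (simp add: power_less_top_ennreal)
    ultimately show False
      using assms(2) by (cases "(L2_norm u)\<^sup>2") (auto simp: ennreal_le_iff simp flip: ennreal_plus)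
  qed
  then obtain g where g: "represents u g" "L2_norm_fun g < ?y"
    unfolding L2_norm_eq by (subst (asm) INF_less_iff) auto
  then have "(L2_norm_fun g)\<^sup>2 \<le> ?y\<^sup>2" by (intro power_mono) auto
  then have "sqnorm g \<le> (L2_norm u)\<^sup>2 + ennreal e" by (simp only: L2_norm_fun_power2 ysq)
  with g show ?thesis by blast
qed

lemma fourier_fun_reflect: "fourier_fun (\<lambda>x. \<phi> (- x)) \<xi> = fourier_fun \<phi> (- \<xi>)"
proof -
  have "(\<integral>x. \<phi> (- x) * osc x \<xi> \<partial>lborel) = (\<integral>x. \<phi> x * osc x (- \<xi>) \<partial>lborel)"
    using lborel_integral_real_affine[of "-1" "\<lambda>x. \<phi> x * osc x (- \<xi>)" 0] by (simp add: osc_minus)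
  then show ?thesis by (simp add: fourier_fun_osc)
qed

lemma sqnorm_reflect:
  assumes [measurable]: "g \<in> borel_measurable borel"
  shows "sqnorm (\<lambda>x. g (- x)) = sqnorm g"
  unfolding sqnorm_def using nn_integral_real_affine[of "\<lambda>x. ennreal ((cmod (g x))\<^sup>2)" "-1" 0] by simp

lemma integral_inv_fourier_fun_mult:
  assumes h: "integrable lborel h" and \<phi>: "\<phi> \<in> schwartz"
  shows "(\<integral>\<xi>. h \<xi> * inv_fourier_fun \<phi> \<xi> \<partial>lborel) = (\<integral>x. fourier_fun h (- x) * \<phi> x \<partial>lborel)"
proof -
  have "(\<integral>\<xi>. h \<xi> * inv_fourier_fun \<phi> \<xi> \<partial>lborel) = (\<integral>\<xi>. h \<xi> * fourier_fun (\<lambda>x. \<phi> (- x)) \<xi> \<partial>lborel)"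
    by (simp add: inv_fourier_fun_eq fourier_fun_reflect)
  also have "\<dots> = (\<integral>x. fourier_fun h x * \<phi> (- x) \<partial>lborel)"
    by (rule integral_fourier_fun_mult[symmetric, OF h schwartz_integrable[OF schwartz_reflect[OF \<phi>]]])
  also have "\<dots> = (\<integral>x. fourier_fun h (- x) * \<phi> x \<partial>lborel)"
    using lborel_integral_real_affine[of "-1" "\<lambda>x. fourier_fun h x * \<phi> (- x)" 0] by simp
  finally show ?thesis .
qed

lemma fourier_multiplier_apply:
  "fourier_multiplier m u \<phi> = fourier u (\<lambda>\<xi>. m \<xi> * inv_fourier_fun \<phi> \<xi>)"
  by (simp add: fourier_multiplier_def inv_fourier_def mult_distr_def)

lemma square_integrable_mult_bounded:
  assumes "square_integrable g" "m \<in> borel_measurable borel" "\<And>x. cmod (m x) \<le> C"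
  shows "square_integrable (\<lambda>x. g x * m x)" "sqnorm (\<lambda>x. g x * m x) \<le> ennreal (C\<^sup>2) * sqnorm g"
proof -
  note [measurable] = assms(2) square_integrable_measurable[OF assms(1)]
  have "C \<ge> 0" using assms(3)[of 0] norm_ge_zero order_trans by blast
  then show le: "sqnorm (\<lambda>x. g x * m x) \<le> ennreal (C\<^sup>2) * sqnorm g"
    using assms(3) by (intro sqnorm_mono) (auto simp: norm_mult mult.commute[of C] intro!: mult_left_mono)
  have "ennreal (C\<^sup>2) * sqnorm g < \<infinity>" using assms(1) by (simp add: square_integrable_def ennreal_mult_less_top)
  then show "square_integrable (\<lambda>x. g x * m x)"
    using le by (simp add: square_integrable_def)
qed

section \<open>Plancherel estimates for single frequency pieces\<close>

context
  fixes \<psi> :: "real \<Rightarrow> complex"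
  assumes window: "modulation_window \<psi>"
begin

lemma window_shift_schwartz: "(\<lambda>x. \<psi> (x - b)) \<in> schwartz"
  by (rule schwartz_translate[OF window_schwartz[OF window]])

text \<open>The shifted window is the weight <\<xi> - n>^\<theta> times a translate of the Schwartz
  function m, whose bound is independent of n. A representative g of the weighted transform becomes
  the integrable function h, so Plancherel's inequality applies to its inverse transform H.\<close>

lemma L2_norm_window_le:
  "\<exists>C>0. \<forall>u\<in>tempered_distributions. \<forall>n::int.
    L2_norm (frequency_piece \<psi> n u)
    \<le> ennreal C * L2_norm (weighted_fourier \<theta> n u)"
proof -
  define m where "m \<xi> = \<psi> \<xi> * complex_of_real (jbracket \<xi> powr (- \<theta>))" for \<xi>
  have m: "m \<in> schwartz"
    using schwartz_mult[OF tame_smooth_jbracket[of 0 "- \<theta>"] window_schwartz[OF window]]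
    by (simp add: m_def[abs_def] mult.commute)
  obtain C0 where C0: "\<And>x. cmod (m x) \<le> C0" using schwartz_bounded[OF m] by blast
  define C where "C = max 1 C0"
  have C: "C > 0" "\<And>x. cmod (m x) \<le> C" using C0 by (auto simp: C_def intro: max.coboundedI2)
  have "L2_norm (frequency_piece \<psi> n u)
      \<le> ennreal C * L2_norm_fun g"
    if g: "represents (weighted_fourier \<theta> n u) g" for u g and n :: int
  proof -
    define mn where "mn \<xi> = m (\<xi> - of_int n)" for \<xi>
    have mn: "mn \<in> schwartz" unfolding mn_def[abs_def] by (rule schwartz_translate[OF m])
    have gsq: "square_integrable g" using g by (simp add: represents_def)
    note [measurable] = schwartz_measurable[OF mn] square_integrable_measurable[OF gsq]
    define h where "h \<xi> = g \<xi> * mn \<xi>" for \<xi>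
    have hi: "integrable lborel h"
      unfolding h_def[abs_def] by (rule square_integrable_mult[OF gsq schwartz_square_integrable[OF mn]])
    have hsq: "sqnorm h \<le> ennreal (C\<^sup>2) * sqnorm g"
      unfolding h_def[abs_def]
      by (rule square_integrable_mult_bounded(2)[OF gsq schwartz_measurable[OF mn]]) (simp add: mn_def C)
    have [measurable]: "h \<in> borel_measurable borel" unfolding h_def[abs_def] by measurable
    define H where "H x = fourier_fun h (- x)" for x
    have Hsq: "sqnorm H \<le> ennreal (C\<^sup>2) * sqnorm g"
      unfolding H_def[abs_def] using sqnorm_reflect[of "fourier_fun h"] Plancherel_le[OF hi, folded sqnorm_def] hsq
      by simp
    have "frequency_piece \<psi> n u \<phi> = (\<integral>x. H x * \<phi> x \<partial>lborel)" if \<phi>: "\<phi> \<in> schwartz" for \<phi>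
    proof -
      have s: "(\<lambda>\<xi>. mn \<xi> * inv_fourier_fun \<phi> \<xi>) \<in> schwartz"
        by (intro schwartz_mult schwartz_imp_tame_smooth mn schwartz_inv_fourier_fun \<phi>)
      have eq: "complex_of_real (jbracket (\<xi> - of_int n) powr \<theta>) * (mn \<xi> * inv_fourier_fun \<phi> \<xi>)
          = \<psi> (\<xi> - of_int n) * inv_fourier_fun \<phi> \<xi>" for \<xi>
      proof -
        have "jbracket (\<xi> - of_int n) powr \<theta> * jbracket (\<xi> - of_int n) powr (- \<theta>) = 1"
          using jbracket_pos[of "\<xi> - of_int n"] by (simp add: powr_minus)
        then have "complex_of_real (jbracket (\<xi> - of_int n) powr \<theta>) * complex_of_real (jbracket (\<xi> - of_int n) powr (- \<theta>)) = 1"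
          by (metis of_real_1 of_real_mult)
        then show ?thesis by (simp add: mn_def m_def mult_ac)
      qed
      have "frequency_piece \<psi> n u \<phi>
          = weighted_fourier \<theta> n u (\<lambda>\<xi>. mn \<xi> * inv_fourier_fun \<phi> \<xi>)"
        by (simp add: fourier_multiplier_apply mult_distr_def eq)
      also have "\<dots> = (\<integral>\<xi>. g \<xi> * (mn \<xi> * inv_fourier_fun \<phi> \<xi>) \<partial>lborel)"
        using g s by (simp add: represents_def)
      also have "\<dots> = (\<integral>\<xi>. h \<xi> * inv_fourier_fun \<phi> \<xi> \<partial>lborel)" by (simp add: h_def mult.assoc)
      also have "\<dots> = (\<integral>x. H x * \<phi> x \<partial>lborel)"
        unfolding H_def by (rule integral_inv_fourier_fun_mult[OF hi \<phi>])
      finally show ?thesis .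
    qed
    moreover have "square_integrable H"
    proof -
      have "ennreal (C\<^sup>2) * sqnorm g < \<infinity>" using gsq by (simp add: square_integrable_def ennreal_mult_less_top)
      moreover have "H \<in> borel_measurable borel" unfolding H_def[abs_def] by measurable
      ultimately show ?thesis using Hsq by (auto simp: square_integrable_def)
    qed
    ultimately have "represents (frequency_piece \<psi> n u) H" by (simp add: represents_def)
    then have "L2_norm (frequency_piece \<psi> n u) \<le> epowr (sqnorm H) (1 / 2)"
      using L2_norm_lower by (simp add: L2_norm_fun_eq)
    also have "\<dots> \<le> epowr (ennreal (C\<^sup>2) * sqnorm g) (1 / 2)" by (intro epowr_mono Hsq) auto
    also have "\<dots> = ennreal C * L2_norm_fun g"
      using C by (simp add: epowr_mult L2_norm_fun_eq epowr_ennreal powr_half_sqrt)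
    finally show ?thesis .
  qed
  then show ?thesis
    using C(1) by (intro exI[of _ C]) (auto intro!: L2_norm_greatest_cmult)
qed

text \<open>Returns from a representative g of the piece to one of its Fourier transform, the L^2
  transform of g. Multiplication by \<rho> then confines its support, which the following
  orthogonality argument relies on.\<close>

lemma L2_window_piece:
  "\<exists>C>0. \<forall>u\<in>tempered_distributions. \<forall>(k::int) g.
    represents (frequency_piece \<psi> k u) g \<longrightarrow>
    (\<exists>h. square_integrable h \<and> sqnorm h \<le> ennreal C * sqnorm g \<and> (\<forall>x. \<bar>x - of_int k\<bar> > 3 \<longrightarrow> h x = 0) \<and>
      (\<forall>\<eta>\<in>schwartz. fourier u (\<lambda>x. \<psi> (x - of_int k) * \<eta> x) = (\<integral>x. h x * \<eta> x \<partial>lborel)))"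
proof -
  \<comment> \<open>A point of [-1, 1] lies within 1 only of integers of modulus at most 2, so these
    five translates already sum to 1 there; their sum vanishes outside [-3, 3].\<close>
  define \<rho> where "\<rho> x = (\<Sum>j\<in>{-2..2}. \<psi> (x - of_int j))" for x
  have \<rho>: "\<rho> \<in> schwartz"
    unfolding \<rho>_def[abs_def] by (intro schwartz_sum window_shift_schwartz) auto
  have \<rho>_0: "\<rho> x = 0" if "\<bar>x\<bar> > 3" for x
    unfolding \<rho>_def using that by (intro sum.neutral ballI window_eq_0[OF window]) auto
  have \<rho>_1: "\<psi> x * \<rho> x = \<psi> x" for x
  proof (cases "\<bar>x\<bar> > 1")
    case False
    have "\<rho> x = 1"
      unfolding \<rho>_def
    proof (rule window_partial_sum[OF window])
      fix k :: int assume "\<bar>x - of_int k\<bar> \<le> 1"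
      then have "\<bar>of_int k :: real\<bar> \<le> 2" using False by linarith
      then show "k \<in> {-2..2}" by auto
    qed simp
    then show ?thesis by simp
  qed (simp add: window_eq_0[OF window])
  obtain C0 where C0: "\<And>x. cmod (\<rho> x) \<le> C0" using schwartz_bounded[OF \<rho>] by blast
  define B where "B = max 1 C0"
  have B: "B > 0" "\<And>x. cmod (\<rho> x) \<le> B" using C0 by (auto simp: B_def intro: max.coboundedI2)
  have "\<exists>h. square_integrable h \<and> sqnorm h \<le> ennreal (B\<^sup>2) * sqnorm g \<and> (\<forall>x. \<bar>x - of_int k\<bar> > 3 \<longrightarrow> h x = 0) \<and>
      (\<forall>\<eta>\<in>schwartz. fourier u (\<lambda>x. \<psi> (x - of_int k) * \<eta> x) = (\<integral>x. h x * \<eta> x \<partial>lborel))"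
    if g: "represents (frequency_piece \<psi> k u) g" for u g and k :: int
  proof -
    have "square_integrable g" using g by (simp add: represents_def)
    from L2_fourier_exists[OF this] obtain h where h: "square_integrable h" "sqnorm h \<le> sqnorm g"
      "\<And>\<eta>. \<eta> \<in> schwartz \<Longrightarrow> (\<integral>x. g x * fourier_fun \<eta> x \<partial>lborel) = (\<integral>x. h x * \<eta> x \<partial>lborel)" by blast
    define \<rho>k where "\<rho>k x = \<rho> (x - of_int k)" for x
    have \<rho>k: "\<rho>k \<in> schwartz" unfolding \<rho>k_def[abs_def] by (rule schwartz_translate[OF \<rho>])
    have m: "square_integrable (\<lambda>x. h x * \<rho>k x)" "sqnorm (\<lambda>x. h x * \<rho>k x) \<le> ennreal (B\<^sup>2) * sqnorm h"
      using square_integrable_mult_bounded[OF h(1) schwartz_measurable[OF \<rho>k], of B] B by (auto simp: \<rho>k_def)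
    have U: "fourier u (\<lambda>x. \<psi> (x - of_int k) * \<eta> x) = (\<integral>x. h x * \<eta> x \<partial>lborel)" if \<eta>: "\<eta> \<in> schwartz" for \<eta>
    proof -
      \<comment> \<open>By Fourier inversion, testing the piece against the transform of \<eta> is
        the same as testing the localized Fourier transform of u against \<eta>.\<close>
      have "fourier u (\<lambda>x. \<psi> (x - of_int k) * \<eta> x) = frequency_piece \<psi> k u (fourier_fun \<eta>)"
        by (simp add: fourier_multiplier_apply fourier_inversion_schwartz[OF \<eta>])
      also have "\<dots> = (\<integral>x. g x * fourier_fun \<eta> x \<partial>lborel)"
        using g schwartz_fourier_fun[OF \<eta>] by (simp add: represents_def)
      finally show ?thesis using h(3)[OF \<eta>] by simp
    qed
    have "fourier u (\<lambda>x. \<psi> (x - of_int k) * \<eta> x) = (\<integral>x. (h x * \<rho>k x) * \<eta> x \<partial>lborel)" if \<eta>: "\<eta> \<in> schwartz" for \<eta>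
    proof -
      have "(\<lambda>x. \<psi> (x - of_int k) * \<eta> x) = (\<lambda>x. \<psi> (x - of_int k) * (\<rho>k x * \<eta> x))"
        using \<rho>_1 by (auto simp: \<rho>k_def mult.assoc[symmetric])
      then show ?thesis
        using U[OF schwartz_mult[OF schwartz_imp_tame_smooth[OF \<rho>k] \<eta>]] by (simp add: mult.assoc)
    qed
    moreover have "sqnorm (\<lambda>x. h x * \<rho>k x) \<le> ennreal (B\<^sup>2) * sqnorm g"
      using m(2) h(2) by (meson mult_left_mono order_trans zero_le)
    moreover have "h x * \<rho>k x = 0" if "\<bar>x - of_int k\<bar> > 3" for x using \<rho>_0[OF that] by (simp add: \<rho>k_def)
    ultimately show ?thesis using m(1) by (intro exI[of _ "\<lambda>x. h x * \<rho>k x"]) blast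
  qed
  then show ?thesis using B(1) by (intro exI[of _ "B\<^sup>2"]) auto
qed

end

section \<open>Sums of pieces with bounded overlap\<close>

lemma sum_le_nn_integral_count_space:
  fixes f :: "'a \<Rightarrow> ennreal"
  assumes "finite F"
  shows "(\<Sum>k\<in>F. f k) \<le> (\<Sum>\<^sup>+k. f k)"
proof -
  have "(\<Sum>k\<in>F. f k) = (\<Sum>k\<in>F. f k * indicator F k)" by (intro sum.cong) auto
  also have "\<dots> = (\<Sum>\<^sup>+k. f k * indicator F k)"
    using assms by (intro nn_integral_count_space'[symmetric]) auto
  also have "\<dots> \<le> (\<Sum>\<^sup>+k. f k)" by (intro nn_integral_mono) (auto simp: indicator_def)
  finally show ?thesis .
qed

text \<open>At most 7 terms are nonzero at each point. Hence the partial sums are eventually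
  constant pointwise, Cauchy-Schwarz costs a factor 7, and Fatou's lemma carries the bound to the
  limit.\<close>

lemma almost_orthogonal_limit:
  fixes hs :: "int \<Rightarrow> real \<Rightarrow> complex"
  assumes meas: "\<And>k. hs k \<in> borel_measurable borel"
    and supp: "\<And>k x. \<bar>x - of_int k\<bar> > 3 \<Longrightarrow> hs k x = 0"
    and fin: "(\<Sum>\<^sup>+k. sqnorm (hs k)) < \<infinity>"
  shows "\<exists>G. square_integrable G \<and> sqnorm G \<le> 7 * (\<Sum>\<^sup>+k. sqnorm (hs k)) \<and>
    (\<forall>x. (\<lambda>N. \<Sum>k\<in>{- int N..int N}. hs k x) \<longlonglongrightarrow> G x)"
proof -
  note [measurable] = meas
  let ?S = "\<lambda>N x. \<Sum>k\<in>{- int N..int N}. hs k x"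
  define G where "G x = lim (\<lambda>N. ?S N x)" for x
  have [measurable]: "G \<in> borel_measurable borel" unfolding G_def[abs_def] by measurable
  have lim: "(\<lambda>N. ?S N x) \<longlonglongrightarrow> G x" for x
  proof -
    \<comment> \<open>The margin 3 is the radius of the supports: an integer of modulus above
      \<open>N0\<close> has distance more than 3 from x.\<close>
    define N0 where "N0 = nat \<lceil>\<bar>x\<bar>\<rceil> + 3"
    have "?S N x = ?S N0 x" if "N \<ge> N0" for N
    proof (rule sum.mono_neutral_right)
      show "\<forall>k\<in>{- int N..int N} - {- int N0..int N0}. hs k x = 0"
      proof
        fix k assume "k \<in> {- int N..int N} - {- int N0..int N0}"
        then have "\<bar>k\<bar> > int N0" by auto
        then have "\<bar>of_int k :: real\<bar> > real N0" by linarith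
        then have "\<bar>x - of_int k\<bar> > 3" unfolding N0_def by linarith
        then show "hs k x = 0" by (rule supp)
      qed
    qed (use that in auto)
    then have "(\<lambda>N. ?S N x) \<longlonglongrightarrow> ?S N0 x"
      by (intro tendsto_eventually eventually_sequentiallyI[of N0])
    then show ?thesis unfolding G_def by (simp add: limI)
  qed
  have "sqnorm (?S N) \<le> 7 * (\<Sum>\<^sup>+k. sqnorm (hs k))" for N
  proof -
    have "sqnorm (?S N) \<le> (\<integral>\<^sup>+x. 7 * (\<Sum>k\<in>{- int N..int N}. ennreal ((cmod (hs k x))\<^sup>2)) \<partial>lborel)"
      unfolding sqnorm_def
    proof (intro nn_integral_mono)
      fix x
      let ?near = "{k::int. \<bar>x - of_int k\<bar> \<le> real 3}"
      let ?F = "{- int N..int N} \<inter> ?near"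
      have "?S N x = (\<Sum>k\<in>?F. hs k x)"
        by (rule sum.mono_neutral_right) (auto simp: not_le intro: supp)
      then have "(cmod (?S N x))\<^sup>2 \<le> (\<Sum>k\<in>?F. cmod (hs k x))\<^sup>2"
        by (simp add: norm_sum power_mono)
      also have "\<dots> \<le> real (card ?F) * (\<Sum>k\<in>?F. (cmod (hs k x))\<^sup>2)"
        using sum_squared_le_sum_of_squares[of "\<lambda>k. cmod (hs k x)" ?F] by (simp add: mult.commute)
      also have "\<dots> \<le> 7 * (\<Sum>k\<in>{- int N..int N}. (cmod (hs k x))\<^sup>2)"
      proof (intro mult_mono sum_mono2)
        have "card ?F \<le> card ?near" using card_integers_near[of x 3] by (intro card_mono) auto
        then show "real (card ?F) \<le> 7" using card_integers_near[of x 3] by simp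
      qed (auto intro: sum_nonneg)
      finally have "ennreal ((cmod (?S N x))\<^sup>2) \<le> ennreal (7 * (\<Sum>k\<in>{- int N..int N}. (cmod (hs k x))\<^sup>2))"
        by (rule ennreal_leI)
      then show "ennreal ((cmod (?S N x))\<^sup>2) \<le> 7 * (\<Sum>k\<in>{- int N..int N}. ennreal ((cmod (hs k x))\<^sup>2))"
        by (simp add: ennreal_mult sum_nonneg sum_ennreal)
    qed
    also have "\<dots> = 7 * (\<Sum>k\<in>{- int N..int N}. sqnorm (hs k))"
      by (simp add: nn_integral_cmult nn_integral_sum sqnorm_def del: sum_ennreal)
    also have "\<dots> \<le> 7 * (\<Sum>\<^sup>+k. sqnorm (hs k))"
      by (intro mult_left_mono sum_le_nn_integral_count_space) auto
    finally show ?thesis .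
  qed
  then have "sqnorm G \<le> 7 * (\<Sum>\<^sup>+k. sqnorm (hs k))"
    unfolding sqnorm_def[of G]
  proof (rule_tac nn_integral_le_of_tendsto)
    show "AE x in lborel. (\<lambda>N. ennreal ((cmod (?S N x))\<^sup>2)) \<longlonglongrightarrow> ennreal ((cmod (G x))\<^sup>2)"
      by (intro AE_I2 tendsto_ennrealI tendsto_power tendsto_norm lim)
  qed (auto simp: sqnorm_def)
  moreover have "7 * (\<Sum>\<^sup>+k. sqnorm (hs k)) < \<infinity>"
    using fin by (simp add: ennreal_mult_less_top)
  ultimately show ?thesis
    using lim by (intro exI[of _ G]) (auto simp: square_integrable_def)
qed

text \<open>Adds convergence of the pairings. The preceding lemma, applied to the moduli of the
  pieces, provides the square-integrable majorant H for dominated convergence.\<close>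

lemma almost_orthogonal_sum:
  fixes hs :: "int \<Rightarrow> real \<Rightarrow> complex"
  assumes sq: "\<And>k. square_integrable (hs k)"
    and supp: "\<And>k x. \<bar>x - of_int k\<bar> > 3 \<Longrightarrow> hs k x = 0"
    and fin: "(\<Sum>\<^sup>+k. sqnorm (hs k)) < \<infinity>"
  shows "\<exists>G. square_integrable G \<and> sqnorm G \<le> 7 * (\<Sum>\<^sup>+k. sqnorm (hs k)) \<and>
    (\<forall>\<phi>. square_integrable \<phi> \<longrightarrow>
      (\<lambda>N. \<Sum>k\<in>{- int N..int N}. \<integral>x. hs k x * \<phi> x \<partial>lborel) \<longlonglongrightarrow> (\<integral>x. G x * \<phi> x \<partial>lborel))"
proof -
  note [measurable] = square_integrable_measurable[OF sq]
  obtain G where G: "square_integrable G" "sqnorm G \<le> 7 * (\<Sum>\<^sup>+k. sqnorm (hs k))"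
    "\<And>x. (\<lambda>N. \<Sum>k\<in>{- int N..int N}. hs k x) \<longlonglongrightarrow> G x"
    using almost_orthogonal_limit[of hs] supp fin by (auto simp: square_integrable_measurable[OF sq])
  have "sqnorm (\<lambda>x. complex_of_real (cmod (hs k x))) = sqnorm (hs k)" for k by (simp add: sqnorm_def)
  then obtain H where H: "square_integrable H"
    "\<And>x. (\<lambda>N. \<Sum>k\<in>{- int N..int N}. complex_of_real (cmod (hs k x))) \<longlonglongrightarrow> H x"
    using almost_orthogonal_limit[of "\<lambda>k x. complex_of_real (cmod (hs k x))"] supp fin by auto
  have dom: "cmod (\<Sum>k\<in>{- int N..int N}. hs k x) \<le> cmod (H x)" for N x
  proof -
    have "incseq (\<lambda>N. \<Sum>k\<in>{- int N..int N}. cmod (hs k x))"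
      by (intro monoI sum_mono2) auto
    moreover have "(\<lambda>N. cmod (\<Sum>k\<in>{- int N..int N}. complex_of_real (cmod (hs k x)))) \<longlonglongrightarrow> cmod (H x)"
      by (intro tendsto_norm H)
    then have "(\<lambda>N. \<Sum>k\<in>{- int N..int N}. cmod (hs k x)) \<longlonglongrightarrow> cmod (H x)"
      by (simp add: sum_nonneg flip: of_real_sum)
    ultimately have "(\<Sum>k\<in>{- int N..int N}. cmod (hs k x)) \<le> cmod (H x)" by (rule incseq_le)
    then show ?thesis by (rule order_trans[OF norm_sum])
  qed
  have "(\<lambda>N. \<Sum>k\<in>{- int N..int N}. \<integral>x. hs k x * \<phi> x \<partial>lborel) \<longlonglongrightarrow> (\<integral>x. G x * \<phi> x \<partial>lborel)"
    if \<phi>: "square_integrable \<phi>" for \<phi>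
  proof -
    note [measurable] = square_integrable_measurable[OF \<phi>] square_integrable_measurable[OF G(1)]
    have "(\<lambda>N. \<integral>x. (\<Sum>k\<in>{- int N..int N}. hs k x) * \<phi> x \<partial>lborel) \<longlonglongrightarrow> (\<integral>x. G x * \<phi> x \<partial>lborel)"
    proof (rule integral_dominated_convergence[where w = "\<lambda>x. cmod (H x * \<phi> x)"])
      show "integrable lborel (\<lambda>x. cmod (H x * \<phi> x))"
        by (intro integrable_norm square_integrable_mult H \<phi>)
      show "AE x in lborel. (\<lambda>N. (\<Sum>k\<in>{- int N..int N}. hs k x) * \<phi> x) \<longlonglongrightarrow> G x * \<phi> x"
        by (intro AE_I2 tendsto_mult tendsto_const G)
      show "AE x in lborel. norm ((\<Sum>k\<in>{- int N..int N}. hs k x) * \<phi> x) \<le> cmod (H x * \<phi> x)" for N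
        using dom by (auto simp: norm_mult intro!: mult_right_mono)
    qed measurable
    moreover have "(\<integral>x. (\<Sum>k\<in>{- int N..int N}. hs k x) * \<phi> x \<partial>lborel) = (\<Sum>k\<in>{- int N..int N}. \<integral>x. hs k x * \<phi> x \<partial>lborel)" for N
      using square_integrable_mult[OF sq \<phi>] by (simp add: sum_distrib_right)
    ultimately show ?thesis by simp
  qed
  with G show ?thesis by blast
qed

section \<open>Comparison of the two norms\<close>

text \<open>Peetre's inequality, from 1 + |a| \<le> sqrt 2 <a> and submultiplicativity of 1 + |a|;
  the two square roots make up the factor 2.\<close>

lemma jbracket_add_le: "jbracket (a + b) \<le> 2 * jbracket a * jbracket b"
proof -
  have le: "1 + \<bar>a\<bar> \<le> sqrt 2 * jbracket a" for a
  proof -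
    have "(1 + \<bar>a\<bar>)\<^sup>2 \<le> 2 * (1 + \<bar>a\<bar>\<^sup>2)" using sum_squares_bound[of 1 "\<bar>a\<bar>"] by (simp add: power2_sum)
    then have "1 + \<bar>a\<bar> \<le> sqrt (2 * (1 + \<bar>a\<bar>\<^sup>2))" by (rule real_le_rsqrt)
    then show ?thesis by (simp only: jbracket_def real_sqrt_mult)
  qed
  have "jbracket (a + b) \<le> 1 + \<bar>a + b\<bar>" by (rule jbracket_le)
  also have "\<dots> \<le> (1 + \<bar>a\<bar>) * (1 + \<bar>b\<bar>)"
    using abs_triangle_ineq[of a b] mult_nonneg_nonneg[OF abs_ge_zero[of a] abs_ge_zero[of b]]
    unfolding distrib_left distrib_right by linarith
  also have "\<dots> \<le> (sqrt 2 * jbracket a) * (sqrt 2 * jbracket b)"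
    using jbracket_pos[of a] by (intro mult_mono le) auto
  also have "\<dots> = (sqrt 2 * sqrt 2) * jbracket a * jbracket b" by (simp only: mult_ac)
  finally show ?thesis by simp
qed

text \<open>The weight is comparable to its value at k on the support of the k-th piece. The base 8
  is the 2 of Peetre's inequality times <k - x> \<le> 1 + 3.\<close>

lemma jbracket_powr_near:
  assumes "\<theta> \<le> 0" "\<bar>x - k\<bar> \<le> 3"
  shows "jbracket (x - n) powr \<theta> \<le> 8 powr (- \<theta>) * jbracket (k - n) powr \<theta>"
proof -
  have "jbracket (k - n) \<le> 2 * jbracket (k - x) * jbracket (x - n)"
    using jbracket_add_le[of "k - x" "x - n"] by simp
  also have "\<dots> \<le> 8 * jbracket (x - n)"
    using jbracket_le[of "k - x"] assms(2) jbracket_pos[of "x - n"] by (intro mult_right_mono) auto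
  finally have "jbracket (k - n) / 8 \<le> jbracket (x - n)" by simp
  then have "jbracket (x - n) powr \<theta> \<le> (jbracket (k - n) / 8) powr \<theta>"
    using assms(1) jbracket_pos[of "k - n"] by (intro powr_mono2') auto
  also have "\<dots> = 8 powr (- \<theta>) * jbracket (k - n) powr \<theta>"
    using jbracket_pos[of "k - n"] by (simp add: powr_divide powr_minus_divide)
  finally show ?thesis .
qed

context
  fixes \<psi> :: "real \<Rightarrow> complex"
  assumes window: "modulation_window \<psi>"
begin

text \<open>The weight is moved onto each piece at the cost of the factor
  \<open>8 powr (- \<theta>)\<close>, squared here, and the bounded overlap contributes the 7. The
  sum G of the weighted pieces represents the weighted Fourier transform.\<close>

lemma L2_norm_weighted_fourier_le_of_pieces:
  assumes u: "u \<in> tempered_distributions" and \<theta>: "\<theta> \<le> 0"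
    and h: "\<And>k. square_integrable (h k)" and supp: "\<And>(k::int) x. \<bar>x - of_int k\<bar> > 3 \<Longrightarrow> h k x = 0"
    and rep: "\<And>k \<eta>. \<eta> \<in> schwartz \<Longrightarrow> fourier u (\<lambda>x. \<psi> (x - of_int k) * \<eta> x) = (\<integral>x. h k x * \<eta> x \<partial>lborel)"
    and fin: "(\<Sum>\<^sup>+k. ennreal (jbracket (of_int (k - n)) powr (2 * \<theta>)) * sqnorm (h k)) < \<infinity>"
  shows "(L2_norm (weighted_fourier \<theta> n u))\<^sup>2
    \<le> ennreal (7 * (8 powr (- \<theta>))\<^sup>2) *
      (\<Sum>\<^sup>+k. ennreal (jbracket (of_int (k - n)) powr (2 * \<theta>)) * sqnorm (h k))"
proof -
  define m where "m x = complex_of_real (jbracket (x - of_int n) powr \<theta>)" for x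
  have m: "m \<in> tame_smooth" unfolding m_def[abs_def] by (rule tame_smooth_jbracket)
  have mcont: "continuous_on UNIV m"
    by (intro continuous_at_imp_continuous_on ballI has_vector_derivative_continuous[OF all_derivs_has_vector_derivative[OF m]])
  have [measurable]: "m \<in> borel_measurable borel" by (rule borel_measurable_continuous_onI[OF mcont])
  have m_le: "cmod (m x) \<le> 1" for x
    using \<theta> jbracket_ge_1[of "x - of_int n"] powr_mono[of \<theta> 0 "jbracket (x - of_int n)"] by (simp add: m_def)
  note [measurable] = square_integrable_measurable[OF h]
  define c where "c = 8 powr (- \<theta>)"
  define hs where "hs k x = h k x * m x" for k x
  define W where "W = (\<Sum>\<^sup>+k. ennreal (jbracket (of_int (k - n)) powr (2 * \<theta>)) * sqnorm (h k))"
  have hs: "square_integrable (hs k)" for k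
    unfolding hs_def[abs_def] by (rule square_integrable_mult_bounded(1)[OF h _ m_le]) measurable
  have hs_le: "sqnorm (hs k) \<le> ennreal (c\<^sup>2) * (ennreal (jbracket (of_int (k - n)) powr (2 * \<theta>)) * sqnorm (h k))" for k
  proof -
    let ?j = "jbracket (of_int k - of_int n) powr \<theta>"
    have "sqnorm (hs k) \<le> ennreal ((c * ?j)\<^sup>2) * sqnorm (h k)"
    proof (rule sqnorm_mono)
      fix x
      show "cmod (hs k x) \<le> c * ?j * cmod (h k x)"
      proof (cases "\<bar>x - of_int k\<bar> > 3")
        case False
        then have "jbracket (x - of_int n) powr \<theta> \<le> c * ?j"
          unfolding c_def by (intro jbracket_powr_near \<theta>) auto
        then have "jbracket (x - of_int n) powr \<theta> * cmod (h k x) \<le> c * ?j * cmod (h k x)"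
          by (intro mult_right_mono) auto
        then show ?thesis by (simp add: hs_def m_def norm_mult mult.commute)
      qed (simp add: hs_def supp)
    qed (simp_all add: c_def)
    also have "(c * ?j)\<^sup>2 = c\<^sup>2 * jbracket (of_int (k - n)) powr (2 * \<theta>)"
      using jbracket_pos[of "of_int k - of_int n"] by (simp add: power_mult_distrib powr_power mult.commute)
    finally show ?thesis by (simp add: ennreal_mult mult.assoc)
  qed
  have sum_le: "(\<Sum>\<^sup>+k. sqnorm (hs k)) \<le> ennreal (c\<^sup>2) * W"
  proof -
    have "(\<Sum>\<^sup>+k. sqnorm (hs k))
        \<le> (\<Sum>\<^sup>+k. ennreal (c\<^sup>2) * (ennreal (jbracket (of_int (k - n)) powr (2 * \<theta>)) * sqnorm (h k)))"
      by (rule nn_integral_mono) (rule hs_le)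
    then show ?thesis by (simp add: W_def nn_integral_cmult)
  qed
  also have "\<dots> < \<infinity>" using fin by (simp add: W_def ennreal_mult_less_top)
  finally have fin': "(\<Sum>\<^sup>+k. sqnorm (hs k)) < \<infinity>" .
  have hs_supp: "hs k x = 0" if "\<bar>x - of_int k\<bar> > 3" for k x using supp[OF that] by (simp add: hs_def)
  from almost_orthogonal_sum[of hs, OF hs hs_supp fin'] obtain G where G: "square_integrable G" "sqnorm G \<le> 7 * (\<Sum>\<^sup>+k. sqnorm (hs k))"
    "\<And>\<phi>. square_integrable \<phi> \<Longrightarrow>
      (\<lambda>N. \<Sum>k\<in>{- int N..int N}. \<integral>x. hs k x * \<phi> x \<partial>lborel) \<longlonglongrightarrow> (\<integral>x. G x * \<phi> x \<partial>lborel)"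
    by blast
  have "mult_distr m (fourier u) \<phi> = (\<integral>x. G x * \<phi> x \<partial>lborel)" if \<phi>: "\<phi> \<in> schwartz" for \<phi>
  \<comment> \<open>Both sides are limits of the same partial sums: one by the window decomposition
    of the Fourier transform, the other by summation of the pieces.\<close>
  proof (rule LIMSEQ_unique)
    have s: "(\<lambda>x. m x * \<phi> x) \<in> schwartz" by (rule schwartz_mult[OF m \<phi>])
    show "(\<lambda>N. \<Sum>k\<in>{- int N..int N}. fourier u (\<lambda>x. \<psi> (x - of_int k) * (m x * \<phi> x))) \<longlonglongrightarrow> mult_distr m (fourier u) \<phi>"
      unfolding mult_distr_def by (rule fourier_window_decomposition[OF window u s])
    show "(\<lambda>N. \<Sum>k\<in>{- int N..int N}. fourier u (\<lambda>x. \<psi> (x - of_int k) * (m x * \<phi> x))) \<longlonglongrightarrow> (\<integral>x. G x * \<phi> x \<partial>lborel)"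
      using G(3)[OF schwartz_square_integrable[OF \<phi>]] by (simp add: rep[OF s] hs_def mult.assoc)
  qed
  then have "represents (mult_distr m (fourier u)) G" using G(1) by (simp add: represents_def)
  then have "(L2_norm (mult_distr m (fourier u)))\<^sup>2 \<le> sqnorm G" by (rule L2_norm_power2_lower)
  also have "\<dots> \<le> 7 * (ennreal (c\<^sup>2) * W)" using G(2) sum_le by (meson mult_left_mono order_trans zero_le)
  also have "\<dots> = ennreal (7 * c\<^sup>2) * W" by (simp add: ennreal_mult mult.assoc)
  finally show ?thesis by (simp add: m_def[abs_def] c_def W_def)
qed

text \<open>Near-optimal representatives of the pieces are chosen simultaneously, with errors that
  sum to at most e after all constants.\<close>

lemma L2_norm_weighted_fourier_le:
  assumes \<theta>: "\<theta> \<le> 0"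
  shows "\<exists>C>0. \<forall>u\<in>tempered_distributions. \<forall>n::int.
    (L2_norm (weighted_fourier \<theta> n u))\<^sup>2
    \<le> ennreal C * (\<Sum>\<^sup>+k. ennreal (jbracket (of_int (k - n)) powr (2 * \<theta>)) *
        (L2_norm (frequency_piece \<psi> k u))\<^sup>2)"
proof -
  obtain C0 where C0: "C0 > 0" and piece: "\<And>u (k::int) g. u \<in> tempered_distributions \<Longrightarrow>
    represents (frequency_piece \<psi> k u) g \<Longrightarrow>
    \<exists>h. square_integrable h \<and> sqnorm h \<le> ennreal C0 * sqnorm g \<and> (\<forall>x. \<bar>x - of_int k\<bar> > 3 \<longrightarrow> h x = 0) \<and>
      (\<forall>\<eta>\<in>schwartz. fourier u (\<lambda>x. \<psi> (x - of_int k) * \<eta> x) = (\<integral>x. h x * \<eta> x \<partial>lborel))"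
    using L2_window_piece[OF window] by blast
  define K where "K = (\<Sum>\<^sup>+k. ennreal (jbracket (of_int (k::int)) powr (- 2)))"
  have "K < top" unfolding K_def by (rule sum_jbracket_powr_finite) simp
  then obtain K' where K': "K' > 0" "K \<le> ennreal K'" by (rule bound_by_positive_real)
  define C where "C = 7 * (8 powr (- \<theta>))\<^sup>2 * C0"
  have "C > 0" using C0 by (simp add: C_def)
  have "(L2_norm (weighted_fourier \<theta> n u))\<^sup>2
    \<le> ennreal C * (\<Sum>\<^sup>+k. ennreal (jbracket (of_int (k - n)) powr (2 * \<theta>)) *
        (L2_norm (frequency_piece \<psi> k u))\<^sup>2)"
    if u: "u \<in> tempered_distributions" for u and n :: int
  proof (rule ennreal_le_epsilon)
    fix e :: real assume e: "e > 0"
    define w where "w k = ennreal (jbracket (of_int (k - n)) powr (2 * \<theta>))" for k :: int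
    define M where "M k = L2_norm (frequency_piece \<psi> k u)" for k :: int
    define S where "S = (\<Sum>\<^sup>+k. w k * (M k)\<^sup>2)"
    assume "ennreal C * (\<Sum>\<^sup>+k. ennreal (jbracket (of_int (k - n)) powr (2 * \<theta>)) *
        (L2_norm (frequency_piece \<psi> k u))\<^sup>2) < top"
    \<comment> \<open>With the right-hand side finite and all weights positive, every local norm is
      finite, so that every piece has a representative.\<close>
    then have "ennreal C * S < top" by (simp add: S_def w_def M_def)
    then have S: "S < top" using \<open>C > 0\<close> by (auto simp: ennreal_mult_less_top)
    have w_pos: "w k > 0" and w_le: "w k \<le> 1" for k
      using \<theta> jbracket_pos[of "of_int (k - n)"] jbracket_ge_1[of "of_int (k - n)"]
        powr_mono[of "2 * \<theta>" 0 "jbracket (of_int (k - n))"]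
      by (auto simp: w_def ennreal_le_1)
    have M_fin: "M k < \<infinity>" for k
    proof -
      have "w k * (M k)\<^sup>2 \<le> S" unfolding S_def by (rule nn_integral_ge_point) simp
      then have "w k * (M k)\<^sup>2 < top" using S by (rule le_less_trans)
      then have "(M k)\<^sup>2 < top" using w_pos[of k] by (auto simp: ennreal_mult_less_top)
      then show ?thesis by (simp add: power_less_top_ennreal)
    qed
    \<comment> \<open>The k-th piece gets the error \<epsilon> <k>^-2. These sum to at most
      \<epsilon> * K', and the factor C turns this into e.\<close>
    define \<epsilon> where "\<epsilon> = e / (C * K')"
    have \<epsilon>: "\<epsilon> > 0" using e \<open>C > 0\<close> K' by (simp add: \<epsilon>_def)
    have ex: "\<exists>h. square_integrable h \<and> sqnorm h \<le> ennreal C0 * ((M k)\<^sup>2 + ennreal (\<epsilon> * jbracket (of_int k) powr (- 2))) \<and>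
        (\<forall>x. \<bar>x - of_int k\<bar> > 3 \<longrightarrow> h x = 0) \<and>
        (\<forall>\<eta>\<in>schwartz. fourier u (\<lambda>x. \<psi> (x - of_int k) * \<eta> x) = (\<integral>x. h x * \<eta> x \<partial>lborel))" for k
    proof -
      obtain g where g: "represents (frequency_piece \<psi> k u) g"
        "sqnorm g \<le> (M k)\<^sup>2 + ennreal (\<epsilon> * jbracket (of_int k) powr (- 2))"
        using L2_norm_approx[OF M_fin[of k, unfolded M_def], of "\<epsilon> * jbracket (of_int k) powr (- 2)"]
          \<epsilon> jbracket_pos[of "of_int k"] by (auto simp: M_def)
      from piece[OF u g(1)] mult_left_mono[OF g(2), of "ennreal C0"] show ?thesis
        by (meson order_trans zero_le)
    qed
    from choice[OF allI[OF ex]] obtain h where "\<forall>k. square_integrable (h k) \<and>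
        sqnorm (h k) \<le> ennreal C0 * ((M k)\<^sup>2 + ennreal (\<epsilon> * jbracket (of_int k) powr (- 2))) \<and>
        (\<forall>x. \<bar>x - of_int k\<bar> > 3 \<longrightarrow> h k x = 0) \<and>
        (\<forall>\<eta>\<in>schwartz. fourier u (\<lambda>x. \<psi> (x - of_int k) * \<eta> x) = (\<integral>x. h k x * \<eta> x \<partial>lborel))" ..
    then have h: "\<And>k. square_integrable (h k)"
      "\<And>k. sqnorm (h k) \<le> ennreal C0 * ((M k)\<^sup>2 + ennreal (\<epsilon> * jbracket (of_int k) powr (- 2)))"
      "\<And>(k::int) x. \<bar>x - of_int k\<bar> > 3 \<Longrightarrow> h k x = 0"
      "\<And>k \<eta>. \<eta> \<in> schwartz \<Longrightarrow> fourier u (\<lambda>x. \<psi> (x - of_int k) * \<eta> x) = (\<integral>x. h k x * \<eta> x \<partial>lborel)"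
      by blast+
    have sum: "(\<Sum>\<^sup>+k. w k * sqnorm (h k)) \<le> ennreal C0 * (S + ennreal (\<epsilon> * K'))"
    proof -
      have "w k * sqnorm (h k) \<le> ennreal C0 * (w k * (M k)\<^sup>2 + ennreal \<epsilon> * ennreal (jbracket (of_int k) powr (- 2)))" for k
      proof -
        have "w k * sqnorm (h k) \<le> w k * (ennreal C0 * ((M k)\<^sup>2 + ennreal (\<epsilon> * jbracket (of_int k) powr (- 2))))"
          by (intro mult_left_mono h) auto
        also have "\<dots> = ennreal C0 * (w k * (M k)\<^sup>2 + w k * ennreal (\<epsilon> * jbracket (of_int k) powr (- 2)))"
          by (simp add: algebra_simps)
        also have "\<dots> \<le> ennreal C0 * (w k * (M k)\<^sup>2 + 1 * ennreal (\<epsilon> * jbracket (of_int k) powr (- 2)))"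
          by (intro mult_left_mono add_left_mono mult_right_mono w_le) auto
        finally show ?thesis using \<epsilon> by (simp add: ennreal_mult)
      qed
      then have "(\<Sum>\<^sup>+k. w k * sqnorm (h k))
          \<le> (\<Sum>\<^sup>+k. ennreal C0 * (w k * (M k)\<^sup>2 + ennreal \<epsilon> * ennreal (jbracket (of_int k) powr (- 2))))"
        by (intro nn_integral_mono)
      also have "\<dots> = ennreal C0 * (S + ennreal \<epsilon> * K)"
        by (simp add: nn_integral_cmult nn_integral_add S_def K_def)
      also have "\<dots> \<le> ennreal C0 * (S + ennreal \<epsilon> * ennreal K')"
        by (intro mult_left_mono add_left_mono K') auto
      finally show ?thesis using \<epsilon> K' by (simp add: ennreal_mult)
    qed
    also have "\<dots> < \<infinity>" using S by (simp add: ennreal_mult_less_top)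
    finally have fin: "(\<Sum>\<^sup>+k. w k * sqnorm (h k)) < \<infinity>" .
    have "(L2_norm (weighted_fourier \<theta> n u))\<^sup>2
        \<le> ennreal (7 * (8 powr (- \<theta>))\<^sup>2) * (\<Sum>\<^sup>+k. w k * sqnorm (h k))"
      unfolding w_def by (rule L2_norm_weighted_fourier_le_of_pieces[OF u \<theta> h(1,3,4) fin[unfolded w_def]])
    also have "\<dots> \<le> ennreal (7 * (8 powr (- \<theta>))\<^sup>2) * (ennreal C0 * (S + ennreal (\<epsilon> * K')))"
      by (intro mult_left_mono sum) auto
    also have "\<dots> = ennreal C * (S + ennreal (\<epsilon> * K'))"
      using C0 by (simp add: C_def ennreal_mult mult.assoc)
    also have "\<dots> = ennreal C * S + ennreal (C * (\<epsilon> * K'))"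
      using \<epsilon> K' \<open>C > 0\<close> by (simp add: distrib_left ennreal_mult)
    also have "C * (\<epsilon> * K') = e" using \<open>C > 0\<close> K' by (simp add: \<epsilon>_def)
    finally show "(L2_norm (weighted_fourier \<theta> n u))\<^sup>2
      \<le> ennreal C * (\<Sum>\<^sup>+k. ennreal (jbracket (of_int (k - n)) powr (2 * \<theta>)) *
        (L2_norm (frequency_piece \<psi> k u))\<^sup>2) + ennreal e"
      by (simp add: S_def w_def M_def)
  qed
  with \<open>C > 0\<close> show ?thesis by blast
qed

end

section \<open>Common treatment of the line and the circle, and conclusion\<close>

definition local_norm :: "line_or_circle \<Rightarrow> (real \<Rightarrow> complex) \<Rightarrow> functional \<Rightarrow> int \<Rightarrow> ennreal" where
  "local_norm M \<psi> f k = (case M of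
     Line \<Rightarrow> L2_norm (frequency_piece \<psi> k f)
   | Circle \<Rightarrow> ennreal (cmod (fourier_coeff f k)))"

definition weighted_norm :: "line_or_circle \<Rightarrow> real \<Rightarrow> functional \<Rightarrow> int \<Rightarrow> ennreal" where
  "weighted_norm M \<theta> f n = (case M of
     Line \<Rightarrow> L2_norm (weighted_fourier \<theta> n f)
   | Circle \<Rightarrow> lp_norm 2 (\<lambda>k. ennreal (jbracket (of_int (k - n)) powr \<theta> * cmod (fourier_coeff f k))))"

lemma MH_norm_eq: "MH_norm M \<theta> p f = lp_norm p (weighted_norm M \<theta> f)"
  by (cases M) (simp_all add: weighted_norm_def[abs_def])

lemma M2_norm_eq: "M2_norm M \<psi> s p f = lp_norm p (\<lambda>n. ennreal (jbracket (of_int n) powr s) * local_norm M \<psi> f n)"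
  by (cases M) (simp_all add: local_norm_def[abs_def] modulation_norm_line_def FL_norm_circle_def ennreal_mult)

lemma M2_norm_0_eq: "M2_norm M \<psi> 0 p f = lp_norm p (local_norm M \<psi> f)"
  using jbracket_pos by (simp add: M2_norm_eq less_imp_neq[symmetric])

text \<open>On the circle the domination is an equality with constant 1: each piece is a single
  Fourier coefficient.\<close>

lemma weighted_norm_Circle_power2:
  "(weighted_norm Circle \<theta> f n)\<^sup>2 = (\<Sum>\<^sup>+k. ennreal (jbracket (of_int (k - n)) powr (2 * \<theta>)) * (local_norm Circle \<psi> f k)\<^sup>2)"
proof -
  have "epowr (ennreal (jbracket (of_int (k - n)) powr \<theta> * cmod (fourier_coeff f k))) 2
      = ennreal (jbracket (of_int (k - n)) powr (2 * \<theta>)) * (local_norm Circle \<psi> f k)\<^sup>2" for k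
    using jbracket_pos[of "of_int (k - n)"]
    by (simp add: local_norm_def ennreal_mult epowr_mult epowr_jbracket mult.commute flip: epowr_2)
  then show ?thesis
    by (simp add: weighted_norm_def numeral_eq_ereal lp_norm_finite epowr_epowr flip: epowr_2)
qed

lemma weighted_norm_peetre_dominated:
  assumes "modulation_window \<psi>" "\<theta> \<le> 0"
  shows "\<exists>C>0. \<forall>f\<in>distributions M. peetre_dominated \<theta> C (weighted_norm M \<theta> f) (local_norm M \<psi> f)"
proof (cases M)
  case Line
  then show ?thesis
    using L2_norm_weighted_fourier_le[OF assms] by (simp add: peetre_dominated_def weighted_norm_def local_norm_def)
next
  case Circle
  then show ?thesis
    by (intro exI[of _ 1]) (simp add: peetre_dominated_def weighted_norm_Circle_power2[where \<psi> = \<psi>])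
qed

text \<open>On the circle this is the single term k = n of the inner sum, where the weight is 1; on
  the line it is the Plancherel estimate for one window. Neither restricts \<theta>.\<close>

lemma local_norm_le_weighted_norm:
  assumes "modulation_window \<psi>"
  shows "\<exists>C>0. \<forall>f\<in>distributions M. \<forall>n. local_norm M \<psi> f n \<le> ennreal C * weighted_norm M \<theta> f n"
proof (cases M)
  case Line
  then show ?thesis
    using L2_norm_window_le[OF assms, of \<theta>] by (simp add: weighted_norm_def local_norm_def)
next
  case Circle
  have "local_norm Circle \<psi> f n \<le> weighted_norm Circle \<theta> f n" for f n
  proof -
    have "(local_norm Circle \<psi> f n)\<^sup>2 = ennreal (jbracket (of_int (n - n)) powr (2 * \<theta>)) * (local_norm Circle \<psi> f n)\<^sup>2"
      by simp
    also have "\<dots> \<le> (weighted_norm Circle \<theta> f n)\<^sup>2"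
      unfolding weighted_norm_Circle_power2[where \<psi> = \<psi>] by (rule nn_integral_ge_point) simp
    finally show ?thesis by (rule le_epowr_half[THEN order_trans]) (simp add: epowr_epowr flip: epowr_2)
  qed
  then show ?thesis using Circle by (intro exI[of _ 1]) auto
qed

lemma M2_norm_lesssim_MH_norm:
  assumes "modulation_window \<psi>" "2 \<le> p"
  shows "lesssim_on (distributions M) (M2_norm M \<psi> 0 p) (MH_norm M \<theta> p)"
proof -
  obtain C where C: "C > 0" "\<And>f n. f \<in> distributions M \<Longrightarrow> local_norm M \<psi> f n \<le> ennreal C * weighted_norm M \<theta> f n"
    using local_norm_le_weighted_norm[OF assms(1)] by blast
  have "M2_norm M \<psi> 0 p f \<le> ennreal C * MH_norm M \<theta> p f" if "f \<in> distributions M" for f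
    unfolding M2_norm_0_eq MH_norm_eq lp_norm_cmult[OF assms(2), symmetric]
    by (intro lp_norm_mono assms C that)
  with C(1) show ?thesis unfolding lesssim_on_def by blast
qed

text \<open>B is a functional on sequences, which lets the upper bounds by the l^p, l^q and weighted
  l^p norms share one argument. The constant of the domination is fixed first, and the final one
  depends on f only through it, hence not at all.\<close>

lemma MH_norm_lesssim:
  assumes "modulation_window \<psi>" "\<theta> \<le> 0"
    and bound: "\<And>C. \<exists>C'>0. \<forall>H a. peetre_dominated \<theta> C H a \<longrightarrow> lp_norm p H \<le> ennreal C' * B a"
    and B: "\<And>f. B (local_norm M \<psi> f) = A f"
  shows "lesssim_on (distributions M) (MH_norm M \<theta> p) A"
proof -
  obtain C where C: "\<And>f. f \<in> distributions M \<Longrightarrow> peetre_dominated \<theta> C (weighted_norm M \<theta> f) (local_norm M \<psi> f)"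
    using weighted_norm_peetre_dominated[OF assms(1,2)] by blast
  obtain C' where "C' > 0" "\<And>H a. peetre_dominated \<theta> C H a \<Longrightarrow> lp_norm p H \<le> ennreal C' * B a"
    using bound[of C] by blast
  with C show ?thesis unfolding lesssim_on_def MH_norm_eq B[symmetric] by blast
qed

theorem lemma1p2:
  fixes M :: line_or_circle and \<psi> :: "real \<Rightarrow> complex"
  assumes "modulation_window \<psi>"
  shows "(\<forall>(\<theta>::real) (p::ereal). \<theta> < - 1 / 2 \<and> 2 \<le> p \<and> p \<le> \<infinity> \<longrightarrow>
            sim_on (distributions M) (MH_norm M \<theta> p) (M2_norm M \<psi> 0 p))
       \<and> (\<forall>(\<theta>::real) (p::ereal) (q::ereal) (s::real).
            - 1 / 2 \<le> \<theta> \<and> \<theta> < 0 \<and> 2 \<le> q \<and> q < p \<and> p \<le> \<infinity> \<and>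
            1 / q > 1 / p + 1 / 2 + ereal \<theta> \<and> s > 1 / 2 + \<theta> \<longrightarrow>
            lesssim_on (distributions M) (M2_norm M \<psi> 0 p) (MH_norm M \<theta> p) \<and>
            lesssim_on (distributions M) (MH_norm M \<theta> p) (M2_norm M \<psi> 0 q) \<and>
            lesssim_on (distributions M) (MH_norm M \<theta> p) (M2_norm M \<psi> s p))"
proof (intro conjI allI impI; elim conjE)
  fix \<theta> :: real and p :: ereal
  assume \<theta>: "\<theta> < - 1 / 2" and p: "2 \<le> p"
  have "lesssim_on (distributions M) (MH_norm M \<theta> p) (M2_norm M \<psi> 0 p)"
    using \<theta> p by (intro MH_norm_lesssim[OF assms, where B = "lp_norm p"] peetre_dominated_diag M2_norm_0_eq[symmetric]) auto
  then show "sim_on (distributions M) (MH_norm M \<theta> p) (M2_norm M \<psi> 0 p)"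
    using M2_norm_lesssim_MH_norm[OF assms p] by (simp add: sim_on_def)
next
  fix \<theta> :: real and p q :: ereal and s :: real
  assume a: "- 1 / 2 \<le> \<theta>" "\<theta> < 0" "2 \<le> q" "q < p" "1 / q > 1 / p + 1 / 2 + ereal \<theta>" "s > 1 / 2 + \<theta>"
  have "2 \<le> p" using a(3,4) by (meson less_imp_le order_trans)
  then show "lesssim_on (distributions M) (M2_norm M \<psi> 0 p) (MH_norm M \<theta> p)"
    by (rule M2_norm_lesssim_MH_norm[OF assms])
  show "lesssim_on (distributions M) (MH_norm M \<theta> p) (M2_norm M \<psi> 0 q)"
    by (rule MH_norm_lesssim[OF assms less_imp_le[OF a(2)] peetre_dominated_offdiag[OF a(2-5)]])
       (rule M2_norm_0_eq[symmetric])
  show "lesssim_on (distributions M) (MH_norm M \<theta> p) (M2_norm M \<psi> s p)"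
    by (rule MH_norm_lesssim[OF assms less_imp_le[OF a(2)] peetre_dominated_weighted[OF a]])
       (rule M2_norm_eq[symmetric])
qed

end
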